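(* Let $A$ be an Auslander algebra. Let $E$ be an injective $A$-module such that $\operatorname{End}_A(E)$ is a semisimple algebra and $\operatorname{Hom}_A(E,Q)=0$ for all projective-injective $A$-modules $Q$. Let $R=\operatorname{End}_A(E)^{op}$ and let $$A[E]=\begin{bmatrix}R&0\\ {}_AE_R&A\end{bmatrix}$$ be the triangular matrix algebra of $A$ and the $A$-$\operatorname{End}_A(E)^{op}$-bimodule $E$. Then there is a tilting $A[E]$-module in the subcategory $\mathcal{C}_{A[E]}$.
   Context: All modules are finitely generated left modules over artin algebras. An Auslander algebra is an artin algebra $A$ with $\operatorname{gldim}A\le 2\le\operatorname{domdim}A$, where for a minimal injective resolution $0\to{}_AA\to I_0\to I_1\to\cdots$, $\operatorname{domdim}A=\sup\{k\mid I_i\text{ is projective for all }0\le i<k\}$. The multiplication in $A[E]$ is matrix multiplication using the bimodule structure of ${}_AE_R$. For an artin algebra $\Lambda$, let $\widetilde{Q}$ be the direct sum of representatives of the isomorphism classes of all indecomposable projective-injective $\Lambda$-modules; $\mathcal{C}_\Lambda=(\operatorname{Gen}\widetilde{Q})\cap(\operatorname{Cogen}\widetilde{Q})$ is the full subcategory of modules $M$ that admit both an epimorphism $\widetilde{Q}^m\to M$ and a monomorphism $M\to\widetilde{Q}^{m'}$ for some $m,m'$. A basic $\Lambda$-module $T$ is tilting if (1) $\operatorname{projdim}T\le 1$, (2) $\operatorname{Ext}^1_\Lambda(T,T)=0$, (3) there is an exact sequence $0\to\Lambda\to T_0\to T_1\to 0$ with $T_0,T_1\in\operatorname{add}T$.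 *)

theory Defs
  imports "HOL-Algebra.Module" "HOL-Algebra.QuotRing" "HOL-Algebra.Elementary_Groups"
    "HOL-Library.Extended_Nat"
begin

section \<open>Finitely generated left modules\<close>

text \<open>The library locale \<^locale>\<open>module\<close> requires a commutative base ring; here the base ring is
  arbitrary. The ring-multiplicative fields of the module record are not used.\<close>

locale left_module = R?: ring R + M?: abelian_group M
  for R :: "('a, 'm) ring_scheme" (structure) and M :: "('a, 'b, 'c) module_scheme" (structure) +
  assumes smult_closed [simp, intro]:
      "\<lbrakk>a \<in> carrier R; x \<in> carrier M\<rbrakk> \<Longrightarrow> a \<odot>\<^bsub>M\<^esub> x \<in> carrier M"
    and smult_l_distr:
      "\<lbrakk>a \<in> carrier R; b \<in> carrier R; x \<in> carrier M\<rbrakk> \<Longrightarrow>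
      (a \<oplus> b) \<odot>\<^bsub>M\<^esub> x = a \<odot>\<^bsub>M\<^esub> x \<oplus>\<^bsub>M\<^esub> b \<odot>\<^bsub>M\<^esub> x"
    and smult_r_distr:
      "\<lbrakk>a \<in> carrier R; x \<in> carrier M; y \<in> carrier M\<rbrakk> \<Longrightarrow>
      a \<odot>\<^bsub>M\<^esub> (x \<oplus>\<^bsub>M\<^esub> y) = a \<odot>\<^bsub>M\<^esub> x \<oplus>\<^bsub>M\<^esub> a \<odot>\<^bsub>M\<^esub> y"
    and smult_assoc1:
      "\<lbrakk>a \<in> carrier R; b \<in> carrier R; x \<in> carrier M\<rbrakk> \<Longrightarrow>
      (a \<otimes> b) \<odot>\<^bsub>M\<^esub> x = a \<odot>\<^bsub>M\<^esub> (b \<odot>\<^bsub>M\<^esub> x)"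
    and smult_one [simp]:
      "x \<in> carrier M \<Longrightarrow> \<one> \<odot>\<^bsub>M\<^esub> x = x"

definition fg_module :: "('a, 'm) ring_scheme \<Rightarrow> ('a, 'b) module \<Rightarrow> bool" where
  "fg_module A M \<longleftrightarrow> left_module A M \<and>
     (\<exists>S. finite S \<and> S \<subseteq> carrier M \<and>
        (\<forall>H. submodule H A M \<and> S \<subseteq> H \<longrightarrow> H = carrier M))"

text \<open>Quantification over all finitely generated modules needs one fixed carrier type. A finitely
  generated module over a ring with elements of type \<open>'a\<close> is a quotient of a free module of
  finite rank, so up to isomorphism its carrier consists of sets of functions
  \<open>nat \<Rightarrow> 'a\<close>; see \<open>fg_module_iso_umod\<close> below.\<close>

type_synonym 'a umod = "('a, (nat \<Rightarrow> 'a) set) module"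

definition fg_mods :: "('a, 'm) ring_scheme \<Rightarrow> 'a umod set" where
  "fg_mods A = {M. fg_module A M}"

definition zero_module :: "('a, 'b) module \<Rightarrow> bool" where
  "zero_module M \<longleftrightarrow> carrier M = {\<zero>\<^bsub>M\<^esub>}"

definition mod_hom :: "('a, 'm) ring_scheme \<Rightarrow> ('a, 'b) module \<Rightarrow> ('a, 'c) module \<Rightarrow> ('b \<Rightarrow> 'c) set"
  where "mod_hom A M N = {f \<in> carrier M \<rightarrow>\<^sub>E carrier N.
     (\<forall>x\<in>carrier M. \<forall>y\<in>carrier M. f (x \<oplus>\<^bsub>M\<^esub> y) = f x \<oplus>\<^bsub>N\<^esub> f y) \<and>
     (\<forall>a\<in>carrier A. \<forall>x\<in>carrier M. f (a \<odot>\<^bsub>M\<^esub> x) = a \<odot>\<^bsub>N\<^esub> f x)}"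

definition zero_hom :: "('a, 'b) module \<Rightarrow> ('a, 'c) module \<Rightarrow> 'b \<Rightarrow> 'c" where
  "zero_hom M N = (\<lambda>x\<in>carrier M. \<zero>\<^bsub>N\<^esub>)"

definition mod_ker :: "('a, 'b) module \<Rightarrow> ('a, 'c) module \<Rightarrow> ('b \<Rightarrow> 'c) \<Rightarrow> 'b set" where
  "mod_ker M N f = {x \<in> carrier M. f x = \<zero>\<^bsub>N\<^esub>}"

definition mono_hom :: "('a, 'm) ring_scheme \<Rightarrow> ('a, 'b) module \<Rightarrow> ('a, 'c) module \<Rightarrow> ('b \<Rightarrow> 'c) \<Rightarrow> bool"
  where "mono_hom A M N f \<longleftrightarrow> f \<in> mod_hom A M N \<and> inj_on f (carrier M)"

definition epi_hom :: "('a, 'm) ring_scheme \<Rightarrow> ('a, 'b) module \<Rightarrow> ('a, 'c) module \<Rightarrow> ('b \<Rightarrow> 'c) \<Rightarrow> bool"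
  where "epi_hom A M N f \<longleftrightarrow> f \<in> mod_hom A M N \<and> f ` carrier M = carrier N"

definition mod_iso :: "('a, 'm) ring_scheme \<Rightarrow> ('a, 'b) module \<Rightarrow> ('a, 'c) module \<Rightarrow> bool" where
  "mod_iso A M N \<longleftrightarrow> (\<exists>f\<in>mod_hom A M N. bij_betw f (carrier M) (carrier N))"

lemma (in left_module) submoduleI:
  assumes "H \<subseteq> carrier M" and "\<zero>\<^bsub>M\<^esub> \<in> H"
    and "\<And>x. x \<in> H \<Longrightarrow> \<ominus>\<^bsub>M\<^esub> x \<in> H"
    and "\<And>x y. \<lbrakk>x \<in> H; y \<in> H\<rbrakk> \<Longrightarrow> x \<oplus>\<^bsub>M\<^esub> y \<in> H"
    and "\<And>a x. \<lbrakk>a \<in> carrier R; x \<in> H\<rbrakk> \<Longrightarrow> a \<odot>\<^bsub>M\<^esub> x \<in> H"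
  shows "submodule H R M"
  using assms by (auto intro!: submodule.intro subgroup.intro submodule_axioms.intro simp: a_inv_def)

lemma transport_module:
  fixes A :: "('a, 'm) ring_scheme" and M :: "('a, 'b) module" and F :: "'b \<Rightarrow> 'd"
  assumes M: "fg_module A M" and F: "inj_on F (carrier M)"
  shows "\<exists>N. fg_module A N \<and> carrier N = F ` carrier M \<and> mod_iso A M N"
proof -
  interpret left_module A M using M unfolding fg_module_def by simp
  obtain S where S: "finite S" "S \<subseteq> carrier M"
    "\<And>H. submodule H A M \<Longrightarrow> S \<subseteq> H \<Longrightarrow> H = carrier M"
    using M unfolding fg_module_def by (elim conjE exE) (rule that; assumption?; simp)
  define G where "G = the_inv_into (carrier M) F"
  have GF [simp]: "G (F x) = x" if "x \<in> carrier M" for x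
    using that F by (simp add: G_def the_inv_into_f_f)
  define N :: "('a, 'd) module" where "N = \<lparr>carrier = F ` carrier M, monoid.mult = undefined, one = undefined,
    zero = F \<zero>\<^bsub>M\<^esub>, add = (\<lambda>u v. F (G u \<oplus>\<^bsub>M\<^esub> G v)), smult = (\<lambda>a u. F (a \<odot>\<^bsub>M\<^esub> G u))\<rparr>"
  have ab: "abelian_group N"
  proof (rule abelian_groupI)
    fix x assume "x \<in> carrier N"
    then obtain u where u: "u \<in> carrier M" "x = F u" by (auto simp: N_def)
    then show "\<exists>y\<in>carrier N. y \<oplus>\<^bsub>N\<^esub> x = \<zero>\<^bsub>N\<^esub>"
      by (intro bexI[of _ "F (\<ominus>\<^bsub>M\<^esub> u)"]) (auto simp: N_def M.l_neg)
  qed (auto simp: N_def M.a_ac)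
  have lm: "left_module A N"
    by (intro left_module.intro left_module_axioms.intro ab R.ring_axioms)
      (auto simp: N_def smult_l_distr smult_r_distr smult_assoc1)
  have sub: "submodule {x \<in> carrier M. F x \<in> H} A M" if H: "submodule H A N" for H
  proof -
    interpret N: left_module A N by (rule lm)
    interpret H: submodule H A N by (rule H)
    have z: "F \<zero>\<^bsub>M\<^esub> \<in> H" using H.one_closed by (simp add: N_def)
    have pl: "F (x \<oplus>\<^bsub>M\<^esub> y) \<in> H" if "x \<in> carrier M" "y \<in> carrier M" "F x \<in> H" "F y \<in> H" for x y
      using H.m_closed[OF that(3,4)] that(1,2) by (simp add: N_def)
    have sm: "F (a \<odot>\<^bsub>M\<^esub> x) \<in> H" if "a \<in> carrier A" "x \<in> carrier M" "F x \<in> H" for a x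
      using H.smult_closed[OF that(1,3)] that(2) by (simp add: N_def)
    have ng: "F (\<ominus>\<^bsub>M\<^esub> x) \<in> H" if "x \<in> carrier M" "F x \<in> H" for x
    proof -
      have "\<ominus>\<^bsub>N\<^esub> (F x) \<in> H" using H.m_inv_closed[OF that(2)] by (simp add: a_inv_def)
      moreover have "\<ominus>\<^bsub>N\<^esub> (F x) = F (\<ominus>\<^bsub>M\<^esub> x)"
        by (rule N.minus_equality) (use that in \<open>auto simp: N_def M.l_neg\<close>)
      ultimately show ?thesis by simp
    qed
    show ?thesis
      by (intro submoduleI) (use z pl sm ng in auto)
  qed
  have "\<exists>S. finite S \<and> S \<subseteq> carrier N \<and> (\<forall>H. submodule H A N \<and> S \<subseteq> H \<longrightarrow> H = carrier N)"
  proof (intro exI[of _ "F ` S"] conjI allI impI)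
    fix H assume H: "submodule H A N \<and> F ` S \<subseteq> H"
    then have "{x \<in> carrier M. F x \<in> H} = carrier M"
      using S(2) by (intro S(3) sub) auto
    moreover have "H \<subseteq> carrier N" using H submodule.axioms(1) subgroup.subset by fastforce
    ultimately show "H = carrier N" by (auto simp: N_def)
  qed (use S in \<open>auto simp: N_def\<close>)
  then have "fg_module A N" using lm by (simp add: fg_module_def)
  moreover have "mod_iso A M N"
    unfolding mod_iso_def mod_hom_def
    by (intro bexI[of _ "restrict F (carrier M)"])
      (use F in \<open>auto simp: N_def bij_betw_def inj_on_def\<close>)
  ultimately show ?thesis by (auto simp: N_def)
qed

lemma fg_module_iso_umod:
  fixes A :: "('a, 'm) ring_scheme"
  assumes M: "fg_module A M"
  shows "\<exists>N\<in>fg_mods A. mod_iso A M N"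
proof -
  interpret left_module A M using M unfolding fg_module_def by simp
  obtain S where S: "finite S" "S \<subseteq> carrier M"
    "\<And>H. submodule H A M \<Longrightarrow> S \<subseteq> H \<Longrightarrow> H = carrier M"
    using M unfolding fg_module_def by (elim conjE exE) (rule that; assumption?; simp)
  obtain s and n :: nat where s: "S = s ` {..<n}"
    using S(1) by (auto simp: finite_conv_nat_seg_image lessThan_def)
  then have sM: "s i \<in> carrier M" if "i < n" for i using that S(2) by auto
  define comb where "comb c = (\<Oplus>\<^bsub>M\<^esub>i\<in>{..<n}. c i \<odot>\<^bsub>M\<^esub> s i)" for c
  define D where "D = ({..<n} \<rightarrow>\<^sub>E carrier A)"
  have D: "c i \<in> carrier A" if "c \<in> D" "i < n" for c i using that by (auto simp: D_def)
  have cl: "comb c \<in> carrier M" if "c \<in> D" for c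
    unfolding comb_def by (intro M.finsum_closed) (use D[OF that] sM in auto)
  have cong: "comb (restrict f {..<n}) = (\<Oplus>\<^bsub>M\<^esub>i\<in>{..<n}. f i \<odot>\<^bsub>M\<^esub> s i)"
    if "\<And>i. i < n \<Longrightarrow> f i \<in> carrier A" for f
    unfolding comb_def by (intro M.finsum_cong') (use that sM in auto)
  have add: "comb c \<oplus>\<^bsub>M\<^esub> comb d \<in> comb ` D" if "c \<in> D" "d \<in> D" for c d
  proof (rule image_eqI)
    show "(\<lambda>i\<in>{..<n}. c i \<oplus>\<^bsub>A\<^esub> d i) \<in> D" using that by (auto simp: D_def)
    show "comb c \<oplus>\<^bsub>M\<^esub> comb d = comb (\<lambda>i\<in>{..<n}. c i \<oplus>\<^bsub>A\<^esub> d i)"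
    proof -
      have "(\<Oplus>\<^bsub>M\<^esub>i\<in>{..<n}. (c i \<oplus>\<^bsub>A\<^esub> d i) \<odot>\<^bsub>M\<^esub> s i)
          = (\<Oplus>\<^bsub>M\<^esub>i\<in>{..<n}. c i \<odot>\<^bsub>M\<^esub> s i \<oplus>\<^bsub>M\<^esub> d i \<odot>\<^bsub>M\<^esub> s i)"
        by (intro M.finsum_cong') (use D[OF that(1)] D[OF that(2)] sM in \<open>auto simp: smult_l_distr\<close>)
      also have "\<dots> = comb c \<oplus>\<^bsub>M\<^esub> comb d"
        unfolding comb_def
        by (intro M.finsum_addf) (use D[OF that(1)] D[OF that(2)] sM in auto)
      finally show ?thesis using D[OF that(1)] D[OF that(2)] by (simp add: cong)
    qed
  qed
  have fin: "a \<odot>\<^bsub>M\<^esub> (\<Oplus>\<^bsub>M\<^esub>i\<in>J. f i) = (\<Oplus>\<^bsub>M\<^esub>i\<in>J. a \<odot>\<^bsub>M\<^esub> f i)"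
    if "finite J" "f \<in> J \<rightarrow> carrier M" "a \<in> carrier A" for a f and J :: "nat set"
    using that
  proof (induction J rule: finite_induct)
    case empty
    have "a \<odot>\<^bsub>M\<^esub> \<zero>\<^bsub>M\<^esub> \<oplus>\<^bsub>M\<^esub> a \<odot>\<^bsub>M\<^esub> \<zero>\<^bsub>M\<^esub> = a \<odot>\<^bsub>M\<^esub> \<zero>\<^bsub>M\<^esub>"
      using empty by (simp flip: smult_r_distr)
    then have "a \<odot>\<^bsub>M\<^esub> \<zero>\<^bsub>M\<^esub> = \<zero>\<^bsub>M\<^esub>"
      using empty by (simp add: M.add.l_cancel_one)
    then show ?case by simp
  next
    case (insert i J)
    then have "f i \<in> carrier M" "f \<in> J \<rightarrow> carrier M" by auto
    then show ?case using insert
      by (subst (1 2) M.finsum_insert) (auto simp: smult_r_distr Pi_iff)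
  qed
  have sm: "a \<odot>\<^bsub>M\<^esub> comb c \<in> comb ` D" if "c \<in> D" "a \<in> carrier A" for a c
  proof (rule image_eqI)
    show "(\<lambda>i\<in>{..<n}. a \<otimes>\<^bsub>A\<^esub> c i) \<in> D" using that by (auto simp: D_def)
    have "a \<odot>\<^bsub>M\<^esub> comb c = (\<Oplus>\<^bsub>M\<^esub>i\<in>{..<n}. a \<odot>\<^bsub>M\<^esub> (c i \<odot>\<^bsub>M\<^esub> s i))"
      unfolding comb_def by (intro fin) (use D[OF that(1)] that sM in auto)
    also have "\<dots> = (\<Oplus>\<^bsub>M\<^esub>i\<in>{..<n}. (a \<otimes>\<^bsub>A\<^esub> c i) \<odot>\<^bsub>M\<^esub> s i)"
      by (intro M.finsum_cong') (use D[OF that(1)] that sM in \<open>auto simp: smult_assoc1\<close>)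
    finally show "a \<odot>\<^bsub>M\<^esub> comb c = comb (\<lambda>i\<in>{..<n}. a \<otimes>\<^bsub>A\<^esub> c i)"
      using D[OF that(1)] that by (simp add: cong)
  qed
  have zl: "\<zero>\<^bsub>A\<^esub> \<odot>\<^bsub>M\<^esub> x = \<zero>\<^bsub>M\<^esub>" if "x \<in> carrier M" for x
    using smult_l_distr[of "\<zero>\<^bsub>A\<^esub>" "\<zero>\<^bsub>A\<^esub>" x] that by (simp add: M.add.l_cancel_one)
  have unit: "s j \<in> comb ` D" if "j < n" for j
  proof (rule image_eqI)
    show "(\<lambda>i\<in>{..<n}. if i = j then \<one>\<^bsub>A\<^esub> else \<zero>\<^bsub>A\<^esub>) \<in> D" by (auto simp: D_def)
    have "(\<Oplus>\<^bsub>M\<^esub>i\<in>{..<n}. (if i = j then \<one>\<^bsub>A\<^esub> else \<zero>\<^bsub>A\<^esub>) \<odot>\<^bsub>M\<^esub> s i)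
        = (\<Oplus>\<^bsub>M\<^esub>i\<in>{..<n}. if j = i then s i else \<zero>\<^bsub>M\<^esub>)"
      by (intro M.finsum_cong') (use sM zl in auto)
    also have "\<dots> = s j"
      using M.finsum_singleton[of j "{..<n}" s] that sM by auto
    finally show "s j = comb (\<lambda>i\<in>{..<n}. if i = j then \<one>\<^bsub>A\<^esub> else \<zero>\<^bsub>A\<^esub>)"
      by (simp add: cong)
  qed
  have ng: "\<ominus>\<^bsub>M\<^esub> x = (\<ominus>\<^bsub>A\<^esub> \<one>\<^bsub>A\<^esub>) \<odot>\<^bsub>M\<^esub> x" if "x \<in> carrier M" for x
    by (rule M.minus_equality)
      (use that smult_l_distr[of "\<ominus>\<^bsub>A\<^esub> \<one>\<^bsub>A\<^esub>" "\<one>\<^bsub>A\<^esub>" x] zl in \<open>auto simp: R.l_neg\<close>)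
  have "D \<noteq> {}" by (auto simp: D_def PiE_eq_empty_iff)
  then obtain c where c: "c \<in> D" by blast
  have "\<zero>\<^bsub>M\<^esub> \<in> comb ` D" using sm[OF c R.zero_closed] zl[OF cl[OF c]] by simp
  then have "submodule (comb ` D) A M"
    using add sm cl ng by (intro submoduleI) auto
  then have all: "comb ` D = carrier M"
    by (rule S(3)) (use unit s in auto)
  have "inj_on (\<lambda>x. {c \<in> D. comb c = x}) (carrier M)"
  proof (rule inj_onI)
    fix x y assume "x \<in> carrier M" and eq: "{c \<in> D. comb c = x} = {c \<in> D. comb c = y}"
    then obtain c where "c \<in> D" "comb c = x" using all by (metis imageE)
    then have "c \<in> {c \<in> D. comb c = x}" by simp
    then show "x = y" unfolding eq using \<open>comb c = x\<close> by simp
  qed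
  from transport_module[OF M this] show ?thesis by (auto simp: fg_mods_def)
qed

definition short_exact :: "('a, 'm) ring_scheme \<Rightarrow> ('a, 'b) module \<Rightarrow> ('b \<Rightarrow> 'c) \<Rightarrow>
    ('a, 'c) module \<Rightarrow> ('c \<Rightarrow> 'd) \<Rightarrow> ('a, 'd) module \<Rightarrow> bool" where
  "short_exact A X f Y g Z \<longleftrightarrow>
     mono_hom A X Y f \<and> f ` carrier X = mod_ker Y Z g \<and> epi_hom A Y Z g"

definition scalar_module :: "('k \<Rightarrow> 'a) \<Rightarrow> ('a, 'm) ring_scheme \<Rightarrow> ('k, 'a) module" where
  "scalar_module \<phi> A = \<lparr>carrier = carrier A, monoid.mult = monoid.mult A, one = \<one>\<^bsub>A\<^esub>,
     zero = \<zero>\<^bsub>A\<^esub>, add = add A, smult = (\<lambda>c x. \<phi> c \<otimes>\<^bsub>A\<^esub> x)\<rparr>"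

definition regular_module :: "('a, 'm) ring_scheme \<Rightarrow> ('a, 'a) module" where
  "regular_module A = scalar_module (\<lambda>a. a) A"

definition dsum :: "'i set \<Rightarrow> ('i \<Rightarrow> ('a, 'b) module) \<Rightarrow> ('a, 'i \<Rightarrow> 'b) module" where
  "dsum I M = \<lparr>carrier = {f \<in> (\<Pi>\<^sub>E i\<in>I. carrier (M i)). finite {i \<in> I. f i \<noteq> \<zero>\<^bsub>M i\<^esub>}},
     monoid.mult = undefined, one = undefined,
     zero = (\<lambda>i\<in>I. \<zero>\<^bsub>M i\<^esub>), add = (\<lambda>f g. \<lambda>i\<in>I. f i \<oplus>\<^bsub>M i\<^esub> g i),
     smult = (\<lambda>a f. \<lambda>i\<in>I. a \<odot>\<^bsub>M i\<^esub> f i)\<rparr>"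

definition dpower :: "('a, 'b) module \<Rightarrow> nat \<Rightarrow> ('a, nat \<Rightarrow> 'b) module" where
  "dpower M n = dsum {..<n} (\<lambda>_. M)"

definition dsum2 :: "('a, 'b) module \<Rightarrow> ('a, 'c) module \<Rightarrow> ('a, 'b \<times> 'c) module" where
  "dsum2 M N = \<lparr>carrier = carrier M \<times> carrier N, monoid.mult = undefined, one = undefined,
     zero = (\<zero>\<^bsub>M\<^esub>, \<zero>\<^bsub>N\<^esub>), add = (\<lambda>(x, y) (x', y'). (x \<oplus>\<^bsub>M\<^esub> x', y \<oplus>\<^bsub>N\<^esub> y')),
     smult = (\<lambda>a (x, y). (a \<odot>\<^bsub>M\<^esub> x, a \<odot>\<^bsub>N\<^esub> y))\<rparr>"

definition simple_submodule :: "('a, 'm) ring_scheme \<Rightarrow> ('a, 'b) module \<Rightarrow> 'b set \<Rightarrow> bool" where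
  "simple_submodule A M S \<longleftrightarrow> submodule S A M \<and> S \<noteq> {\<zero>\<^bsub>M\<^esub>} \<and>
     (\<forall>H. submodule H A M \<and> H \<subseteq> S \<longrightarrow> H = {\<zero>\<^bsub>M\<^esub>} \<or> H = S)"

text \<open>A module is semisimple if it is the sum of its simple submodules.\<close>

definition semisimple_module :: "('a, 'm) ring_scheme \<Rightarrow> ('a, 'b) module \<Rightarrow> bool" where
  "semisimple_module A M \<longleftrightarrow> left_module A M \<and>
     (\<forall>H. submodule H A M \<and> (\<forall>S. simple_submodule A M S \<longrightarrow> S \<subseteq> H) \<longrightarrow> H = carrier M)"

definition semisimple_ring :: "('a, 'm) ring_scheme \<Rightarrow> bool" where
  "semisimple_ring A \<longleftrightarrow> ring A \<and> semisimple_module A (regular_module A)"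

definition indecomposable :: "('a, 'm) ring_scheme \<Rightarrow> ('a, 'b) module \<Rightarrow> bool" where
  "indecomposable A M \<longleftrightarrow> left_module A M \<and> \<not> zero_module M \<and>
     (\<forall>X Y. submodule X A M \<and> submodule Y A M \<and> X \<inter> Y = {\<zero>\<^bsub>M\<^esub>} \<and> X <+>\<^bsub>M\<^esub> Y = carrier M
        \<longrightarrow> X = {\<zero>\<^bsub>M\<^esub>} \<or> Y = {\<zero>\<^bsub>M\<^esub>})"

definition basic_module :: "('a, 'm) ring_scheme \<Rightarrow> ('a, 'b) module \<Rightarrow> bool" where
  "basic_module A T \<longleftrightarrow> (\<exists>n (X :: nat \<Rightarrow> 'a umod).
     (\<forall>i<n. X i \<in> fg_mods A \<and> indecomposable A (X i)) \<and>
     (\<forall>i<n. \<forall>j<n. i \<noteq> j \<longrightarrow> \<not> mod_iso A (X i) (X j)) \<and>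
     mod_iso A T (dsum {..<n} X))"

definition add_cl :: "('a, 'm) ring_scheme \<Rightarrow> 'a umod \<Rightarrow> 'a umod set" where
  "add_cl A T = {M \<in> fg_mods A. \<exists>n. \<exists>N\<in>fg_mods A. mod_iso A (dsum2 M N) (dpower T n)}"

section \<open>Projective and injective modules, homological dimensions\<close>

definition projective_module :: "('a, 'm) ring_scheme \<Rightarrow> ('a, 'b) module \<Rightarrow> bool" where
  "projective_module A P \<longleftrightarrow> fg_module A P \<and>
     (\<forall>X\<in>fg_mods A. \<forall>Y\<in>fg_mods A. \<forall>f g. epi_hom A X Y f \<and> g \<in> mod_hom A P Y \<longrightarrow>
        (\<exists>h\<in>mod_hom A P X. compose (carrier P) f h = g))"

definition injective_module :: "('a, 'm) ring_scheme \<Rightarrow> ('a, 'b) module \<Rightarrow> bool" where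
  "injective_module A I \<longleftrightarrow> fg_module A I \<and>
     (\<forall>X\<in>fg_mods A. \<forall>Y\<in>fg_mods A. \<forall>f g. mono_hom A X Y f \<and> g \<in> mod_hom A X I \<longrightarrow>
        (\<exists>h\<in>mod_hom A Y I. compose (carrier X) h f = g))"

definition proj_inj_mods :: "('a, 'm) ring_scheme \<Rightarrow> 'a umod set" where
  "proj_inj_mods A = {Q. projective_module A Q \<and> injective_module A Q}"

text \<open>Augmented projective resolution \<open>\<cdots> \<rightarrow> P 1 \<rightarrow> P 0 \<rightarrow> M \<rightarrow> 0\<close> with \<open>d i : P (i + 1) \<rightarrow> P i\<close>.\<close>

definition proj_resolution :: "('a, 'm) ring_scheme \<Rightarrow> ('a, 'b) module \<Rightarrow> (nat \<Rightarrow> 'a umod) \<Rightarrow>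
    (nat \<Rightarrow> (nat \<Rightarrow> 'a) set \<Rightarrow> (nat \<Rightarrow> 'a) set) \<Rightarrow> ((nat \<Rightarrow> 'a) set \<Rightarrow> 'b) \<Rightarrow> bool" where
  "proj_resolution A M P d \<epsilon> \<longleftrightarrow>
     (\<forall>i. projective_module A (P i) \<and> d i \<in> mod_hom A (P (Suc i)) (P i)) \<and>
     epi_hom A (P 0) M \<epsilon> \<and>
     d 0 ` carrier (P 1) = mod_ker (P 0) M \<epsilon> \<and>
     (\<forall>i. d (Suc i) ` carrier (P (Suc (Suc i))) = mod_ker (P (Suc i)) (P i) (d i))"

definition projdim :: "('a, 'm) ring_scheme \<Rightarrow> ('a, 'b) module \<Rightarrow> enat" where
  "projdim A M = Inf {enat n | n. \<exists>P d \<epsilon>. proj_resolution A M P d \<epsilon> \<and> (\<forall>i>n. zero_module (P i))}"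

definition gldim :: "('a, 'm) ring_scheme \<Rightarrow> enat" where
  "gldim A = (SUP M\<in>fg_mods A. projdim A M)"

text \<open>Augmented injective resolution \<open>0 \<rightarrow> M \<rightarrow> I 0 \<rightarrow> I 1 \<rightarrow> \<cdots>\<close> with \<open>d i : I i \<rightarrow> I (i + 1)\<close>.\<close>

definition inj_resolution :: "('a, 'm) ring_scheme \<Rightarrow> ('a, 'b) module \<Rightarrow> (nat \<Rightarrow> 'a umod) \<Rightarrow>
    (nat \<Rightarrow> (nat \<Rightarrow> 'a) set \<Rightarrow> (nat \<Rightarrow> 'a) set) \<Rightarrow> ('b \<Rightarrow> (nat \<Rightarrow> 'a) set) \<Rightarrow> bool" where
  "inj_resolution A M I d \<eta> \<longleftrightarrow>
     (\<forall>i. injective_module A (I i) \<and> d i \<in> mod_hom A (I i) (I (Suc i))) \<and>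
     mono_hom A M (I 0) \<eta> \<and>
     \<eta> ` carrier M = mod_ker (I 0) (I 1) (d 0) \<and>
     (\<forall>i. d i ` carrier (I i) = mod_ker (I (Suc i)) (I (Suc (Suc i))) (d (Suc i)))"

definition essential_submodule :: "('a, 'm) ring_scheme \<Rightarrow> ('a, 'b) module \<Rightarrow> 'b set \<Rightarrow> bool" where
  "essential_submodule A M U \<longleftrightarrow> submodule U A M \<and>
     (\<forall>H. submodule H A M \<and> H \<inter> U = {\<zero>\<^bsub>M\<^esub>} \<longrightarrow> H = {\<zero>\<^bsub>M\<^esub>})"

text \<open>Minimality: each \<open>I i\<close> is an injective envelope of the preceding cokernel.\<close>

definition min_inj_resolution :: "('a, 'm) ring_scheme \<Rightarrow> ('a, 'b) module \<Rightarrow> (nat \<Rightarrow> 'a umod) \<Rightarrow>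
    (nat \<Rightarrow> (nat \<Rightarrow> 'a) set \<Rightarrow> (nat \<Rightarrow> 'a) set) \<Rightarrow> ('b \<Rightarrow> (nat \<Rightarrow> 'a) set) \<Rightarrow> bool" where
  "min_inj_resolution A M I d \<eta> \<longleftrightarrow> inj_resolution A M I d \<eta> \<and>
     essential_submodule A (I 0) (\<eta> ` carrier M) \<and>
     (\<forall>i. essential_submodule A (I (Suc i)) (d i ` carrier (I i)))"

definition domdim :: "('a, 'm) ring_scheme \<Rightarrow> enat" where
  "domdim A = Sup {enat k | k. \<exists>I d \<eta>. min_inj_resolution A (regular_module A) I d \<eta> \<and>
     (\<forall>i<k. projective_module A (I i))}"

section \<open>Extension groups\<close>

definition hom_group :: "('a, 'm) ring_scheme \<Rightarrow> ('a, 'b) module \<Rightarrow> ('a, 'c) module \<Rightarrow> ('b \<Rightarrow> 'c) monoid"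
  where "hom_group A M N = \<lparr>carrier = mod_hom A M N,
     monoid.mult = (\<lambda>f g. \<lambda>x\<in>carrier M. f x \<oplus>\<^bsub>N\<^esub> g x), one = zero_hom M N\<rparr>"

definition cocycles :: "('a, 'm) ring_scheme \<Rightarrow> (nat \<Rightarrow> ('a, 'b) module) \<Rightarrow> (nat \<Rightarrow> 'b \<Rightarrow> 'b) \<Rightarrow>
    ('a, 'c) module \<Rightarrow> nat \<Rightarrow> ('b \<Rightarrow> 'c) set" where
  "cocycles A P d N n = {f \<in> mod_hom A (P n) N.
     compose (carrier (P (Suc n))) f (d n) = zero_hom (P (Suc n)) N}"

fun coboundaries :: "('a, 'm) ring_scheme \<Rightarrow> (nat \<Rightarrow> ('a, 'b) module) \<Rightarrow> (nat \<Rightarrow> 'b \<Rightarrow> 'b) \<Rightarrow>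
    ('a, 'c) module \<Rightarrow> nat \<Rightarrow> ('b \<Rightarrow> 'c) set" where
  "coboundaries A P d N 0 = {zero_hom (P 0) N}"
| "coboundaries A P d N (Suc n) =
     (\<lambda>g. compose (carrier (P (Suc n))) g (d n)) ` mod_hom A (P n) N"

text \<open>The \<open>n\<close>-th cohomology of \<open>Hom (P, N)\<close> for a chosen projective resolution \<open>P\<close> of \<open>M\<close>.\<close>

definition Ext :: "('a, 'm) ring_scheme \<Rightarrow> nat \<Rightarrow> ('a, 'b) module \<Rightarrow> ('a, 'c) module \<Rightarrow>
    ((nat \<Rightarrow> 'a) set \<Rightarrow> 'c) set monoid" where
  "Ext A n M N = (let (P, d) = (SOME (P, d). \<exists>\<epsilon>. proj_resolution A M P d \<epsilon>)
     in (hom_group A (P n) N)\<lparr>carrier := cocycles A P d N n\<rparr> Mod coboundaries A P d N n)"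

section \<open>Auslander algebras\<close>

definition artinian_cring :: "('k, 'm) ring_scheme \<Rightarrow> bool" where
  "artinian_cring k \<longleftrightarrow> cring k \<and>
     (\<forall>I. (\<forall>n::nat. ideal (I n) k \<and> I (Suc n) \<subseteq> I n) \<longrightarrow> (\<exists>N. \<forall>n\<ge>N. I n = I N))"

text \<open>The structure map \<open>\<phi>\<close> makes \<open>A\<close> an algebra over the commutative artinian ring \<open>k\<close>.\<close>

definition artin_algebra :: "('k, 'l) ring_scheme \<Rightarrow> ('k \<Rightarrow> 'a) \<Rightarrow> ('a, 'm) ring_scheme \<Rightarrow> bool" where
  "artin_algebra k \<phi> A \<longleftrightarrow> artinian_cring k \<and> ring A \<and> \<phi> \<in> ring_hom k A \<and>
     (\<forall>c\<in>carrier k. \<forall>a\<in>carrier A. \<phi> c \<otimes>\<^bsub>A\<^esub> a = a \<otimes>\<^bsub>A\<^esub> \<phi> c) \<and>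
     fg_module k (scalar_module \<phi> A)"

definition auslander_algebra :: "('k, 'l) ring_scheme \<Rightarrow> ('k \<Rightarrow> 'a) \<Rightarrow> ('a, 'm) ring_scheme \<Rightarrow> bool" where
  "auslander_algebra k \<phi> A \<longleftrightarrow> artin_algebra k \<phi> A \<and> gldim A \<le> 2 \<and> 2 \<le> domdim A"

section \<open>The triangular matrix algebra\<close>

definition End_ring :: "('a, 'm) ring_scheme \<Rightarrow> ('a, 'b) module \<Rightarrow> ('b \<Rightarrow> 'b) ring" where
  "End_ring A M = \<lparr>carrier = mod_hom A M M, monoid.mult = compose (carrier M),
     one = (\<lambda>x\<in>carrier M. x), zero = zero_hom M M,
     add = (\<lambda>f g. \<lambda>x\<in>carrier M. f x \<oplus>\<^bsub>M\<^esub> g x)\<rparr>"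

definition op_ring :: "'r ring \<Rightarrow> 'r ring" where
  "op_ring R = R\<lparr>monoid.mult := (\<lambda>x y. y \<otimes>\<^bsub>R\<^esub> x)\<rparr>"

text \<open>The triple \<open>(r, e, a)\<close> stands for the matrix with first row \<open>(r, 0)\<close> and second row
  \<open>(e, a)\<close>; \<open>ract\<close> is the right action of \<open>R\<close> on the left \<open>A\<close>-module \<open>E\<close>.\<close>

definition tri_matrix_ring :: "('r, 'l) ring_scheme \<Rightarrow> ('a, 'e) module \<Rightarrow> ('e \<Rightarrow> 'r \<Rightarrow> 'e) \<Rightarrow>
    ('a, 'm) ring_scheme \<Rightarrow> ('r \<times> 'e \<times> 'a) ring" where
  "tri_matrix_ring R E ract A =
     \<lparr>carrier = carrier R \<times> carrier E \<times> carrier A,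
      monoid.mult = (\<lambda>(r, e, a) (r', e', a').
        (r \<otimes>\<^bsub>R\<^esub> r', ract e r' \<oplus>\<^bsub>E\<^esub> a \<odot>\<^bsub>E\<^esub> e', a \<otimes>\<^bsub>A\<^esub> a')),
      one = (\<one>\<^bsub>R\<^esub>, \<zero>\<^bsub>E\<^esub>, \<one>\<^bsub>A\<^esub>),
      zero = (\<zero>\<^bsub>R\<^esub>, \<zero>\<^bsub>E\<^esub>, \<zero>\<^bsub>A\<^esub>),
      add = (\<lambda>(r, e, a) (r', e', a'). (r \<oplus>\<^bsub>R\<^esub> r', e \<oplus>\<^bsub>E\<^esub> e', a \<oplus>\<^bsub>A\<^esub> a'))\<rparr>"

text \<open>An endomorphism, as an element of the opposite endomorphism ring, acts on the right by
  evaluation.\<close>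

definition ext_algebra :: "('a, 'm) ring_scheme \<Rightarrow> ('a, 'e) module \<Rightarrow> (('e \<Rightarrow> 'e) \<times> 'e \<times> 'a) ring" where
  "ext_algebra A E = tri_matrix_ring (op_ring (End_ring A E)) E (\<lambda>e r. r e) A"

lemma mod_homD:
  assumes "f \<in> mod_hom A M N"
  shows "f \<in> extensional (carrier M)"
    and "x \<in> carrier M \<Longrightarrow> f x \<in> carrier N"
    and "\<lbrakk>x \<in> carrier M; y \<in> carrier M\<rbrakk> \<Longrightarrow> f (x \<oplus>\<^bsub>M\<^esub> y) = f x \<oplus>\<^bsub>N\<^esub> f y"
    and "\<lbrakk>a \<in> carrier A; x \<in> carrier M\<rbrakk> \<Longrightarrow> f (a \<odot>\<^bsub>M\<^esub> x) = a \<odot>\<^bsub>N\<^esub> f x"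
  using assms by (auto simp: mod_hom_def PiE_iff)

lemma mod_homI:
  assumes "f \<in> extensional (carrier M)"
    and "\<And>x. x \<in> carrier M \<Longrightarrow> f x \<in> carrier N"
    and "\<And>x y. \<lbrakk>x \<in> carrier M; y \<in> carrier M\<rbrakk> \<Longrightarrow> f (x \<oplus>\<^bsub>M\<^esub> y) = f x \<oplus>\<^bsub>N\<^esub> f y"
    and "\<And>a x. \<lbrakk>a \<in> carrier A; x \<in> carrier M\<rbrakk> \<Longrightarrow> f (a \<odot>\<^bsub>M\<^esub> x) = a \<odot>\<^bsub>N\<^esub> f x"
  shows "f \<in> mod_hom A M N"
  using assms by (auto simp: mod_hom_def PiE_iff)

lemma ring_End_ring:
  assumes "left_module A M"
  shows "ring (End_ring A M)"
proof -
  interpret left_module A M by (rule assms)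
  let ?H = "mod_hom A M M" and ?C = "carrier M"
  have sz: "a \<odot>\<^bsub>M\<^esub> \<zero>\<^bsub>M\<^esub> = \<zero>\<^bsub>M\<^esub>" if "a \<in> carrier A" for a
    using smult_r_distr[of a "\<zero>\<^bsub>M\<^esub>" "\<zero>\<^bsub>M\<^esub>"] that by (simp add: M.add.l_cancel_one)
  have sneg: "a \<odot>\<^bsub>M\<^esub> (\<ominus>\<^bsub>M\<^esub> x) = \<ominus>\<^bsub>M\<^esub> (a \<odot>\<^bsub>M\<^esub> x)"
    if "a \<in> carrier A" "x \<in> ?C" for a x
    by (rule M.minus_equality[symmetric])
      (use that sz smult_r_distr[of a "\<ominus>\<^bsub>M\<^esub> x" x] in \<open>auto simp: M.l_neg\<close>)
  have add: "(\<lambda>x\<in>?C. f x \<oplus>\<^bsub>M\<^esub> g x) \<in> ?H" if "f \<in> ?H" "g \<in> ?H" for f g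
    using mod_homD[OF that(1)] mod_homD[OF that(2)]
    by (intro mod_homI) (auto simp: M.a_ac smult_r_distr)
  have zero: "zero_hom M M \<in> ?H"
    by (intro mod_homI) (auto simp: zero_hom_def sz)
  have one: "(\<lambda>x\<in>?C. x) \<in> ?H"
    by (intro mod_homI) auto
  have comp: "compose ?C f g \<in> ?H" if "f \<in> ?H" "g \<in> ?H" for f g
    using mod_homD[OF that(1)] mod_homD[OF that(2)]
    by (intro mod_homI) (auto simp: compose_def)
  have neg: "(\<lambda>x\<in>?C. \<ominus>\<^bsub>M\<^esub> f x) \<in> ?H" if "f \<in> ?H" for f
    using mod_homD[OF that] by (intro mod_homI) (auto simp: M.minus_add sneg)
  have ag: "abelian_group (End_ring A M)"
  proof (rule abelian_groupI)
    fix f assume f: "f \<in> carrier (End_ring A M)"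
    then show "\<exists>g\<in>carrier (End_ring A M). g \<oplus>\<^bsub>End_ring A M\<^esub> f = \<zero>\<^bsub>End_ring A M\<^esub>"
      by (intro bexI[of _ "\<lambda>x\<in>?C. \<ominus>\<^bsub>M\<^esub> f x"])
        (auto simp: End_ring_def zero_hom_def neg M.l_neg mod_homD intro!: restrict_ext)
    show "\<zero>\<^bsub>End_ring A M\<^esub> \<oplus>\<^bsub>End_ring A M\<^esub> f = f"
      using mod_homD[of f A M M] f
      by (auto simp: End_ring_def zero_hom_def extensional_def fun_eq_iff)
  qed (auto simp: End_ring_def zero add mod_homD M.a_ac cong: restrict_cong)
  have mo: "monoid (End_ring A M)"
  proof (rule monoidI)
    fix f g h assume f: "f \<in> carrier (End_ring A M)" "g \<in> carrier (End_ring A M)" 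
       "h \<in> carrier (End_ring A M)"
    then show "f \<otimes>\<^bsub>End_ring A M\<^esub> g \<otimes>\<^bsub>End_ring A M\<^esub> h =
         f \<otimes>\<^bsub>End_ring A M\<^esub> (g \<otimes>\<^bsub>End_ring A M\<^esub> h)"
      by (auto simp: End_ring_def compose_def fun_eq_iff mod_homD)
  next
    fix f assume f: "f \<in> carrier (End_ring A M)"
    show "\<one>\<^bsub>End_ring A M\<^esub> \<otimes>\<^bsub>End_ring A M\<^esub> f = f" "f \<otimes>\<^bsub>End_ring A M\<^esub> \<one>\<^bsub>End_ring A M\<^esub> = f"
      using mod_homD[of f A M M] f by (auto simp: End_ring_def compose_def extensional_def fun_eq_iff)
  qed (auto simp: End_ring_def one comp)
  show ?thesis
    using ag mo
    by (intro ring.intro ring_axioms.intro)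
      (auto simp: End_ring_def compose_def fun_eq_iff mod_homD)
qed

lemma ring_op_ring:
  assumes "ring R"
  shows "ring (op_ring R)"
proof -
  interpret ring R by (rule assms)
  have "add_monoid (op_ring R) = add_monoid R"
    by (simp add: op_ring_def)
  then have "abelian_group (op_ring R)"
    using a_comm_monoid a_comm_group
    by (intro abelian_group.intro abelian_monoid.intro abelian_group_axioms.intro) simp_all
  moreover have "monoid (op_ring R)"
    by (rule monoidI) (auto simp: op_ring_def m_assoc)
  ultimately show ?thesis
    by (intro ring.intro ring_axioms.intro) (auto simp: op_ring_def l_distr r_distr)
qed

lemma ring_ext_algebra:
  assumes "left_module A E"
  shows "ring (ext_algebra A E)"
proof -
  interpret left_module A E by (rule assms)
  interpret O: ring "op_ring (End_ring A E)" using ring_op_ring[OF ring_End_ring[OF assms]] .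
  let ?O = "op_ring (End_ring A E)"
  have op: "carrier ?O = mod_hom A E E" "\<And>r s. r \<otimes>\<^bsub>?O\<^esub> s = compose (carrier E) s r"
    "\<And>r s. r \<oplus>\<^bsub>?O\<^esub> s = (\<lambda>x\<in>carrier E. r x \<oplus>\<^bsub>E\<^esub> s x)" "\<one>\<^bsub>?O\<^esub> = (\<lambda>x\<in>carrier E. x)"
    by (auto simp: op_ring_def End_ring_def)
  note opC = op(1)
  have z: "f \<zero>\<^bsub>E\<^esub> = \<zero>\<^bsub>E\<^esub>" if "f \<in> carrier ?O" for f
  proof -
    have "f (\<zero>\<^bsub>E\<^esub> \<oplus>\<^bsub>E\<^esub> \<zero>\<^bsub>E\<^esub>) = f \<zero>\<^bsub>E\<^esub> \<oplus>\<^bsub>E\<^esub> f \<zero>\<^bsub>E\<^esub>" "f \<zero>\<^bsub>E\<^esub> \<in> carrier E"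
      using mod_homD(2,3)[OF that[unfolded opC] M.zero_closed] M.zero_closed by blast+
    then show ?thesis by (simp add: M.add.l_cancel_one)
  qed
  have sz: "a \<odot>\<^bsub>E\<^esub> \<zero>\<^bsub>E\<^esub> = \<zero>\<^bsub>E\<^esub>" if "a \<in> carrier A" for a
    using smult_r_distr[of a "\<zero>\<^bsub>E\<^esub>" "\<zero>\<^bsub>E\<^esub>"] that by (simp add: M.add.l_cancel_one)
  have app [simp]: "f x \<in> carrier E" if "f \<in> carrier ?O" "x \<in> carrier E" for f x
    using that mod_homD(2) by (auto simp: opC)
  have appa: "f (x \<oplus>\<^bsub>E\<^esub> y) = f x \<oplus>\<^bsub>E\<^esub> f y"
    if "f \<in> carrier ?O" "x \<in> carrier E" "y \<in> carrier E" for f x y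
    using that mod_homD(3) by (auto simp: opC)
  have apps: "f (a \<odot>\<^bsub>E\<^esub> x) = a \<odot>\<^bsub>E\<^esub> f x"
    if "f \<in> carrier ?O" "x \<in> carrier E" "a \<in> carrier A" for f x a
    using that mod_homD(4) by (fastforce simp: opC)
  have ract: "(r \<otimes>\<^bsub>?O\<^esub> s) x = s (r x)" "(r \<oplus>\<^bsub>?O\<^esub> s) x = r x \<oplus>\<^bsub>E\<^esub> s x" "\<one>\<^bsub>?O\<^esub> x = x"
    if "x \<in> carrier E" for r s x
    using that by (auto simp: op compose_def)
  have zl: "\<zero>\<^bsub>A\<^esub> \<odot>\<^bsub>E\<^esub> x = \<zero>\<^bsub>E\<^esub>" if "x \<in> carrier E" for x
    using smult_l_distr[of "\<zero>\<^bsub>A\<^esub>" "\<zero>\<^bsub>A\<^esub>" x] that by (simp add: M.add.l_cancel_one)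
  note defs = ext_algebra_def tri_matrix_ring_def
  have "abelian_group (ext_algebra A E)"
  proof (rule abelian_groupI)
    fix x assume "x \<in> carrier (ext_algebra A E)"
    then obtain r e a where "x = (r, e, a)" "r \<in> carrier ?O" "e \<in> carrier E" "a \<in> carrier A"
      by (auto simp: defs)
    then show "\<exists>y\<in>carrier (ext_algebra A E). y \<oplus>\<^bsub>ext_algebra A E\<^esub> x = \<zero>\<^bsub>ext_algebra A E\<^esub>"
      by (intro bexI[of _ "(\<ominus>\<^bsub>?O\<^esub> r, \<ominus>\<^bsub>E\<^esub> e, \<ominus>\<^bsub>A\<^esub> a)"])
        (auto simp: defs O.l_neg M.l_neg R.l_neg)
  qed (auto simp: defs O.a_ac M.a_ac R.a_ac)
  moreover have "monoid (ext_algebra A E)"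
    by (rule monoidI)
      (auto simp: defs O.m_assoc R.m_assoc appa apps ract z sz zl smult_r_distr smult_assoc1 M.a_assoc)
  ultimately show ?thesis
    by (intro ring.intro ring_axioms.intro)
      (auto simp: defs O.l_distr O.r_distr appa ract smult_l_distr smult_r_distr M.a_ac
        R.l_distr R.r_distr)
qed

section \<open>The subcategory and tilting modules\<close>

definition iso_reps :: "('a, 'm) ring_scheme \<Rightarrow> 'a umod set \<Rightarrow> 'a umod set" where
  "iso_reps A \<X> = (\<lambda>X. SOME Y. Y \<in> \<X> \<and> mod_iso A X Y) ` \<X>"

definition Q_tilde :: "('a, 'm) ring_scheme \<Rightarrow> ('a, 'a umod \<Rightarrow> (nat \<Rightarrow> 'a) set) module" where
  "Q_tilde A = dsum (iso_reps A {X \<in> proj_inj_mods A. indecomposable A X}) (\<lambda>X. X)"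

definition Gen :: "('a, 'm) ring_scheme \<Rightarrow> ('a, 'b) module \<Rightarrow> 'a umod set" where
  "Gen A Q = {M \<in> fg_mods A. \<exists>m f. epi_hom A (dpower Q m) M f}"

definition Cogen :: "('a, 'm) ring_scheme \<Rightarrow> ('a, 'b) module \<Rightarrow> 'a umod set" where
  "Cogen A Q = {M \<in> fg_mods A. \<exists>m f. mono_hom A M (dpower Q m) f}"

definition C_cat :: "('a, 'm) ring_scheme \<Rightarrow> 'a umod set" where
  "C_cat A = Gen A (Q_tilde A) \<inter> Cogen A (Q_tilde A)"

definition tilting_module :: "('a, 'm) ring_scheme \<Rightarrow> 'a umod \<Rightarrow> bool" where
  "tilting_module A T \<longleftrightarrow> fg_module A T \<and> basic_module A T \<and>
     projdim A T \<le> 1 \<and>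
     trivial_group (Ext A 1 T T) \<and>
     (\<exists>T0\<in>add_cl A T. \<exists>T1\<in>add_cl A T. \<exists>f g. short_exact A (regular_module A) f T0 g T1)"

end

theory Submission
  imports Defs
begin

text \<open>Write \<open>B\<close> for \<^term>\<open>ext_algebra A E\<close>. An \<open>A\<close>-module becomes a \<open>B\<close>-module by inflation
  along the projection \<open>B \<rightarrow> A\<close>. The first column of \<open>B\<close> is projective, and it is injective because
  \<open>E\<close> is; the inflation of a projective-injective \<open>A\<close>-module \<open>Q\<close> is projective, and it is injective
  because \<open>Hom (E, Q) = 0\<close>. Hence a minimal injective resolution \<open>0 \<rightarrow> A \<rightarrow> I 0 \<rightarrow> I 1\<close> yields an exact
  sequence \<open>0 \<rightarrow> B \<rightarrow> G \<rightarrow> C \<rightarrow> 0\<close> in which \<open>G\<close> is the sum of the first column and the inflation of \<open>I 0\<close>,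
  hence projective-injective, and \<open>C\<close> embeds into the inflation of \<open>I 1\<close>. The basic part of \<open>G \<oplus> C\<close> is
  the tilting module. The descending chain condition over \<open>k\<close> provides the decompositions into
  indecomposables.\<close>

section \<open>Linear maps\<close>

text \<open>Let \<open>e2\<close> be the idempotent of \<open>B\<close> that cuts out
  \<open>A\<close>. The corner functor sending X to \<open>e2 X\<close> is exact, and all transfer
  between the two algebras goes through it. Its left adjoint is inflation, because
  \<open>B e2\<close> is \<open>A\<close> with \<open>B\<close> acting through the projection; hence
  inflation preserves projectives. Its right adjoint sends Q to Hom_A(\<open>e2 B\<close>, Q), where
  \<open>e2 B\<close> is E \<oplus> A. For Q = E this is the first column, and when Hom(E, Q) = 0 it
  is the inflation of Q; both injectivity claims are instances of this. The obstacle is that a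
  tilting module must be basic, while G \<oplus> C may repeat summands. Multiplicities are not
  tracked: the homological conditions are proved for an arbitrary retract T of G \<oplus> C, and G
  \<oplus> C is in turn a retract of a power of T. Ext vanishes because G is injective as well as
  projective: a map from B to T lifts to a power of G, and the lift extends. The definitions
  quantify over modules on one fixed carrier type, whereas sums and corners live on other types;
  they are moved along pairs of mutually inverse linear maps.\<close>

text \<open>Unlike \<^const>\<open>mod_hom\<close>, linear maps are not required to be extensional, so that they can be
  composed and added without restricting them.\<close>

definition lin :: "('a, 'm) ring_scheme \<Rightarrow> ('a, 'b) module \<Rightarrow> ('a, 'c) module \<Rightarrow> ('b \<Rightarrow> 'c) \<Rightarrow> bool" where
  "lin A M N f \<longleftrightarrow> (\<forall>x\<in>carrier M. f x \<in> carrier N) \<and>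
     (\<forall>x\<in>carrier M. \<forall>y\<in>carrier M. f (x \<oplus>\<^bsub>M\<^esub> y) = f x \<oplus>\<^bsub>N\<^esub> f y) \<and>
     (\<forall>a\<in>carrier A. \<forall>x\<in>carrier M. f (a \<odot>\<^bsub>M\<^esub> x) = a \<odot>\<^bsub>N\<^esub> f x)"

text \<open>This is being a direct summand up to isomorphism. Only the split pair is recorded: it
  composes freely, relates modules with different carrier types, and transports projectivity,
  injectivity and finite generation without naming a complement.\<close>

definition retract :: "('a, 'm) ring_scheme \<Rightarrow> ('a, 'b) module \<Rightarrow> ('a, 'c) module \<Rightarrow> bool" where
  "retract A M N \<longleftrightarrow> (\<exists>i r. lin A M N i \<and> lin A N M r \<and> (\<forall>x\<in>carrier M. r (i x) = x))"

text \<open>Keeping the inverse as data makes symmetry and composition immediate, and each direction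
  is at hand as a linear map.\<close>

definition iso_pair ::
    "('a, 'm) ring_scheme \<Rightarrow> ('a, 'b) module \<Rightarrow> ('a, 'c) module \<Rightarrow> ('b \<Rightarrow> 'c) \<Rightarrow> ('c \<Rightarrow> 'b) \<Rightarrow> bool" where
  "iso_pair A M N f g \<longleftrightarrow> lin A M N f \<and> lin A N M g \<and>
     (\<forall>x\<in>carrier M. g (f x) = x) \<and> (\<forall>y\<in>carrier N. f (g y) = y)"

lemma linI:
  assumes "\<And>x. x \<in> carrier M \<Longrightarrow> f x \<in> carrier N"
    and "\<And>x y. \<lbrakk>x \<in> carrier M; y \<in> carrier M\<rbrakk> \<Longrightarrow> f (x \<oplus>\<^bsub>M\<^esub> y) = f x \<oplus>\<^bsub>N\<^esub> f y"
    and "\<And>a x. \<lbrakk>a \<in> carrier A; x \<in> carrier M\<rbrakk> \<Longrightarrow> f (a \<odot>\<^bsub>M\<^esub> x) = a \<odot>\<^bsub>N\<^esub> f x"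
  shows "lin A M N f"
  using assms by (simp add: lin_def)

lemma linD:
  assumes "lin A M N f"
  shows "x \<in> carrier M \<Longrightarrow> f x \<in> carrier N"
    and "\<lbrakk>x \<in> carrier M; y \<in> carrier M\<rbrakk> \<Longrightarrow> f (x \<oplus>\<^bsub>M\<^esub> y) = f x \<oplus>\<^bsub>N\<^esub> f y"
    and "\<lbrakk>a \<in> carrier A; x \<in> carrier M\<rbrakk> \<Longrightarrow> f (a \<odot>\<^bsub>M\<^esub> x) = a \<odot>\<^bsub>N\<^esub> f x"
  using assms by (auto simp: lin_def)

lemma left_moduleI:
  assumes "ring A"
    and "\<And>x y. \<lbrakk>x \<in> carrier M; y \<in> carrier M\<rbrakk> \<Longrightarrow> x \<oplus>\<^bsub>M\<^esub> y \<in> carrier M"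
    and "\<zero>\<^bsub>M\<^esub> \<in> carrier M"
    and "\<And>x y z. \<lbrakk>x \<in> carrier M; y \<in> carrier M; z \<in> carrier M\<rbrakk> \<Longrightarrow>
      (x \<oplus>\<^bsub>M\<^esub> y) \<oplus>\<^bsub>M\<^esub> z = x \<oplus>\<^bsub>M\<^esub> (y \<oplus>\<^bsub>M\<^esub> z)"
    and "\<And>x y. \<lbrakk>x \<in> carrier M; y \<in> carrier M\<rbrakk> \<Longrightarrow> x \<oplus>\<^bsub>M\<^esub> y = y \<oplus>\<^bsub>M\<^esub> x"
    and "\<And>x. x \<in> carrier M \<Longrightarrow> \<zero>\<^bsub>M\<^esub> \<oplus>\<^bsub>M\<^esub> x = x"
    and "\<And>x. x \<in> carrier M \<Longrightarrow> \<exists>y\<in>carrier M. y \<oplus>\<^bsub>M\<^esub> x = \<zero>\<^bsub>M\<^esub>"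
    and "\<And>a x. \<lbrakk>a \<in> carrier A; x \<in> carrier M\<rbrakk> \<Longrightarrow> a \<odot>\<^bsub>M\<^esub> x \<in> carrier M"
    and "\<And>a b x. \<lbrakk>a \<in> carrier A; b \<in> carrier A; x \<in> carrier M\<rbrakk> \<Longrightarrow>
      (a \<oplus>\<^bsub>A\<^esub> b) \<odot>\<^bsub>M\<^esub> x = a \<odot>\<^bsub>M\<^esub> x \<oplus>\<^bsub>M\<^esub> b \<odot>\<^bsub>M\<^esub> x"
    and "\<And>a x y. \<lbrakk>a \<in> carrier A; x \<in> carrier M; y \<in> carrier M\<rbrakk> \<Longrightarrow>
      a \<odot>\<^bsub>M\<^esub> (x \<oplus>\<^bsub>M\<^esub> y) = a \<odot>\<^bsub>M\<^esub> x \<oplus>\<^bsub>M\<^esub> a \<odot>\<^bsub>M\<^esub> y"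
    and "\<And>a b x. \<lbrakk>a \<in> carrier A; b \<in> carrier A; x \<in> carrier M\<rbrakk> \<Longrightarrow>
      (a \<otimes>\<^bsub>A\<^esub> b) \<odot>\<^bsub>M\<^esub> x = a \<odot>\<^bsub>M\<^esub> (b \<odot>\<^bsub>M\<^esub> x)"
    and "\<And>x. x \<in> carrier M \<Longrightarrow> \<one>\<^bsub>A\<^esub> \<odot>\<^bsub>M\<^esub> x = x"
  shows "left_module A M"
  using assms
  by (intro left_module.intro left_module_axioms.intro abelian_groupI) auto

context left_module
begin

lemma smult_zero [simp]: "a \<in> carrier R \<Longrightarrow> a \<odot>\<^bsub>M\<^esub> \<zero>\<^bsub>M\<^esub> = \<zero>\<^bsub>M\<^esub>"
  using smult_r_distr[of a "\<zero>\<^bsub>M\<^esub>" "\<zero>\<^bsub>M\<^esub>"] by (simp add: M.add.l_cancel_one)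

lemma zero_smult [simp]: "x \<in> carrier M \<Longrightarrow> \<zero> \<odot>\<^bsub>M\<^esub> x = \<zero>\<^bsub>M\<^esub>"
  using smult_l_distr[of "\<zero>" "\<zero>" x] by (simp add: M.add.l_cancel_one)

lemma smult_neg: "\<lbrakk>a \<in> carrier R; x \<in> carrier M\<rbrakk> \<Longrightarrow> a \<odot>\<^bsub>M\<^esub> (\<ominus>\<^bsub>M\<^esub> x) = \<ominus>\<^bsub>M\<^esub> (a \<odot>\<^bsub>M\<^esub> x)"
  by (rule M.minus_equality[symmetric])
    (use smult_r_distr[of a "\<ominus>\<^bsub>M\<^esub> x" x] in \<open>auto simp: M.l_neg\<close>)

text \<open>With this, closure under negation and compatibility with negation follow from scalar
  multiplication alone.\<close>

lemma neg_eq_smult: "x \<in> carrier M \<Longrightarrow> \<ominus>\<^bsub>M\<^esub> x = (\<ominus> \<one>) \<odot>\<^bsub>M\<^esub> x"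
  by (rule M.minus_equality)
    (use smult_l_distr[of "\<ominus> \<one>" "\<one>" x] in \<open>auto simp: R.l_neg\<close>)

lemma submoduleI':
  assumes "H \<subseteq> carrier M" and "\<zero>\<^bsub>M\<^esub> \<in> H"
    and "\<And>x y. \<lbrakk>x \<in> H; y \<in> H\<rbrakk> \<Longrightarrow> x \<oplus>\<^bsub>M\<^esub> y \<in> H"
    and "\<And>a x. \<lbrakk>a \<in> carrier R; x \<in> H\<rbrakk> \<Longrightarrow> a \<odot>\<^bsub>M\<^esub> x \<in> H"
  shows "submodule H R M"
  by (rule submoduleI) (use assms neg_eq_smult in auto)

lemma submodule_carrier: "submodule (carrier M) R M"
  by (rule submoduleI') auto

lemma submodule_zero: "submodule {\<zero>\<^bsub>M\<^esub>} R M"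
  by (rule submoduleI') auto

end

section \<open>Submodules, kernels and images\<close>

lemma submoduleD:
  assumes "submodule H A M"
  shows "x \<in> H \<Longrightarrow> x \<in> carrier M" and "\<zero>\<^bsub>M\<^esub> \<in> H"
    and "\<lbrakk>x \<in> H; y \<in> H\<rbrakk> \<Longrightarrow> x \<oplus>\<^bsub>M\<^esub> y \<in> H"
    and "\<lbrakk>a \<in> carrier A; x \<in> H\<rbrakk> \<Longrightarrow> a \<odot>\<^bsub>M\<^esub> x \<in> H"
    and "x \<in> H \<Longrightarrow> \<ominus>\<^bsub>M\<^esub> x \<in> H"
proof -
  interpret submodule H A M by (rule assms)
  show "x \<in> H \<Longrightarrow> x \<in> carrier M" "\<zero>\<^bsub>M\<^esub> \<in> H" "\<lbrakk>x \<in> H; y \<in> H\<rbrakk> \<Longrightarrow> x \<oplus>\<^bsub>M\<^esub> y \<in> H"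
     "\<lbrakk>a \<in> carrier A; x \<in> H\<rbrakk> \<Longrightarrow> a \<odot>\<^bsub>M\<^esub> x \<in> H"
     "x \<in> H \<Longrightarrow> \<ominus>\<^bsub>M\<^esub> x \<in> H"
    using subset one_closed m_closed[of x y] smult_closed[of a x] m_inv_closed[of x] by (auto simp: a_inv_def)
qed

definition submod :: "('a, 'b) module \<Rightarrow> 'b set \<Rightarrow> ('a, 'b) module" where
  "submod M H = M\<lparr>carrier := H\<rparr>"

lemma submod_simps [simp]:
  "carrier (submod M H) = H" "\<zero>\<^bsub>submod M H\<^esub> = \<zero>\<^bsub>M\<^esub>"
  "x \<oplus>\<^bsub>submod M H\<^esub> y = x \<oplus>\<^bsub>M\<^esub> y" "a \<odot>\<^bsub>submod M H\<^esub> x = a \<odot>\<^bsub>M\<^esub> x"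
  by (simp_all add: submod_def)

lemma left_module_submod:
  assumes "left_module A M" "submodule H A M"
  shows "left_module A (submod M H)"
proof -
  interpret left_module A M by fact
  note H = submoduleD[OF assms(2)]
  show ?thesis
  proof (rule left_moduleI)
    fix x assume "x \<in> carrier (submod M H)"
    then show "\<exists>y\<in>carrier (submod M H). y \<oplus>\<^bsub>submod M H\<^esub> x = \<zero>\<^bsub>submod M H\<^esub>"
      using H(1,5) by (intro bexI[of _ "\<ominus>\<^bsub>M\<^esub> x"]) (auto simp: M.l_neg)
  qed (use H in \<open>auto simp: M.a_ac smult_l_distr smult_r_distr smult_assoc1 R.ring_axioms\<close>)
qed

lemma submodule_submodD:
  assumes "left_module A M" "submodule H A M" "submodule K A (submod M H)"
  shows "submodule K A M"
proof -
  interpret left_module A M by fact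
  show ?thesis by (rule submoduleI') (use submoduleD[OF assms(3)] submoduleD(1)[OF assms(2)] in auto)
qed

lemma lin_zero:
  assumes "left_module A M" "left_module A N" "lin A M N f"
  shows "f \<zero>\<^bsub>M\<^esub> = \<zero>\<^bsub>N\<^esub>"
proof -
  interpret M: left_module A M by fact
  interpret N: left_module A N by fact
  have "f \<zero>\<^bsub>M\<^esub> \<oplus>\<^bsub>N\<^esub> f \<zero>\<^bsub>M\<^esub> = f \<zero>\<^bsub>M\<^esub>"
    using linD(2)[OF assms(3), of "\<zero>\<^bsub>M\<^esub>" "\<zero>\<^bsub>M\<^esub>", symmetric] by simp
  then show ?thesis using linD(1)[OF assms(3), of "\<zero>\<^bsub>M\<^esub>"] by (simp add: N.M.add.l_cancel_one)
qed

lemma lin_comp: "\<lbrakk>lin A M N f; lin A N L g\<rbrakk> \<Longrightarrow> lin A M L (\<lambda>x. g (f x))"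
  by (simp add: lin_def)

lemma lin_id: "lin A M M (\<lambda>x. x)"
  by (simp add: lin_def)

lemma lin_const_zero:
  assumes "left_module A N"
  shows "lin A M N (\<lambda>x. \<zero>\<^bsub>N\<^esub>)"
proof -
  interpret N: left_module A N by fact
  show ?thesis by (simp add: lin_def)
qed

lemma lin_add:
  assumes "left_module A N" "lin A M N f" "lin A M N g"
  shows "lin A M N (\<lambda>x. f x \<oplus>\<^bsub>N\<^esub> g x)"
proof -
  interpret N: left_module A N by fact
  show ?thesis using assms(2,3) by (auto simp: lin_def N.smult_r_distr N.M.a_ac)
qed

lemma lin_neg:
  assumes "left_module A N" "lin A M N f"
  shows "lin A M N (\<lambda>x. \<ominus>\<^bsub>N\<^esub> f x)"
proof -
  interpret N: left_module A N by fact
  show ?thesis using assms(2) by (auto simp: lin_def N.smult_neg N.M.minus_add N.M.a_ac)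
qed

lemma lin_uminus:
  assumes "left_module A M" "left_module A N" "lin A M N f" "x \<in> carrier M"
  shows "f (\<ominus>\<^bsub>M\<^esub> x) = \<ominus>\<^bsub>N\<^esub> f x"
proof -
  interpret M: left_module A M by fact
  interpret N: left_module A N by fact
  show ?thesis using assms(4) linD[OF assms(3)] by (simp add: M.neg_eq_smult N.neg_eq_smult)
qed

lemma lin_diff:
  assumes "left_module A N" "lin A M N f" "lin A M N g"
  shows "lin A M N (\<lambda>x. f x \<ominus>\<^bsub>N\<^esub> g x)"
  using lin_add[OF assms(1,2) lin_neg[OF assms(1,3)]] by (simp add: a_minus_def)

lemma lin_inj:
  assumes "left_module A M" "left_module A N" "lin A M N f"
    and "\<And>x. \<lbrakk>x \<in> carrier M; f x = \<zero>\<^bsub>N\<^esub>\<rbrakk> \<Longrightarrow> x = \<zero>\<^bsub>M\<^esub>"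
  shows "inj_on f (carrier M)"
proof (rule inj_onI)
  interpret M: left_module A M by fact
  interpret N: left_module A N by fact
  fix x y assume xy: "x \<in> carrier M" "y \<in> carrier M" "f x = f y"
  have "f (x \<oplus>\<^bsub>M\<^esub> \<ominus>\<^bsub>M\<^esub> y) = \<zero>\<^bsub>N\<^esub>"
    using xy linD(1,2)[OF assms(3)] lin_uminus[OF assms(1-3)] by (simp add: N.M.r_neg)
  then have "x \<oplus>\<^bsub>M\<^esub> \<ominus>\<^bsub>M\<^esub> y = \<zero>\<^bsub>M\<^esub>" using assms(4) xy by simp
  then show "x = y" using xy by (metis M.M.minus_equality M.M.minus_minus M.M.a_inv_closed)
qed

lemma lin_cong:
  assumes "left_module A M" "lin A M N f" "\<And>x. x \<in> carrier M \<Longrightarrow> f x = g x"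
  shows "lin A M N g"
proof -
  interpret M: left_module A M by fact
  show ?thesis
    by (rule linI) (use linD[OF assms(2)] in \<open>simp_all flip: assms(3)\<close>)
qed

lemma lin_submod_dom:
  assumes "submodule H A M" "lin A M N f"
  shows "lin A (submod M H) N f"
  using linD[OF assms(2)] submoduleD(1)[OF assms(1)] by (auto intro!: linI)

lemma lin_submod_cod:
  assumes "lin A M N f" "\<And>x. x \<in> carrier M \<Longrightarrow> f x \<in> H"
  shows "lin A M (submod N H) f"
  using linD[OF assms(1)] assms(2) by (auto intro!: linI)

lemma lin_incl:
  assumes "submodule H A M"
  shows "lin A (submod M H) M (\<lambda>x. x)"
  by (rule lin_submod_dom[OF assms lin_id])

lemma mod_hom_lin: "f \<in> mod_hom A M N \<Longrightarrow> lin A M N f"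
  by (auto simp: lin_def mod_hom_def)

lemma lin_mod_hom:
  assumes "left_module A M" "lin A M N f"
  shows "restrict f (carrier M) \<in> mod_hom A M N"
proof -
  interpret M: left_module A M by fact
  show ?thesis using linD[OF assms(2)] by (auto intro!: mod_homI)
qed

lemma submodule_vimage:
  assumes "left_module A M" "left_module A N" "lin A M N f" "submodule H A N"
  shows "submodule {x \<in> carrier M. f x \<in> H} A M"
proof -
  interpret M: left_module A M by fact
  show ?thesis
    by (rule M.submoduleI')
      (use linD[OF assms(3)] submoduleD[OF assms(4)] lin_zero[OF assms(1-3)] in auto)
qed

lemma submodule_image:
  assumes "left_module A M" "left_module A N" "lin A M N f" "submodule H A M"
  shows "submodule (f ` H) A N"
proof -
  interpret N: left_module A N by fact
  note f = linD[OF assms(3)] and H = submoduleD[OF assms(4)]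
  show ?thesis
  proof (rule N.submoduleI')
    show "\<zero>\<^bsub>N\<^esub> \<in> f ` H" using H(2) lin_zero[OF assms(1-3)] by (metis imageI)
    fix u v assume "u \<in> f ` H" "v \<in> f ` H"
    then obtain x y where "x \<in> H" "y \<in> H" "u = f x" "v = f y" by blast
    then show "u \<oplus>\<^bsub>N\<^esub> v \<in> f ` H"
      using H(1,3) f(2) by (intro image_eqI[of _ _ "x \<oplus>\<^bsub>M\<^esub> y"]) auto
  next
    fix a u assume a: "a \<in> carrier A" "u \<in> f ` H"
    then obtain x where "x \<in> H" "u = f x" by blast
    then show "a \<odot>\<^bsub>N\<^esub> u \<in> f ` H"
      using H(1,4) f(3) a by (intro image_eqI[of _ _ "a \<odot>\<^bsub>M\<^esub> x"]) auto
  qed (use H(1) f(1) in auto)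
qed

lemma submodule_kernel:
  assumes "left_module A M" "left_module A N" "lin A M N f"
  shows "submodule {x \<in> carrier M. f x = \<zero>\<^bsub>N\<^esub>} A M"
  using submodule_vimage[OF assms left_module.submodule_zero[OF assms(2)]] by simp

section \<open>Finite generation, isomorphisms and retracts\<close>

lemma fg_left: "fg_module A M \<Longrightarrow> left_module A M"
  by (simp add: fg_module_def)

lemma fg_generators:
  assumes "fg_module A M"
  obtains S where "finite S" "S \<subseteq> carrier M"
    "\<And>H. \<lbrakk>submodule H A M; S \<subseteq> H\<rbrakk> \<Longrightarrow> H = carrier M"
  using assms unfolding fg_module_def by (elim conjE exE) (rule that; assumption?; simp)

text \<open>The images of generators generate: a submodule containing them has a preimage that
  contains the generators of \<open>M\<close>, so this preimage is all of \<open>M\<close>.\<close>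

lemma fg_surj:
  assumes M: "fg_module A M" and N: "left_module A N" and f: "lin A M N f"
    and surj: "\<And>y. y \<in> carrier N \<Longrightarrow> \<exists>x\<in>carrier M. f x = y"
  shows "fg_module A N"
proof -
  note M' = fg_left[OF M]
  from M obtain S where S: "finite S" "S \<subseteq> carrier M"
    "\<And>H. \<lbrakk>submodule H A M; S \<subseteq> H\<rbrakk> \<Longrightarrow> H = carrier M"
    by (rule fg_generators) blast
  show ?thesis unfolding fg_module_def
  proof (intro conjI N exI[of _ "f ` S"] allI impI)
    fix H assume H: "submodule H A N \<and> f ` S \<subseteq> H"
    then have "{x \<in> carrier M. f x \<in> H} = carrier M"
      using S(2) submodule_vimage[OF M' N f] by (intro S(3)) auto
    then show "H = carrier N" using surj submoduleD(1)[of H A N] H by blast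
  qed (use S(1,2) linD(1)[OF f] in auto)
qed

lemma fg_retract:
  assumes "fg_module A N" "left_module A M" "retract A M N"
  shows "fg_module A M"
proof -
  obtain i r where ir: "lin A M N i" "lin A N M r" "\<forall>x\<in>carrier M. r (i x) = x"
    using assms(3) unfolding retract_def by blast
  show ?thesis
    by (rule fg_surj[OF assms(1,2) ir(2)]) (use ir(3) linD(1)[OF ir(1)] in blast)
qed

lemma iso_pairD:
  assumes "iso_pair A M N f g"
  shows "lin A M N f" "lin A N M g" "x \<in> carrier M \<Longrightarrow> g (f x) = x"
    "y \<in> carrier N \<Longrightarrow> f (g y) = y" "x \<in> carrier M \<Longrightarrow> f x \<in> carrier N"
    "y \<in> carrier N \<Longrightarrow> g y \<in> carrier M"
  using assms by (auto simp: iso_pair_def lin_def)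

lemma iso_pair_retract: "iso_pair A M N f g \<Longrightarrow> retract A M N"
  by (auto simp: iso_pair_def retract_def)

lemma iso_pair_sym: "iso_pair A M N f g \<Longrightarrow> iso_pair A N M g f"
  by (auto simp: iso_pair_def)

lemma retract_refl: "retract A M M"
  unfolding retract_def by (rule exI[of _ "\<lambda>x. x"])+ (simp add: lin_id)

lemma retract_trans:
  assumes "retract A L M" "retract A M N"
  shows "retract A L N"
proof -
  obtain i r where i: "lin A L M i" "lin A M L r" "\<And>x. x \<in> carrier L \<Longrightarrow> r (i x) = x"
    using assms(1) unfolding retract_def by blast
  obtain j s where j: "lin A M N j" "lin A N M s" "\<And>x. x \<in> carrier M \<Longrightarrow> s (j x) = x"
    using assms(2) unfolding retract_def by blast
  show ?thesis unfolding retract_def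
    using lin_comp[OF i(1) j(1)] lin_comp[OF j(2) i(2)] i(3) j(3) linD(1)[OF i(1)]
    by (intro exI[of _ "\<lambda>x. j (i x)"] exI[of _ "\<lambda>x. r (s x)"]) auto
qed

lemma lin_bij_iso_pair:
  assumes "left_module A M" "left_module A N" "lin A M N f" "inj_on f (carrier M)"
    and "\<And>y. y \<in> carrier N \<Longrightarrow> \<exists>x\<in>carrier M. f x = y"
  obtains g where "iso_pair A M N f g"
proof -
  have "f ` carrier M = carrier N" using assms(5) linD(1)[OF assms(3)] by blast
  define g where "g = the_inv_into (carrier M) f"
  have gM: "g y \<in> carrier M" "f (g y) = y" if "y \<in> carrier N" for y
    using that assms(4) \<open>f ` carrier M = carrier N\<close> unfolding g_def
    by (metis the_inv_into_into subset_refl, metis f_the_inv_into_f)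
  have gf: "g (f x) = x" if "x \<in> carrier M" for x
    using that assms(4) by (simp add: g_def the_inv_into_f_f)
  interpret M: left_module A M by fact
  note f = linD[OF assms(3)]
  have "lin A N M g"
  proof (rule linI)
    fix x y assume xy: "x \<in> carrier N" "y \<in> carrier N"
    then show "g (x \<oplus>\<^bsub>N\<^esub> y) = g x \<oplus>\<^bsub>M\<^esub> g y"
      using gM f(2)[of "g x" "g y"] gf[of "g x \<oplus>\<^bsub>M\<^esub> g y"] by simp
  next
    fix a x assume ax: "a \<in> carrier A" "x \<in> carrier N"
    then show "g (a \<odot>\<^bsub>N\<^esub> x) = a \<odot>\<^bsub>M\<^esub> g x"
      using gM f(3)[of a "g x"] gf[of "a \<odot>\<^bsub>M\<^esub> g x"] by simp
  qed (rule gM)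
  then have "iso_pair A M N f g" using gM(2) gf assms(3) by (simp add: iso_pair_def)
  then show ?thesis by (rule that)
qed

lemma mod_iso_iff:
  assumes "left_module A M"  "left_module A N"
  shows "mod_iso A M N \<longleftrightarrow> (\<exists>f g. iso_pair A M N f g)"
proof
  assume "mod_iso A M N"
  then obtain f where f: "f \<in> mod_hom A M N" "inj_on f (carrier M)" "f ` carrier M = carrier N"
    unfolding mod_iso_def bij_betw_def by blast
  have "\<exists>x\<in>carrier M. f x = y" if "y \<in> carrier N" for y using that unfolding f(3)[symmetric] by blast
  from lin_bij_iso_pair[OF assms mod_hom_lin[OF f(1)] f(2) this]
  show "\<exists>f g. iso_pair A M N f g" by blast
next
  assume "\<exists>f g. iso_pair A M N f g"
  then obtain f g where fg: "lin A M N f" "lin A N M g"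
    "\<forall>x\<in>carrier M. g (f x) = x" "\<forall>y\<in>carrier N. f (g y) = y" by (auto simp: iso_pair_def)
  have "bij_betw (restrict f (carrier M)) (carrier M) (carrier N)"
    by (rule bij_betwI[where g = g]) (use fg linD(1)[OF fg(1)] linD(1)[OF fg(2)] in auto)
  then show "mod_iso A M N"
    unfolding mod_iso_def using lin_mod_hom[OF assms(1) fg(1)] by blast
qed

lemma iso_pair_trans:
  assumes "iso_pair A L M f g" "iso_pair A M N f' g'"
  shows "iso_pair A L N (\<lambda>x. f' (f x)) (\<lambda>x. g (g' x))"
  using assms lin_comp[of A L M f N f'] lin_comp[of A N M g' L g]
    linD(1)[of A L M f] linD(1)[of A N M g'] unfolding iso_pair_def by simp

text \<open>Bridge from arbitrary carrier types to the fixed type over which the definitions of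
  projectivity, injectivity and \<open>add_cl\<close> quantify.\<close>

lemma fg_umod:
  assumes "fg_module A (M :: ('a, 'b) module)"
  obtains N :: "'a umod" and f g where "fg_module A N" "iso_pair A M N f g"
proof -
  obtain N where "N \<in> fg_mods A" "mod_iso A M N" using fg_module_iso_umod[OF assms] by blast
  then show ?thesis using that fg_left[OF assms] fg_left[of A N]
    by (auto simp: fg_mods_def mod_iso_iff)
qed

section \<open>Projective and injective modules\<close>

lemma projective_fg: "projective_module A P \<Longrightarrow> fg_module A P"
  by (simp add: projective_module_def)

lemma injective_fg: "injective_module A P \<Longrightarrow> fg_module A P"
  by (simp add: injective_module_def)

text \<open>The definition tests lifting only against \<open>umod\<close> modules and extensional
  maps. Replacing \<open>X\<close> and \<open>Y\<close> by isomorphic copies makes it usable for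
  finitely generated modules on any carrier.\<close>

lemma projective_lift:
  assumes P: "projective_module A P" and X: "fg_module A X" and Y: "fg_module A Y"
    and f: "lin A X Y f" "\<And>y. y \<in> carrier Y \<Longrightarrow> \<exists>x\<in>carrier X. f x = y" and g: "lin A P Y g"
  obtains h where "lin A P X h" "\<And>p. p \<in> carrier P \<Longrightarrow> f (h p) = g p"
proof -
  obtain X' u u' where X': "fg_module A (X' :: 'a umod)" "iso_pair A X X' u u'"
    using fg_umod[OF X] by metis
  obtain Y' v v' where Y': "fg_module A (Y' :: 'a umod)" "iso_pair A Y Y' v v'"
    using fg_umod[OF Y] by metis
  note u = iso_pairD[OF X'(2)] and v = iso_pairD[OF Y'(2)]
  have f': "lin A X' Y' (\<lambda>x. v (f (u' x)))"
    by (rule lin_comp[OF u(2) lin_comp[OF f(1) v(1)]])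
  have g': "lin A P Y' (\<lambda>x. v (g x))" by (rule lin_comp[OF g v(1)])
  have e: "epi_hom A X' Y' (restrict (\<lambda>x. v (f (u' x))) (carrier X'))"
    unfolding epi_hom_def
  proof (intro conjI lin_mod_hom[OF fg_left[OF X'(1)] f'] equalityI subsetI)
    fix y assume "y \<in> carrier Y'"
    then obtain x where "x \<in> carrier X" "f x = v' y" using f(2) v(6) by blast
    then show "y \<in> restrict (\<lambda>x. v (f (u' x))) (carrier X') ` carrier X'"
      using u(3,5) v(4) \<open>y \<in> carrier Y'\<close> by (intro image_eqI[of _ _ "u x"]) auto
  qed (use linD(1)[OF f'] in auto)
  obtain h where h: "h \<in> mod_hom A P X'"
    "compose (carrier P) (restrict (\<lambda>x. v (f (u' x))) (carrier X')) h = restrict (\<lambda>x. v (g x)) (carrier P)"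
    using P e lin_mod_hom[OF fg_left[OF projective_fg[OF P]] g'] X'(1) Y'(1)
    unfolding projective_module_def fg_mods_def by blast
  note hl = mod_hom_lin[OF h(1)]
  show ?thesis
  proof (rule that)
    show l: "lin A P X (\<lambda>p. u' (h p))" by (rule lin_comp[OF hl u(2)])
    fix p assume p: "p \<in> carrier P"
    then have "v (f (u' (h p))) = v (g p)"
      using fun_cong[OF h(2), of p] linD(1)[OF hl] by (simp add: compose_def)
    then have "v' (v (f (u' (h p)))) = v' (v (g p))" by simp
    then show "f (u' (h p)) = g p"
      using v(3) p linD(1)[OF l] linD(1)[OF f(1)] linD(1)[OF g] by simp
  qed
qed

text \<open>The dual transport: the extension problem is moved to copies of \<open>X\<close> and
  \<open>Y\<close> on the fixed carrier type and its solution is moved back.\<close>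

lemma injective_extend:
  assumes I: "injective_module A I" and X: "fg_module A X" and Y: "fg_module A Y"
    and f: "lin A X Y f" "inj_on f (carrier X)" and g: "lin A X I g"
  obtains h where "lin A Y I h" "\<And>x. x \<in> carrier X \<Longrightarrow> h (f x) = g x"
proof -
  obtain X' u u' where X': "fg_module A (X' :: 'a umod)" "iso_pair A X X' u u'"
    using fg_umod[OF X] by metis
  obtain Y' v v' where Y': "fg_module A (Y' :: 'a umod)" "iso_pair A Y Y' v v'"
    using fg_umod[OF Y] by metis
  note u = iso_pairD[OF X'(2)] and v = iso_pairD[OF Y'(2)]
  have f': "lin A X' Y' (\<lambda>x. v (f (u' x)))"
    by (rule lin_comp[OF u(2) lin_comp[OF f(1) v(1)]])
  have g': "lin A X' I (\<lambda>x. g (u' x))" by (rule lin_comp[OF u(2) g])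
  have e: "mono_hom A X' Y' (restrict (\<lambda>x. v (f (u' x))) (carrier X'))"
    unfolding mono_hom_def
  proof (intro conjI lin_mod_hom[OF fg_left[OF X'(1)] f'] inj_onI)
    fix x y assume xy: "x \<in> carrier X'" "y \<in> carrier X'"
      "restrict (\<lambda>x. v (f (u' x))) (carrier X') x = restrict (\<lambda>x. v (f (u' x))) (carrier X') y"
    have c: "u' x \<in> carrier X" "u' y \<in> carrier X" using xy u(6) by blast+
    have "v' (v (f (u' x))) = v' (v (f (u' y)))" using xy by simp
    then have "f (u' x) = f (u' y)" using v(3) c linD(1)[OF f(1)] by simp
    then have "u' x = u' y" using f(2) c by (simp add: inj_on_eq_iff)
    then show "x = y" using xy u(4) by metis
  qed
  obtain h where h: "h \<in> mod_hom A Y' I"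
    "compose (carrier X') h (restrict (\<lambda>x. v (f (u' x))) (carrier X')) = restrict (\<lambda>x. g (u' x)) (carrier X')"
    using I e lin_mod_hom[OF fg_left[OF X'(1)] g'] X'(1) Y'(1)
    unfolding injective_module_def fg_mods_def by blast
  note hl = mod_hom_lin[OF h(1)]
  show ?thesis
  proof (rule that)
    show l: "lin A Y I (\<lambda>y. h (v y))" by (rule lin_comp[OF v(1) hl])
    fix x assume x: "x \<in> carrier X"
    have ux: "u x \<in> carrier X'" using x u(5) by blast
    then show "h (v (f x)) = g x"
      using fun_cong[OF h(2), of "u x"] u(3) x by (simp add: compose_def)
  qed
qed

text \<open>For the converse, lifts need only be produced as plain linear maps against
  \<open>umod\<close> modules; restricting them to the carrier restores extensionality.\<close>

lemma projectiveI:
  fixes P :: "('a, 'b) module"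
  assumes P: "fg_module A P"
    and lift: "\<And>(X :: 'a umod) (Y :: 'a umod) f g. \<lbrakk>fg_module A X; fg_module A Y; lin A X Y f;
      \<And>y. y \<in> carrier Y \<Longrightarrow> \<exists>x\<in>carrier X. f x = y; lin A P Y g\<rbrakk> \<Longrightarrow>
      \<exists>h. lin A P X h \<and> (\<forall>p\<in>carrier P. f (h p) = g p)"
  shows "projective_module A P"
  unfolding projective_module_def
proof (intro conjI P ballI allI impI)
  interpret P: left_module A P by (rule fg_left[OF P])
  fix X Y :: "'a umod" and f g
  assume XY: "X \<in> fg_mods A" "Y \<in> fg_mods A" and fg: "epi_hom A X Y f \<and> g \<in> mod_hom A P Y"
  have s: "\<exists>x\<in>carrier X. f x = y" if "y \<in> carrier Y" for y
    using fg that unfolding epi_hom_def by (metis imageE)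
  have l: "lin A X Y f" "lin A P Y g" using fg mod_hom_lin unfolding epi_hom_def by blast+
  obtain h where h: "lin A P X h" "\<And>p. p \<in> carrier P \<Longrightarrow> f (h p) = g p"
    using lift[OF _ _ l(1) s l(2)] XY unfolding fg_mods_def by blast
  have "compose (carrier P) f (restrict h (carrier P)) = g"
    using h(2) fg mod_homD(1)[of g A P Y] by (auto simp: compose_def fun_eq_iff extensional_def)
  then show "\<exists>h\<in>mod_hom A P X. compose (carrier P) f h = g"
    using lin_mod_hom[OF P.left_module_axioms h(1)] by blast
qed

lemma injectiveI:
  fixes I :: "('a, 'b) module"
  assumes I: "fg_module A I"
    and ext: "\<And>(X :: 'a umod) (Y :: 'a umod) f g. \<lbrakk>fg_module A X; fg_module A Y; lin A X Y f;
      inj_on f (carrier X); lin A X I g\<rbrakk> \<Longrightarrow>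
      \<exists>h. lin A Y I h \<and> (\<forall>x\<in>carrier X. h (f x) = g x)"
  shows "injective_module A I"
  unfolding injective_module_def
proof (intro conjI I ballI allI impI)
  fix X Y :: "'a umod" and f g
  assume XY: "X \<in> fg_mods A" "Y \<in> fg_mods A" and fg: "mono_hom A X Y f \<and> g \<in> mod_hom A X I"
  have l: "lin A X Y f" "lin A X I g" "inj_on f (carrier X)"
    using fg mod_hom_lin unfolding mono_hom_def by blast+
  obtain h where h: "lin A Y I h" "\<And>p. p \<in> carrier X \<Longrightarrow> h (f p) = g p"
    using ext[OF _ _ l(1,3,2)] XY unfolding fg_mods_def by blast
  have "compose (carrier X) (restrict h (carrier Y)) f = g"
    using h(2) fg mod_homD(1)[of g A X I] mod_homD(2)[of f A X Y]
    by (auto simp: compose_def fun_eq_iff extensional_def mono_hom_def)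
  then show "\<exists>h\<in>mod_hom A Y I. compose (carrier X) h f = g"
    using lin_mod_hom[OF _ h(1)] XY fg_left by (auto simp: fg_mods_def)
qed

text \<open>A map out of \<open>M\<close> becomes a map out of \<open>P\<close> after precomposition
  with the retraction; its lift is pulled back along the inclusion.\<close>

lemma projective_retract:
  assumes P: "projective_module A P" and M: "left_module A M" and r: "retract A M P"
  shows "projective_module A M"
proof (rule projectiveI)
  obtain i r where ir: "lin A M P i" "lin A P M r" "\<And>x. x \<in> carrier M \<Longrightarrow> r (i x) = x"
    using r unfolding retract_def by blast
  fix X Y :: "'a umod" and f g
  assume a: "fg_module A X" "fg_module A Y" "lin A X Y f"
      "\<And>y. y \<in> carrier Y \<Longrightarrow> \<exists>x\<in>carrier X. f x = y" "lin A M Y g"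
  obtain h where "lin A P X h" "\<And>p. p \<in> carrier P \<Longrightarrow> f (h p) = g (r p)"
    using projective_lift[OF P a(1-4) lin_comp[OF ir(2) a(5)]] by blast
  then show "\<exists>h. lin A M X h \<and> (\<forall>p\<in>carrier M. f (h p) = g p)"
    using lin_comp[OF ir(1)] ir(3) linD(1)[OF ir(1)] by (intro exI[of _ "\<lambda>x. h (i x)"]) auto
qed (rule fg_retract[OF projective_fg[OF P] M r])

text \<open>A map into \<open>M\<close> becomes a map into \<open>I\<close> by the inclusion; its
  extension is pushed back along the retraction.\<close>

lemma injective_retract:
  assumes I: "injective_module A I" and M: "left_module A M" and r: "retract A M I"
  shows "injective_module A M"
proof (rule injectiveI)
  obtain i r where ir: "lin A M I i" "lin A I M r" "\<And>x. x \<in> carrier M \<Longrightarrow> r (i x) = x"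
    using r unfolding retract_def by blast
  fix X Y :: "'a umod" and f g
  assume a: "fg_module A X" "fg_module A Y" "lin A X Y f" "inj_on f (carrier X)" "lin A X M g"
  obtain h where "lin A Y I h" "\<And>x. x \<in> carrier X \<Longrightarrow> h (f x) = i (g x)"
    using injective_extend[OF I a(1-4) lin_comp[OF a(5) ir(1)]] by blast
  then show "\<exists>h. lin A Y M h \<and> (\<forall>p\<in>carrier X. h (f p) = g p)"
    using lin_comp[OF _ ir(2)] ir(3) linD(1)[OF a(5)] by (intro exI[of _ "\<lambda>x. r (h x)"]) auto
qed (rule fg_retract[OF injective_fg[OF I] M r])

section \<open>The regular module\<close>

lemma regular_simps [simp]:
  "carrier (regular_module A) = carrier A" "\<zero>\<^bsub>regular_module A\<^esub> = \<zero>\<^bsub>A\<^esub>"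
  "x \<oplus>\<^bsub>regular_module A\<^esub> y = x \<oplus>\<^bsub>A\<^esub> y" "a \<odot>\<^bsub>regular_module A\<^esub> x = a \<otimes>\<^bsub>A\<^esub> x"
  by (simp_all add: regular_module_def scalar_module_def)

lemma left_module_regular:
  assumes "ring A"
  shows "left_module A (regular_module A)"
proof -
  interpret ring A by fact
  show ?thesis
  proof (rule left_moduleI)
    fix x assume "x \<in> carrier (regular_module A)"
    then show "\<exists>y\<in>carrier (regular_module A). y \<oplus>\<^bsub>regular_module A\<^esub> x = \<zero>\<^bsub>regular_module A\<^esub>"
      by (intro bexI[of _ "\<ominus>\<^bsub>A\<^esub> x"]) (auto simp: l_neg)
  qed (auto simp: a_ac l_distr r_distr m_assoc assms)
qed

lemma fg_regular:
  assumes "ring A"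
  shows "fg_module A (regular_module A)"
  unfolding fg_module_def
proof (intro conjI left_module_regular assms exI[of _ "{\<one>\<^bsub>A\<^esub>}"] allI impI)
  interpret ring A by fact
  fix H assume H: "submodule H A (regular_module A) \<and> {\<one>\<^bsub>A\<^esub>} \<subseteq> H"
  have "a \<in> H" if "a \<in> carrier A" for a
    using submoduleD(4)[of H A "regular_module A" a "\<one>\<^bsub>A\<^esub>"] H that by simp
  then show "H = carrier (regular_module A)" using submoduleD(1)[of H A "regular_module A"] H by auto
qed (simp_all add: assms ring.ring_simprules(6))

lemma lin_regular:
  assumes "left_module A X" "x \<in> carrier X"
  shows "lin A (regular_module A) X (\<lambda>a. a \<odot>\<^bsub>X\<^esub> x)"
proof -
  interpret left_module A X by fact
  show ?thesis using assms(2) by (auto intro!: linI simp: smult_l_distr smult_assoc1)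
qed

text \<open>A map out of the regular module is determined by the image of the unit, so any preimage
  of that image defines a lift.\<close>

lemma projective_regular:
  assumes "ring A"
  shows "projective_module A (regular_module A)"
proof (rule projectiveI[OF fg_regular[OF assms]])
  interpret ring A by fact
  fix X Y :: "'a umod" and f g
  assume a: "fg_module A X" "fg_module A Y" "lin A X Y f"
      "\<And>y. y \<in> carrier Y \<Longrightarrow> \<exists>x\<in>carrier X. f x = y" "lin A (regular_module A) Y g"
  have "g \<one>\<^bsub>A\<^esub> \<in> carrier Y" using linD(1)[OF a(5), of "\<one>\<^bsub>A\<^esub>"] by simp
  then obtain x where x: "x \<in> carrier X" "f x = g \<one>\<^bsub>A\<^esub>" using a(4) by blast
  have "f (p \<odot>\<^bsub>X\<^esub> x) = g p" if "p \<in> carrier A" for p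
  proof -
    have "g (p \<otimes>\<^bsub>A\<^esub> \<one>\<^bsub>A\<^esub>) = p \<odot>\<^bsub>Y\<^esub> g \<one>\<^bsub>A\<^esub>"
      using linD(3)[OF a(5) that, of "\<one>\<^bsub>A\<^esub>"] by simp
    then show ?thesis unfolding linD(3)[OF a(3) that x(1)] x(2) using that by simp
  qed
  then show "\<exists>h. lin A (regular_module A) X h \<and> (\<forall>p\<in>carrier (regular_module A). f (h p) = g p)"
    unfolding regular_simps using lin_regular[OF fg_left[OF a(1)] x(1)] by (intro exI[of _ "\<lambda>a. a \<odot>\<^bsub>X\<^esub> x"]) simp
qed

section \<open>Direct sums\<close>

lemma dsum_simps:
  "carrier (dsum I M) = {f \<in> (\<Pi>\<^sub>E i\<in>I. carrier (M i)). finite {i \<in> I. f i \<noteq> \<zero>\<^bsub>M i\<^esub>}}"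
  "\<zero>\<^bsub>dsum I M\<^esub> = (\<lambda>i\<in>I. \<zero>\<^bsub>M i\<^esub>)"
  "f \<oplus>\<^bsub>dsum I M\<^esub> g = (\<lambda>i\<in>I. f i \<oplus>\<^bsub>M i\<^esub> g i)"
  "a \<odot>\<^bsub>dsum I M\<^esub> f = (\<lambda>i\<in>I. a \<odot>\<^bsub>M i\<^esub> f i)"
  by (simp_all add: dsum_def)

lemma carrier_dsum_finite: "finite I \<Longrightarrow> carrier (dsum I M) = (\<Pi>\<^sub>E i\<in>I. carrier (M i))"
  by (simp add: dsum_simps)

lemma dsum_component: "\<lbrakk>f \<in> carrier (dsum I M); i \<in> I\<rbrakk> \<Longrightarrow> f i \<in> carrier (M i)"
  by (auto simp: dsum_simps)

lemma left_module_dsum: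
  assumes R: "ring A" and M: "\<And>i. i \<in> I \<Longrightarrow> left_module A (M i)"
  shows "left_module A (dsum I M)"
proof -
  let ?D = "dsum I M"
  have ag: "abelian_group (M i)" if "i \<in> I" for i
    using M[OF that] by (simp add: left_module_def)
  have am: "abelian_monoid (M i)" if "i \<in> I" for i
    using ag[OF that] by (simp add: abelian_group_def)
  note cl = am[THEN abelian_monoid.a_closed] am[THEN abelian_monoid.zero_closed]
    M[THEN left_module.smult_closed]
  note ze = am[THEN abelian_monoid.l_zero] am[THEN abelian_monoid.zero_closed]
    M[THEN left_module.smult_zero]
  show ?thesis
  proof (rule left_moduleI[OF R])
    fix x y assume xy: "x \<in> carrier (?D)" "y \<in> carrier (?D)"
    then have "finite ({i \<in> I. x i \<noteq> \<zero>\<^bsub>M i\<^esub>} \<union> {i \<in> I. y i \<noteq> \<zero>\<^bsub>M i\<^esub>})"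
      by (simp add: dsum_simps)
    moreover have "{i \<in> I. x i \<oplus>\<^bsub>M i\<^esub> y i \<noteq> \<zero>\<^bsub>M i\<^esub>} \<subseteq> {i \<in> I. x i \<noteq> \<zero>\<^bsub>M i\<^esub>} \<union> {i \<in> I. y i \<noteq> \<zero>\<^bsub>M i\<^esub>}"
      using ze(1,2) by auto
    ultimately have "finite {i \<in> I. x i \<oplus>\<^bsub>M i\<^esub> y i \<noteq> \<zero>\<^bsub>M i\<^esub>}" by (rule rev_finite_subset)
    then show "x \<oplus>\<^bsub>?D\<^esub> y \<in> carrier (?D)"
      using xy cl(1) by (auto simp: dsum_simps PiE_iff cong: conj_cong)
  next
    fix a x assume ax: "a \<in> carrier A" "x \<in> carrier (?D)"
    then have "finite {i \<in> I. a \<odot>\<^bsub>M i\<^esub> x i \<noteq> \<zero>\<^bsub>M i\<^esub>}"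
      by (intro finite_subset[of "{i \<in> I. a \<odot>\<^bsub>M i\<^esub> x i \<noteq> \<zero>\<^bsub>M i\<^esub>}" "{i \<in> I. x i \<noteq> \<zero>\<^bsub>M i\<^esub>}"])
         (use ze(3) in \<open>auto simp: dsum_simps\<close>)
    then show "a \<odot>\<^bsub>?D\<^esub> x \<in> carrier (?D)"
      using ax cl(3) by (auto simp: dsum_simps PiE_iff cong: conj_cong)
  next
    fix x assume x: "x \<in> carrier (?D)"
    have "finite {i \<in> I. \<ominus>\<^bsub>M i\<^esub> x i \<noteq> \<zero>\<^bsub>M i\<^esub>}"
      by (rule finite_subset[of _ "{i \<in> I. x i \<noteq> \<zero>\<^bsub>M i\<^esub>}"])
        (use x ag[THEN abelian_group.minus_equality] ze in \<open>auto simp: dsum_simps\<close>)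
    then show "\<exists>y\<in>carrier (?D). y \<oplus>\<^bsub>?D\<^esub> x = \<zero>\<^bsub>?D\<^esub>"
      using x ag[THEN abelian_group.a_inv_closed] ag[THEN abelian_group.l_neg]
      by (intro bexI[of _ "\<lambda>i\<in>I. \<ominus>\<^bsub>M i\<^esub> x i"])
        (auto simp: dsum_simps PiE_iff cong: conj_cong intro!: restrict_ext)
  next
    show "\<zero>\<^bsub>?D\<^esub> \<in> carrier (?D)"
      using cl(2) by (auto simp: dsum_simps PiE_iff cong: conj_cong)
  next
    fix x assume "x \<in> carrier (?D)"
    then show "\<zero>\<^bsub>?D\<^esub> \<oplus>\<^bsub>?D\<^esub> x = x" "\<one>\<^bsub>A\<^esub> \<odot>\<^bsub>?D\<^esub> x = x"
      using ze(1) M[THEN left_module.smult_one]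
      by (auto simp: dsum_simps PiE_iff extensional_def fun_eq_iff)
  next
    fix x y assume "x \<in> carrier (?D)" "y \<in> carrier (?D)"
    then show "x \<oplus>\<^bsub>?D\<^esub> y = y \<oplus>\<^bsub>?D\<^esub> x"
      using am[THEN abelian_monoid.a_comm]
      by (auto simp: dsum_simps PiE_iff intro!: restrict_ext)
  next
    fix x y z assume "x \<in> carrier (?D)" "y \<in> carrier (?D)" "z \<in> carrier (?D)"
    then show "(x \<oplus>\<^bsub>?D\<^esub> y) \<oplus>\<^bsub>?D\<^esub> z = x \<oplus>\<^bsub>?D\<^esub> (y \<oplus>\<^bsub>?D\<^esub> z)"
      using am[THEN abelian_monoid.a_assoc]
      by (auto simp: dsum_simps PiE_iff intro!: restrict_ext)
  next
    fix a x y assume "a \<in> carrier A" "x \<in> carrier (?D)" "y \<in> carrier (?D)"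
    then show "a \<odot>\<^bsub>?D\<^esub> (x \<oplus>\<^bsub>?D\<^esub> y) = a \<odot>\<^bsub>?D\<^esub> x \<oplus>\<^bsub>?D\<^esub> a \<odot>\<^bsub>?D\<^esub> y"
      using M[THEN left_module.smult_r_distr]
      by (auto simp: dsum_simps PiE_iff intro!: restrict_ext)
  next
    fix a b x assume "a \<in> carrier A" "b \<in> carrier A" "x \<in> carrier (?D)"
    then show "(a \<oplus>\<^bsub>A\<^esub> b) \<odot>\<^bsub>?D\<^esub> x = a \<odot>\<^bsub>?D\<^esub> x \<oplus>\<^bsub>?D\<^esub> b \<odot>\<^bsub>?D\<^esub> x"
      "(a \<otimes>\<^bsub>A\<^esub> b) \<odot>\<^bsub>?D\<^esub> x = a \<odot>\<^bsub>?D\<^esub> (b \<odot>\<^bsub>?D\<^esub> x)"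
      using M[THEN left_module.smult_l_distr] M[THEN left_module.smult_assoc1]
      by (auto simp: dsum_simps PiE_iff intro!: restrict_ext)
  qed
qed

lemma lin_dsum_proj: "i \<in> I \<Longrightarrow> lin A (dsum I M) (M i) (\<lambda>f. f i)"
  by (rule linI) (auto simp: dsum_simps)

lemma lin_dsum_incl:
  assumes M: "\<And>i. i \<in> I \<Longrightarrow> left_module A (M i)" and i: "i \<in> I"
  shows "lin A (M i) (dsum I M) (\<lambda>x. \<lambda>j\<in>I. if j = i then x else \<zero>\<^bsub>M j\<^esub>)"
proof -
  have am: "abelian_monoid (M i)" if "i \<in> I" for i
    using M[OF that] by (simp add: left_module_def abelian_group_def)
  note ze = am[THEN abelian_monoid.zero_closed] am[THEN abelian_monoid.l_zero]
    M[THEN left_module.smult_zero]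
  show ?thesis
  proof (rule linI)
    fix x assume x: "x \<in> carrier (M i)"
    have "finite {j \<in> I. (\<lambda>j\<in>I. if j = i then x else \<zero>\<^bsub>M j\<^esub>) j \<noteq> \<zero>\<^bsub>M j\<^esub>}"
      by (rule finite_subset[of _ "{i}"]) auto
    then show "(\<lambda>j\<in>I. if j = i then x else \<zero>\<^bsub>M j\<^esub>) \<in> carrier (dsum I M)"
      using x ze(1) by (auto simp: dsum_simps)
  qed (use ze i in \<open>auto simp: dsum_simps intro!: restrict_ext\<close>)
qed

lemma retract_dsum_component:
  assumes "\<And>i. i \<in> I \<Longrightarrow> left_module A (M i)" and "i \<in> I"
  shows "retract A (M i) (dsum I M)"
  unfolding retract_def using lin_dsum_incl[OF assms] lin_dsum_proj[OF assms(2)] assms(2)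
  by (intro exI[of _ "\<lambda>x. \<lambda>j\<in>I. if j = i then x else \<zero>\<^bsub>M j\<^esub>"] exI[of _ "\<lambda>f. f i"]) auto

lemma lin_dsum:
  assumes "finite J" and "\<And>j. j \<in> J \<Longrightarrow> lin A X (N j) (f j)"
    and "left_module A X"
  shows "lin A X (dsum J N) (\<lambda>x. \<lambda>j\<in>J. f j x)"
proof -
  interpret X: left_module A X by fact
  show ?thesis
    by (rule linI) (use linD[OF assms(2)] in \<open>auto simp: carrier_dsum_finite[OF assms(1)] dsum_simps(3,4)
      intro!: restrict_ext\<close>)
qed

lemma dsum_ext:
  "\<lbrakk>f \<in> carrier (dsum I M); g \<in> carrier (dsum I M); \<And>i. i \<in> I \<Longrightarrow> f i = g i\<rbrakk> \<Longrightarrow> f = g"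
  by (auto simp: dsum_simps intro: PiE_ext)

lemma retract_dsum:
  assumes I: "finite I" and R: "ring A"
    and M: "\<And>i. i \<in> I \<Longrightarrow> left_module A (M i)" "\<And>i. i \<in> I \<Longrightarrow> left_module A (N i)"
    and r: "\<And>i. i \<in> I \<Longrightarrow> retract A (M i) (N i)"
  shows "retract A (dsum I M) (dsum I N)"
proof -
  \<comment> \<open>Inclusion and retraction are packed into one pair, so that a single choice
    function supplies both.\<close>
  have "\<forall>i\<in>I. \<exists>p. lin A (M i) (N i) (fst p) \<and> lin A (N i) (M i) (snd p) \<and>
      (\<forall>x\<in>carrier (M i). snd p (fst p x) = x)"
    using r unfolding retract_def by fastforce
  then obtain p where p: "\<forall>i\<in>I. lin A (M i) (N i) (fst (p i)) \<and> lin A (N i) (M i) (snd (p i)) \<and>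
      (\<forall>x\<in>carrier (M i). snd (p i) (fst (p i) x) = x)"
    unfolding bchoice_iff by blast
  let ?u = "\<lambda>x. \<lambda>i\<in>I. fst (p i) (x i)" and ?v = "\<lambda>x. \<lambda>i\<in>I. snd (p i) (x i)"
  have u: "lin A (dsum I M) (dsum I N) ?u"
    using p by (intro lin_dsum[OF I] lin_comp[OF lin_dsum_proj] left_module_dsum R M) auto
  have v: "lin A (dsum I N) (dsum I M) ?v"
    using p by (intro lin_dsum[OF I] lin_comp[OF lin_dsum_proj] left_module_dsum R M) auto
  have "?v (?u x) = x" if x: "x \<in> carrier (dsum I M)" for x
    by (rule dsum_ext[OF linD(1)[OF v linD(1)[OF u x]] x])
      (use p dsum_component[OF x] in simp)
  then show ?thesis unfolding retract_def using u v by (intro exI[of _ ?u] exI[of _ ?v]) blast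
qed

text \<open>Extension by zero along the injection \<open>e\<close> is split by restriction to its
  image. This cuts a subfamily out of a direct sum when repeated summands are dropped.\<close>

lemma retract_dsum_reindex:
  assumes I: "finite I" "finite J" and e: "inj_on e J" "e ` J \<subseteq> I" and R: "ring A"
    and M: "\<And>i. i \<in> I \<Longrightarrow> left_module A (M i)"
  shows "retract A (dsum J (\<lambda>j. M (e j))) (dsum I M)"
proof -
  let ?g = "the_inv_into J e"
  let ?u = "\<lambda>x. \<lambda>i\<in>I. if i \<in> e ` J then x (?g i) else \<zero>\<^bsub>M i\<^esub>"
  let ?v = "\<lambda>x. \<lambda>j\<in>J. x (e j)"
  let ?J = "dsum J (\<lambda>j. M (e j))"
  have g: "?g i \<in> J" "e (?g i) = i" if "i \<in> e ` J" for i
    using that e(1) by (auto simp: the_inv_into_f_f)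
  have lmJ: "left_module A ?J" 
    by (rule left_module_dsum[OF R]) (use M e in auto)
  have u: "lin A ?J (dsum I M) ?u"
  proof (rule lin_dsum[OF I(1) _ lmJ])
    fix i assume i: "i \<in> I"
    show "lin A ?J (M i) (\<lambda>x. if i \<in> e ` J then x (?g i) else \<zero>\<^bsub>M i\<^esub>)"
    proof (cases "i \<in> e ` J")
      case True
      then show ?thesis using lin_dsum_proj[of "?g i" J A "\<lambda>j. M (e j)"] g[OF True] by simp
    next
      case False
      then show ?thesis using lin_const_zero[OF M[OF i]] by simp
    qed
  qed
  have v: "lin A (dsum I M) ?J ?v"
    by (rule lin_dsum[OF I(2)]) (use e(2) in \<open>auto intro!: lin_dsum_proj left_module_dsum R M\<close>)
  have "?v (?u x) = x" if x: "x \<in> carrier ?J" for x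
    by (rule dsum_ext[OF linD(1)[OF v linD(1)[OF u x]] x])
      (use e in \<open>auto simp: the_inv_into_f_f\<close>)
  then show ?thesis unfolding retract_def using u v by (intro exI[of _ ?u] exI[of _ ?v]) blast
qed

section \<open>Binary direct sums\<close>

lemma dsum2_simps [simp]:
  "carrier (dsum2 M N) = carrier M \<times> carrier N"
  "\<zero>\<^bsub>dsum2 M N\<^esub> = (\<zero>\<^bsub>M\<^esub>, \<zero>\<^bsub>N\<^esub>)"
  "(x, y) \<oplus>\<^bsub>dsum2 M N\<^esub> (x', y') = (x \<oplus>\<^bsub>M\<^esub> x', y \<oplus>\<^bsub>N\<^esub> y')"
  "a \<odot>\<^bsub>dsum2 M N\<^esub> (x, y) = (a \<odot>\<^bsub>M\<^esub> x, a \<odot>\<^bsub>N\<^esub> y)"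
  by (simp_all add: dsum2_def)

lemma left_module_dsum2:
  assumes "left_module A M" "left_module A N"
  shows "left_module A (dsum2 M N)"
proof -
  interpret M: left_module A M by fact
  interpret N: left_module A N by fact
  show ?thesis
  proof (rule left_moduleI)
    fix p assume "p \<in> carrier (dsum2 M N)"
    then show "\<exists>q\<in>carrier (dsum2 M N). q \<oplus>\<^bsub>dsum2 M N\<^esub> p = \<zero>\<^bsub>dsum2 M N\<^esub>"
      by (intro bexI[of _ "(\<ominus>\<^bsub>M\<^esub> fst p, \<ominus>\<^bsub>N\<^esub> snd p)"]) (auto simp: M.M.l_neg N.M.l_neg)
  qed (auto simp: M.M.a_ac N.M.a_ac M.smult_l_distr N.smult_l_distr M.smult_r_distr N.smult_r_distr
      M.smult_assoc1 N.smult_assoc1 M.R.ring_axioms)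
qed

lemma lin_fst: "lin A (dsum2 M N) M fst" and lin_snd: "lin A (dsum2 M N) N snd"
  by (auto intro!: linI)

lemma lin_pair: "\<lbrakk>lin A X M f; lin A X N g\<rbrakk> \<Longrightarrow> lin A X (dsum2 M N) (\<lambda>x. (f x, g x))"
  by (simp add: lin_def)

lemma lin_copair:
  assumes "left_module A X" "lin A M X f" "lin A N X g"
  shows "lin A (dsum2 M N) X (\<lambda>p. f (fst p) \<oplus>\<^bsub>X\<^esub> g (snd p))"
  by (intro lin_add assms lin_comp[OF lin_fst] lin_comp[OF lin_snd])

lemma fg_dsum2:
  assumes "fg_module A M" "fg_module A N"
  shows "fg_module A (dsum2 M N)"
proof -
  note lm = fg_left[OF assms(1)] fg_left[OF assms(2)]
  interpret M: left_module A M by fact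
  interpret N: left_module A N by fact
  interpret MN: left_module A "dsum2 M N" using left_module_dsum2[OF lm] .
  from assms(1) obtain S where S: "finite S" "S \<subseteq> carrier M"
    "\<And>H. \<lbrakk>submodule H A M; S \<subseteq> H\<rbrakk> \<Longrightarrow> H = carrier M"
    by (rule fg_generators) blast
  from assms(2) obtain S' where S': "finite S'" "S' \<subseteq> carrier N"
    "\<And>H. \<lbrakk>submodule H A N; S' \<subseteq> H\<rbrakk> \<Longrightarrow> H = carrier N"
    by (rule fg_generators) blast
  show ?thesis unfolding fg_module_def
  proof (intro conjI MN.left_module_axioms exI[of _ "(S \<times> {\<zero>\<^bsub>N\<^esub>}) \<union> ({\<zero>\<^bsub>M\<^esub>} \<times> S')"] allI impI)
    fix H assume H: "submodule H A (dsum2 M N) \<and> (S \<times> {\<zero>\<^bsub>N\<^esub>}) \<union> ({\<zero>\<^bsub>M\<^esub>} \<times> S') \<subseteq> H"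
    then have sH: "submodule H A (dsum2 M N)" by blast
    have "{x \<in> carrier M. (x, \<zero>\<^bsub>N\<^esub>) \<in> H} = carrier M"
      using H S(2)
      by (intro S(3) submodule_vimage[OF lm(1) MN.left_module_axioms lin_pair[OF lin_id lin_const_zero[OF lm(2)]] sH]) auto
    moreover have "{x \<in> carrier N. (\<zero>\<^bsub>M\<^esub>, x) \<in> H} = carrier N"
      using H S'(2)
      by (intro S'(3) submodule_vimage[OF lm(2) MN.left_module_axioms lin_pair[OF lin_const_zero[OF lm(1)] lin_id] sH]) auto
    ultimately have "(x, y) \<in> H" if "x \<in> carrier M" "y \<in> carrier N" for x y
      using submoduleD(3)[OF sH, of "(x, \<zero>\<^bsub>N\<^esub>)" "(\<zero>\<^bsub>M\<^esub>, y)"] that by auto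
    then show "H = carrier (dsum2 M N)" using submoduleD(1)[OF sH] by auto
  qed (use S S' in auto)
qed

lemma projective_dsum2:
  assumes "projective_module A M" "projective_module A N"
  shows "projective_module A (dsum2 M N)"
proof (rule projectiveI[OF fg_dsum2[OF projective_fg[OF assms(1)] projective_fg[OF assms(2)]]])
  note lm = fg_left[OF projective_fg[OF assms(1)]] fg_left[OF projective_fg[OF assms(2)]]
  interpret M: left_module A M by fact
  interpret N: left_module A N by fact
  fix X Y :: "'a umod" and f g
  assume a: "fg_module A X" "fg_module A Y" "lin A X Y f"
      "\<And>y. y \<in> carrier Y \<Longrightarrow> \<exists>x\<in>carrier X. f x = y" "lin A (dsum2 M N) Y g"
  obtain h where h: "lin A M X h" "\<And>p. p \<in> carrier M \<Longrightarrow> f (h p) = g (p, \<zero>\<^bsub>N\<^esub>)"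
    using projective_lift[OF assms(1) a(1-4) lin_comp[OF lin_pair[OF lin_id lin_const_zero[OF lm(2)]] a(5)]]
    by blast
  obtain h' where h': "lin A N X h'" "\<And>p. p \<in> carrier N \<Longrightarrow> f (h' p) = g (\<zero>\<^bsub>M\<^esub>, p)"
    using projective_lift[OF assms(2) a(1-4) lin_comp[OF lin_pair[OF lin_const_zero[OF lm(1)] lin_id] a(5)]]
    by blast
  have "f (h x \<oplus>\<^bsub>X\<^esub> h' y) = g (x, y)" if "x \<in> carrier M" "y \<in> carrier N" for x y
    using linD(2)[OF a(3), of "h x" "h' y"] linD(2)[OF a(5), of "(x, \<zero>\<^bsub>N\<^esub>)" "(\<zero>\<^bsub>M\<^esub>, y)"] that
      linD(1)[OF h(1)] linD(1)[OF h'(1)] h(2) h'(2) by simp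
  then show "\<exists>h. lin A (dsum2 M N) X h \<and> (\<forall>p\<in>carrier (dsum2 M N). f (h p) = g p)"
    by (intro exI[of _ "\<lambda>p. h (fst p) \<oplus>\<^bsub>X\<^esub> h' (snd p)"] conjI lin_copair[OF fg_left[OF a(1)] h(1) h'(1)]) auto
qed

lemma injective_dsum2:
  assumes "injective_module A M" "injective_module A N"
  shows "injective_module A (dsum2 M N)"
proof (rule injectiveI[OF fg_dsum2[OF injective_fg[OF assms(1)] injective_fg[OF assms(2)]]])
  fix X Y :: "'a umod" and f g
  assume a: "fg_module A X" "fg_module A Y" "lin A X Y f" "inj_on f (carrier X)" "lin A X (dsum2 M N) g"
  obtain h where h: "lin A Y M h" "\<And>x. x \<in> carrier X \<Longrightarrow> h (f x) = fst (g x)"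
    using injective_extend[OF assms(1) a(1-4) lin_comp[OF a(5) lin_fst]] by blast
  obtain h' where h': "lin A Y N h'" "\<And>x. x \<in> carrier X \<Longrightarrow> h' (f x) = snd (g x)"
    using injective_extend[OF assms(2) a(1-4) lin_comp[OF a(5) lin_snd]] by blast
  show "\<exists>h. lin A Y (dsum2 M N) h \<and> (\<forall>x\<in>carrier X. h (f x) = g x)"
    using lin_pair[OF h(1) h'(1)] h(2) h'(2) by (intro exI[of _ "\<lambda>x. (h x, h' x)"]) simp
qed

text \<open>The second family is shifted by \<open>n\<close>, so that the sum of two decomposed
  modules is again indexed by an initial segment of the naturals.\<close>

lemma dsum_append_iso:
  fixes n m :: nat
  assumes R: "ring A" and X: "\<And>i. i < n \<Longrightarrow> left_module A (X i)"
    and Y: "\<And>i. i < m \<Longrightarrow> left_module A (Y i)"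
  obtains f g where
    "iso_pair A (dsum2 (dsum {..<n} X) (dsum {..<m} Y))
       (dsum {..<n + m} (\<lambda>i. if i < n then X i else Y (i - n))) f g"
proof -
  let ?Z = "\<lambda>i. if i < n then X i else Y (i - n)"
  let ?D = "dsum2 (dsum {..<n} X) (dsum {..<m} Y)"
  let ?U = "dsum {..<n + m} ?Z"
  let ?X = "dsum {..<n} X"
  let ?Y = "dsum {..<m} Y"
  let ?f = "\<lambda>p. \<lambda>i\<in>{..<n + m}. if i < n then fst p i else snd p (i - n)"
  let ?g = "\<lambda>x. (\<lambda>i\<in>{..<n}. x i, \<lambda>i\<in>{..<m}. x (n + i))"
  have lX: "left_module A ?X" and lY: "left_module A ?Y"
    using X Y by (auto intro: left_module_dsum[OF R])
  have "left_module A (?Z i)" if "i < n + m" for i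
    using X[of i] Y[of "i - n"] that by (cases "i < n") auto
  then have lZ: "left_module A ?U" by (intro left_module_dsum[OF R]) simp
  have f: "lin A ?D ?U ?f"
  proof (rule lin_dsum[OF _ _ left_module_dsum2[OF lX lY]])
    fix i assume i: "i \<in> {..<n + m}"
    show "lin A ?D (?Z i) (\<lambda>p. if i < n then fst p i else snd p (i - n))"
    proof (cases "i < n")
      case True
      then show ?thesis using lin_comp[OF lin_fst lin_dsum_proj[of i "{..<n}" A X]] by simp
    next
      case False
      then have "i - n \<in> {..<m}" using i by auto
      then show ?thesis using lin_comp[OF lin_snd lin_dsum_proj[of "i - n" "{..<m}" A Y]] False by simp
    qed
  qed simp
  have p1: "lin A ?U (X i) (\<lambda>x. x i)" if "i \<in> {..<n}" for i
    using lin_dsum_proj[of i "{..<n + m}" A ?Z] that by simp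
  have p2: "lin A ?U (Y i) (\<lambda>x. x (n + i))" if "i \<in> {..<m}" for i
    using lin_dsum_proj[of "n + i" "{..<n + m}" A ?Z] that by simp
  have g: "lin A ?U ?D ?g"
    by (intro lin_pair lin_dsum lZ p1 p2) auto
  have "?g (?f p) = p" if p: "p \<in> carrier ?D" for p
  proof -
    have c: "?g (?f p) \<in> carrier ?D" by (rule linD(1)[OF g linD(1)[OF f p]])
    have "fst (?g (?f p)) = fst p"
      by (rule dsum_ext[of _ "{..<n}" X]) (use c p in \<open>auto simp: mem_Times_iff\<close>)
    moreover have "snd (?g (?f p)) = snd p"
      by (rule dsum_ext[of _ "{..<m}" Y]) (use c p in \<open>auto simp: mem_Times_iff\<close>)
    ultimately show ?thesis by (rule prod_eqI)
  qed
  moreover have "?f (?g x) = x" if x: "x \<in> carrier ?U" for x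
    by (rule dsum_ext[OF linD(1)[OF f linD(1)[OF g x]] x]) auto
  ultimately have "iso_pair A ?D ?U ?f ?g"
    using f g unfolding iso_pair_def by blast
  then show ?thesis by (rule that)
qed

lemma dsum_singleton_iso:
  assumes "left_module A (X i)"
  obtains f g where "iso_pair A (X i) (dsum {i} X) f g"
proof -
  have "lin A (X i) (dsum {i} X) (\<lambda>x. \<lambda>j\<in>{i}. x)" by (rule lin_dsum) (use assms lin_id in auto)
  moreover have "lin A (dsum {i} X) (X i) (\<lambda>f. f i)" by (rule lin_dsum_proj) simp
  ultimately have "iso_pair A (X i) (dsum {i} X) (\<lambda>x. \<lambda>j\<in>{i}. x) (\<lambda>f. f i)"
    unfolding iso_pair_def by (auto simp: dsum_simps PiE_iff extensional_def fun_eq_iff)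
  then show ?thesis by (rule that)
qed

lemma fg_dsum_empty:
  assumes "ring A"
  shows "fg_module A (dsum {} X)"
  unfolding fg_module_def
proof (intro conjI exI[of _ "{}"] allI impI)
  show "left_module A (dsum {} X)" by (rule left_module_dsum[OF assms]) simp
  fix H assume H: "submodule H A (dsum {} X) \<and> {} \<subseteq> H"
  then have sH: "submodule H A (dsum {} X)" by blast
  have "H \<subseteq> carrier (dsum {} X)" using submoduleD(1)[OF sH] by blast
  moreover have "\<zero>\<^bsub>dsum {} X\<^esub> \<in> H" by (rule submoduleD(2)[OF sH])
  moreover have "carrier (dsum {} X) = {\<zero>\<^bsub>dsum {} X\<^esub>}"
    by (auto simp: dsum_simps restrict_def)
  ultimately show "H = carrier (dsum {} X)" by (metis empty_iff subset_singletonD)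
qed simp_all

lemma fg_iso: "\<lbrakk>iso_pair A M N f g; fg_module A M; left_module A N\<rbrakk> \<Longrightarrow> fg_module A N"
  using fg_retract iso_pair_retract iso_pair_sym by blast

text \<open>In inductions over a finite index set a surjection is enough, since finite generation
  and the descending chain condition both pass to images.\<close>

lemma dsum_insert_cover:
  assumes R: "ring A" and I: "finite I" "j \<notin> I"
    and X: "\<And>i. i \<in> insert j I \<Longrightarrow> left_module A (X i)"
  obtains f where "lin A (dsum2 (dsum I X) (X j)) (dsum (insert j I) X) f"
    "\<And>y. y \<in> carrier (dsum (insert j I) X) \<Longrightarrow> \<exists>x\<in>carrier (dsum2 (dsum I X) (X j)). f x = y"
proof -
  let ?D = "dsum2 (dsum I X) (X j)"
  let ?E = "dsum (insert j I) X"
  let ?f = "\<lambda>p. \<lambda>i\<in>insert j I. if i = j then snd p else fst p i"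
  have l: "lin A ?D ?E ?f"
  proof (rule lin_dsum)
    show "left_module A ?D" by (intro left_module_dsum2 left_module_dsum R) (use X in auto)
    fix i assume i: "i \<in> insert j I"
    show "lin A ?D (X i) (\<lambda>p. if i = j then snd p else fst p i)"
    proof (cases "i = j")
      case True
      then show ?thesis using lin_snd by simp
    next
      case False
      then have "i \<in> I" using i by simp
      then show ?thesis using lin_comp[OF lin_fst lin_dsum_proj] False by simp
    qed
  qed (use I in simp)
  show ?thesis
  proof (rule that[OF l])
    fix y assume y: "y \<in> carrier ?E"
    have p: "(\<lambda>i\<in>I. y i, y j) \<in> carrier ?D"
      unfolding dsum2_simps carrier_dsum_finite[OF I(1)]
      by (intro SigmaI restrict_PiE_iff[THEN iffD2] ballI dsum_component[OF y]) auto
    have "?f (\<lambda>i\<in>I. y i, y j) = y"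
      by (rule dsum_ext[OF linD(1)[OF l p] y]) auto
    then show "\<exists>x\<in>carrier ?D. ?f x = y" using p by blast
  qed
qed

lemma fg_dsum:
  assumes R: "ring A" and I: "finite I" and X: "\<And>i. i \<in> I \<Longrightarrow> fg_module A (X i)"
  shows "fg_module A (dsum I X)"
  using I X
proof (induction I rule: finite_induct)
  case empty
  then show ?case using fg_dsum_empty[OF R] by simp
next
  case (insert j I)
  have lX: "left_module A (X i)" if "i \<in> insert j I" for i
    by (rule fg_left[OF insert.prems[OF that]])
  obtain f where f: "lin A (dsum2 (dsum I X) (X j)) (dsum (insert j I) X) f"
    "\<And>y. y \<in> carrier (dsum (insert j I) X) \<Longrightarrow> \<exists>x\<in>carrier (dsum2 (dsum I X) (X j)). f x = y"
    by (rule dsum_insert_cover[OF R insert.hyps lX]) blast+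
  show ?case
    by (rule fg_surj[OF fg_dsum2 left_module_dsum[OF R lX] f]) (use insert in auto)
qed

text \<open>The splitting \<open>y = i (r y) + (y - i (r y))\<close> exhibits the kernel of the
  retraction as a complement of \<open>M\<close>.\<close>

lemma retract_complement_iso:
  assumes M: "left_module A M" and N: "left_module A N"
    and i: "lin A M N i" and r: "lin A N M r" and ri: "\<And>x. x \<in> carrier M \<Longrightarrow> r (i x) = x"
  obtains f g where "iso_pair A (dsum2 M (submod N {y \<in> carrier N. r y = \<zero>\<^bsub>M\<^esub>})) N f g"
proof -
  interpret M: left_module A M by fact
  interpret N: left_module A N by fact
  let ?K = "{y \<in> carrier N. r y = \<zero>\<^bsub>M\<^esub>}"
  let ?D = "dsum2 M (submod N ?K)"
  note i' = linD[OF i] and r' = linD[OF r]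
  have K: "submodule ?K A N" by (rule submodule_kernel[OF N M r])
  have f: "lin A ?D N (\<lambda>p. i (fst p) \<oplus>\<^bsub>N\<^esub> snd p)"
    by (rule lin_copair[OF N i lin_incl[OF K]])
  have d: "y \<ominus>\<^bsub>N\<^esub> i (r y) \<in> ?K" if "y \<in> carrier N" for y
    using that r' i' ri lin_uminus[OF N M r] by (simp add: a_minus_def M.M.r_neg)
  have g: "lin A N ?D (\<lambda>y. (r y, y \<ominus>\<^bsub>N\<^esub> i (r y)))"
    by (intro lin_pair r lin_submod_cod[OF lin_diff[OF N lin_id lin_comp[OF r i]] d])
  have "iso_pair A ?D N (\<lambda>p. i (fst p) \<oplus>\<^bsub>N\<^esub> snd p) (\<lambda>y. (r y, y \<ominus>\<^bsub>N\<^esub> i (r y)))"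
    unfolding iso_pair_def
  proof (intro conjI f g ballI)
    fix p assume p: "p \<in> carrier ?D"
    then obtain x k where xk: "p = (x, k)" "x \<in> carrier M" "k \<in> carrier N" "r k = \<zero>\<^bsub>M\<^esub>" by auto
    have "r (i x \<oplus>\<^bsub>N\<^esub> k) = x" using xk r'(2) i'(1) ri by simp
    moreover have "(i x \<oplus>\<^bsub>N\<^esub> k) \<ominus>\<^bsub>N\<^esub> i x = k"
      using xk i'(1) by (simp add: a_minus_def N.M.a_comm[of "i x" k] N.M.a_assoc N.M.r_neg)
    ultimately show "(r (i (fst p) \<oplus>\<^bsub>N\<^esub> snd p),
        (i (fst p) \<oplus>\<^bsub>N\<^esub> snd p) \<ominus>\<^bsub>N\<^esub> i (r (i (fst p) \<oplus>\<^bsub>N\<^esub> snd p))) = p"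
      using xk(1) by simp
  next
    fix y assume "y \<in> carrier N"
    then show "i (fst (r y, y \<ominus>\<^bsub>N\<^esub> i (r y))) \<oplus>\<^bsub>N\<^esub> snd (r y, y \<ominus>\<^bsub>N\<^esub> i (r y)) = y"
      using i'(1) r'(1) by (simp add: a_minus_def N.M.a_lcomm[of "i (r y)" y] N.M.r_neg)
  qed
  then show ?thesis by (rule that)
qed

section \<open>Decomposition into indecomposables\<close>

definition artinian_module :: "('a, 'm) ring_scheme \<Rightarrow> ('a, 'b) module \<Rightarrow> bool" where
  "artinian_module A M \<longleftrightarrow> (\<forall>H :: nat \<Rightarrow> 'b set.
     (\<forall>n. submodule (H n) A M \<and> H (Suc n) \<subseteq> H n) \<longrightarrow> (\<exists>N. \<forall>n\<ge>N. H n = H N))"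

text \<open>The summands live on the fixed carrier type, so that they can serve as witnesses for
  \<open>basic_module\<close> and be compared with the summands of \<open>Q_tilde\<close>. The case
  \<open>n = 0\<close> is the zero module.\<close>

definition decomposable :: "('a, 'm) ring_scheme \<Rightarrow> ('a, 'b) module \<Rightarrow> bool" where
  "decomposable A M \<longleftrightarrow> (\<exists>n (X :: nat \<Rightarrow> 'a umod).
     (\<forall>i<n. fg_module A (X i) \<and> indecomposable A (X i)) \<and>
     (\<exists>f g. iso_pair A M (dsum {..<n} X) f g))"

lemma iso_pair_dsum2:
  assumes "iso_pair A M M' f g" "iso_pair A N N' f' g'"
  shows "iso_pair A (dsum2 M N) (dsum2 M' N') (\<lambda>p. (f (fst p), f' (snd p))) (\<lambda>p. (g (fst p), g' (snd p)))"
  using assms unfolding iso_pair_def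
  by (auto intro!: lin_pair lin_comp[OF lin_fst] lin_comp[OF lin_snd])

lemma decomposable_iso: "\<lbrakk>iso_pair A M N f g; decomposable A N\<rbrakk> \<Longrightarrow> decomposable A M"
  unfolding decomposable_def using iso_pair_trans by blast

lemma decomposable_dsum2:
  assumes R: "ring A" and "decomposable A M" "decomposable A N"
  shows "decomposable A (dsum2 M N)"
proof -
  obtain n and X :: "nat \<Rightarrow> 'a umod" and f g where
    X: "\<And>i. i < n \<Longrightarrow> fg_module A (X i) \<and> indecomposable A (X i)" "iso_pair A M (dsum {..<n} X) f g"
    using assms(2) unfolding decomposable_def by blast
  obtain m and Y :: "nat \<Rightarrow> 'a umod" and f' g' where
    Y: "\<And>i. i < m \<Longrightarrow> fg_module A (Y i) \<and> indecomposable A (Y i)" "iso_pair A N (dsum {..<m} Y) f' g'"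
    using assms(3) unfolding decomposable_def by blast
  obtain u v where "iso_pair A (dsum2 (dsum {..<n} X) (dsum {..<m} Y))
       (dsum {..<n + m} (\<lambda>i. if i < n then X i else Y (i - n))) u v"
    using dsum_append_iso[OF R, of n X m Y] X(1) Y(1) fg_left by metis
  note iso = iso_pair_trans[OF iso_pair_dsum2[OF X(2) Y(2)] this]
  have "fg_module A (if i < n then X i else Y (i - n)) \<and>
      indecomposable A (if i < n then X i else Y (i - n))" if "i < n + m" for i
    using X(1)[of i] Y(1)[of "i - n"] that by (cases "i < n") auto
  then show ?thesis
    unfolding decomposable_def
    by (intro exI[of _ "n + m"] exI[of _ "\<lambda>i. if i < n then X i else Y (i - n)"] conjI exI) (use iso in auto)
qed

lemma set_add_iff: "z \<in> X <+>\<^bsub>M\<^esub> Y \<longleftrightarrow> (\<exists>x\<in>X. \<exists>y\<in>Y. z = x \<oplus>\<^bsub>M\<^esub> y)"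
  by (auto simp: set_add_def set_mult_def)

text \<open>An internal splitting of \<open>N\<close> pulls back along \<open>f\<close> to one of
  \<open>M\<close>, and a summand whose preimage is zero is itself zero.\<close>

lemma indecomposable_iso:
  assumes M: "indecomposable A M" and N: "left_module A N" and iso: "iso_pair A M N f g"
  shows "indecomposable A N"
proof -
  have lM: "left_module A M" using M by (simp add: indecomposable_def)
  interpret M: left_module A M by fact
  interpret N: left_module A N by fact
  note i = iso_pairD[OF iso]
  note f0 = lin_zero[OF lM N i(1)] and g0 = lin_zero[OF N lM i(2)]
  have *: "X = {\<zero>\<^bsub>N\<^esub>}" if X: "submodule X A N" and e: "{x \<in> carrier M. f x \<in> X} = {\<zero>\<^bsub>M\<^esub>}" for X
  proof -
    have "y = \<zero>\<^bsub>N\<^esub>" if "y \<in> X" for y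
    proof -
      have y: "y \<in> carrier N" using submoduleD(1)[OF X that] .
      then have "g y \<in> {x \<in> carrier M. f x \<in> X}" using i(4,6) that by simp
      then have "g y = \<zero>\<^bsub>M\<^esub>" unfolding e by simp
      then show ?thesis using i(4)[OF y] f0 by simp
    qed
    then show ?thesis using submoduleD(2)[OF X] by blast
  qed
  show ?thesis unfolding indecomposable_def
  proof (intro conjI N allI impI)
    show "\<not> zero_module N"
    proof
      assume z: "zero_module N"
      have "x = \<zero>\<^bsub>M\<^esub>" if "x \<in> carrier M" for x
        using i(3,5)[OF that] z g0 unfolding zero_module_def by (metis singletonD)
      then have "carrier M = {\<zero>\<^bsub>M\<^esub>}" using M.M.zero_closed by blast
      then show False using M by (simp add: indecomposable_def zero_module_def)
    qed
    fix X Y assume XY: "submodule X A N \<and> submodule Y A N \<and> X \<inter> Y = {\<zero>\<^bsub>N\<^esub>} \<and> X <+>\<^bsub>N\<^esub> Y = carrier N"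
    let ?X = "{x \<in> carrier M. f x \<in> X}" and ?Y = "{x \<in> carrier M. f x \<in> Y}"
    have sX: "submodule X A N" and sY: "submodule Y A N" using XY by auto
    have s: "submodule ?X A M" "submodule ?Y A M"
      by (intro submodule_vimage[OF lM N i(1)] sX sY)+
    have "x = \<zero>\<^bsub>M\<^esub>" if "x \<in> ?X \<inter> ?Y" for x
    proof -
      have "f x \<in> X \<inter> Y" "x \<in> carrier M" using that by auto
      then have "f x = \<zero>\<^bsub>N\<^esub>" using XY by simp
      then show ?thesis using i(3)[OF \<open>x \<in> carrier M\<close>] g0 by simp
    qed
    then have int: "?X \<inter> ?Y = {\<zero>\<^bsub>M\<^esub>}" using submoduleD(2)[OF s(1)] submoduleD(2)[OF s(2)] by blast
    have sum: "?X <+>\<^bsub>M\<^esub> ?Y = carrier M"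
    proof (intro equalityI subsetI)
      fix z assume "z \<in> ?X <+>\<^bsub>M\<^esub> ?Y"
      then show "z \<in> carrier M" unfolding set_add_iff by auto
    next
      fix z assume z: "z \<in> carrier M"
      then have "f z \<in> X <+>\<^bsub>N\<^esub> Y" using XY i(5) by simp
      then obtain x y where xy: "x \<in> X" "y \<in> Y" "f z = x \<oplus>\<^bsub>N\<^esub> y" unfolding set_add_iff by blast
      then have c: "x \<in> carrier N" "y \<in> carrier N" using submoduleD(1)[OF sX] submoduleD(1)[OF sY] by blast+
      have "z = g x \<oplus>\<^bsub>M\<^esub> g y" using i(3)[OF z] xy(3) linD(2)[OF i(2) c] by simp
      moreover have "g x \<in> ?X" "g y \<in> ?Y" using c xy(1,2) i(4,6) by auto
      ultimately show "z \<in> ?X <+>\<^bsub>M\<^esub> ?Y" unfolding set_add_iff by blast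
    qed
    have "?X = {\<zero>\<^bsub>M\<^esub>} \<or> ?Y = {\<zero>\<^bsub>M\<^esub>}"
      using M s int sum unfolding indecomposable_def by blast
    then show "X = {\<zero>\<^bsub>N\<^esub>} \<or> Y = {\<zero>\<^bsub>N\<^esub>}" using *[OF sX] *[OF sY] by blast
  qed
qed

text \<open>This turns the internal splitting that violates \<open>indecomposable\<close> into a
  binary direct sum, to which the results on \<open>decomposable\<close> apply.\<close>

lemma internal_sum_iso:
  assumes M: "left_module A M" and H: "submodule H A M" and X: "submodule X A M" and Y: "submodule Y A M"
    and int: "X \<inter> Y = {\<zero>\<^bsub>M\<^esub>}" and sum: "X <+>\<^bsub>M\<^esub> Y = H"
  obtains f g where "iso_pair A (dsum2 (submod M X) (submod M Y)) (submod M H) f g"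
proof -
  let ?D = "dsum2 (submod M X) (submod M Y)"
  interpret M: left_module A M by fact
  note lX = left_module_submod[OF M X] and lY = left_module_submod[OF M Y]
    and lH = left_module_submod[OF M H]
  have l: "lin A ?D (submod M H) (\<lambda>p. fst p \<oplus>\<^bsub>M\<^esub> snd p)"
  proof (rule lin_submod_cod[OF lin_copair[OF M lin_incl[OF X] lin_incl[OF Y]]])
    fix p assume "p \<in> carrier ?D"
    then show "fst p \<oplus>\<^bsub>M\<^esub> snd p \<in> H" unfolding sum[symmetric] set_add_iff by fastforce
  qed
  have inj: "inj_on (\<lambda>p. fst p \<oplus>\<^bsub>M\<^esub> snd p) (carrier ?D)"
  proof (rule lin_inj[OF left_module_dsum2[OF lX lY] lH l])
    fix p assume p: "p \<in> carrier ?D" "fst p \<oplus>\<^bsub>M\<^esub> snd p = \<zero>\<^bsub>submod M H\<^esub>"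
    obtain x y where xy: "p = (x, y)" "x \<in> X" "y \<in> Y" using p(1) by auto
    have c: "x \<in> carrier M" "y \<in> carrier M" using xy submoduleD(1)[OF X] submoduleD(1)[OF Y] by auto
    have "\<ominus>\<^bsub>M\<^esub> y = x" using p(2) xy(1) c by (intro M.M.minus_equality) auto
    then have "x \<in> X \<inter> Y" using submoduleD(5)[OF Y xy(3)] xy(2) by auto
    then have x0: "x = \<zero>\<^bsub>M\<^esub>" using int by simp
    then have "y = \<zero>\<^bsub>M\<^esub>" using p(2) xy(1) c by simp
    then show "p = \<zero>\<^bsub>?D\<^esub>" using x0 xy(1) by simp
  qed
  have surj: "\<exists>p\<in>carrier ?D. fst p \<oplus>\<^bsub>M\<^esub> snd p = z"
    if "z \<in> carrier (submod M H)" for z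
    using that unfolding submod_simps sum[symmetric] set_add_iff by force
  show ?thesis
    using lin_bij_iso_pair[OF left_module_dsum2[OF lX lY] lH l inj surj] that by blast
qed

text \<open>A submodule that splits nontrivially is the sum of two strictly smaller ones, so
  well-founded induction on submodules of \<open>M\<close> applies. Finite generation is carried in
  the induction: it need not pass to submodules, but it passes to summands.\<close>

lemma decomposable_artinian:
  fixes A :: "('a, 'm) ring_scheme" and M :: "('a, 'b) module"
  assumes M: "fg_module A M" and art: "artinian_module A M"
  shows "decomposable A M"
proof -
  interpret M: left_module A M by (rule fg_left[OF M])
  note lM = M.left_module_axioms
  note R = M.R.ring_axioms
  define r where "r = {(K, H). submodule K A M \<and> submodule H A M \<and> K \<subset> H}"
  \<comment> \<open>An infinite descending path would be a strictly decreasing chain of submodules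
    of \<open>M\<close>.\<close>
  have "wf r"
    unfolding wf_iff_no_infinite_down_chain
  proof
    assume "\<exists>H. \<forall>i. (H (Suc i), H i) \<in> r"
    then obtain H where H: "\<And>i. submodule (H i) A M" "\<And>i. H (Suc i) \<subset> H i" unfolding r_def by blast
    then obtain N where "\<forall>n\<ge>N. H n = H N" using art unfolding artinian_module_def by blast
    then show False using H(2)[of N] by (metis le_Suc_eq order_refl psubset_eq)
  qed
  then have "submodule H A M \<longrightarrow> fg_module A (submod M H) \<longrightarrow> decomposable A (submod M H)" for H
  proof (induction H)
    case (less H)
    show ?case
    proof (intro impI)
      assume H: "submodule H A M" and fgH: "fg_module A (submod M H)"
      note lH = left_module_submod[OF lM H]
      consider "zero_module (submod M H)" | "indecomposable A (submod M H)"
        | "\<not> zero_module (submod M H)" "\<not> indecomposable A (submod M H)" by blast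
      then show "decomposable A (submod M H)"
      proof cases
        case 1
        then have H0: "H = {\<zero>\<^bsub>M\<^esub>}" by (simp add: zero_module_def)
        \<comment> \<open>The zero module is the empty sum; over the empty index set any family will
          do, hence \<open>undefined\<close>.\<close>
        let ?D = "dsum ({} :: nat set) (\<lambda>_. undefined :: 'a umod)"
        have lD: "left_module A ?D" by (rule left_module_dsum[OF R]) simp
        have c: "carrier ?D = {\<zero>\<^bsub>?D\<^esub>}" by (auto simp: dsum_simps restrict_def)
        have "iso_pair A (submod M H) ?D (\<lambda>_. \<zero>\<^bsub>?D\<^esub>) (\<lambda>_. \<zero>\<^bsub>submod M H\<^esub>)"
          unfolding iso_pair_def
          by (intro conjI lin_const_zero[OF lD] lin_const_zero[OF lH]) (simp_all add: c H0)
        then show ?thesis unfolding decomposable_def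
          by (intro exI[of _ 0] exI[of _ "\<lambda>_. undefined"]) auto
      next
        case 2
        obtain X :: "'a umod" and f g where X: "fg_module A X" "iso_pair A (submod M H) X f g"
          using fg_umod[OF fgH] by metis
        have iX: "indecomposable A X" by (rule indecomposable_iso[OF 2 fg_left[OF X(1)] X(2)])
        obtain u v where "iso_pair A X (dsum {0::nat} (\<lambda>_. X)) u v"
          using dsum_singleton_iso[of A "\<lambda>_. X" 0] fg_left[OF X(1)] by blast
        then have "iso_pair A (submod M H) (dsum {..<1::nat} (\<lambda>_. X)) (\<lambda>x. u (f x)) (\<lambda>x. g (v x))"
          using iso_pair_trans[OF X(2)] by (simp add: lessThan_Suc)
        then show ?thesis unfolding decomposable_def
          using X(1) iX by (intro exI[of _ 1] exI[of _ "\<lambda>_. X"]) blast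
      next
        case 3
        then obtain X Y where XY: "submodule X A (submod M H)" "submodule Y A (submod M H)"
          "X \<inter> Y = {\<zero>\<^bsub>submod M H\<^esub>}" "X <+>\<^bsub>submod M H\<^esub> Y = carrier (submod M H)"
          "X \<noteq> {\<zero>\<^bsub>submod M H\<^esub>}" "Y \<noteq> {\<zero>\<^bsub>submod M H\<^esub>}"
          unfolding indecomposable_def using lH by blast
        have sX: "submodule X A M" and sY: "submodule Y A M"
          using submodule_submodD[OF lM H] XY(1,2) by blast+
        have sub: "X \<subseteq> H" "Y \<subseteq> H" using submoduleD(1)[OF XY(1)] submoduleD(1)[OF XY(2)] by auto
        have int: "X \<inter> Y = {\<zero>\<^bsub>M\<^esub>}" using XY(3) by simp
        have sum: "X <+>\<^bsub>M\<^esub> Y = H" using XY(4) by (auto simp: set_add_iff set_eq_iff)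
        have "X \<noteq> H" "Y \<noteq> H" using sub int XY(5,6) by auto
        then have "(X, H) \<in> r" "(Y, H) \<in> r" using sub sX sY H unfolding r_def by auto
        obtain f g where iso: "iso_pair A (dsum2 (submod M X) (submod M Y)) (submod M H) f g"
          using internal_sum_iso[OF lM H sX sY int sum] by blast
        note l2 = left_module_dsum2[OF left_module_submod[OF lM sX] left_module_submod[OF lM sY]]
        have fg2: "fg_module A (dsum2 (submod M X) (submod M Y))"
          by (rule fg_iso[OF iso_pair_sym[OF iso] fgH l2])
        \<comment> \<open>Each summand is the image of the whole sum under a projection.\<close>
        have "fg_module A (submod M X)"
          by (rule fg_surj[OF fg2 left_module_submod[OF lM sX] lin_fst])
            (use submoduleD(2)[OF sY] in \<open>auto intro: bexI[of _ "\<zero>\<^bsub>M\<^esub>"]\<close>)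
        moreover have "fg_module A (submod M Y)"
          by (rule fg_surj[OF fg2 left_module_submod[OF lM sY] lin_snd])
            (use submoduleD(2)[OF sX] in \<open>auto intro: bexI[of _ "\<zero>\<^bsub>M\<^esub>"]\<close>)
        ultimately have "decomposable A (submod M X)" "decomposable A (submod M Y)"
          using less.IH \<open>(X, H) \<in> r\<close> \<open>(Y, H) \<in> r\<close> sX sY by blast+
        then show ?thesis
          using decomposable_iso[OF iso_pair_sym[OF iso] decomposable_dsum2[OF R]] by blast
      qed
    qed
  qed
  moreover have "submod M (carrier M) = M" by (simp add: submod_def)
  ultimately show ?thesis using M.submodule_carrier M by metis
qed

text \<open>One summand is kept from each isomorphism class, which makes \<open>T\<close> basic and
  a retract of \<open>M\<close>. Conversely each of the \<open>n\<close> summands of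
  \<open>M\<close> is a retract of \<open>T\<close>, so \<open>M\<close> is a retract of the
  \<open>n\<close>-th power. Multiplicities and uniqueness of decompositions never enter.\<close>

lemma basic_reduction:
  fixes A :: "('a, 'm) ring_scheme" and M :: "('a, 'b) module"
  assumes M: "fg_module A M" and dec: "decomposable A M"
  obtains T :: "'a umod" and n where "fg_module A T" "basic_module A T" "retract A T M"
    "retract A M (dpower T n)"
proof -
  interpret M: left_module A M by (rule fg_left[OF M])
  note R = M.R.ring_axioms
  obtain n and X :: "nat \<Rightarrow> 'a umod" and f g where
    X: "\<And>i. i < n \<Longrightarrow> fg_module A (X i)" "\<And>i. i < n \<Longrightarrow> indecomposable A (X i)"
    and iso: "iso_pair A M (dsum {..<n} X) f g"
    using dec unfolding decomposable_def by blast
  note lX = fg_left[OF X(1)]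
  \<comment> \<open>\<open>J\<close> keeps the first index of each isomorphism class;
    \<open>e\<close> renumbers it as an initial segment, the form that \<open>basic_module\<close>
    asks for.\<close>
  define J where "J = {i. i < n \<and> (\<forall>j<i. \<not> mod_iso A (X i) (X j))}"
  have J: "finite J" "\<And>i. i \<in> J \<Longrightarrow> i < n" by (auto simp: J_def)
  obtain e where e: "bij_betw e {..<card J} J"
    using ex_bij_betw_nat_finite[OF J(1)] by (auto simp: atLeast0LessThan)
  have eJ: "e j \<in> J" "e j < n" if "j < card J" for j
    using bij_betwE[OF e] J(2) that by blast+
  have sym: "mod_iso A (X i) (X j) \<Longrightarrow> mod_iso A (X j) (X i)" if "i < n" "j < n" for i j
    using iso_pair_sym by (fastforce simp: mod_iso_iff lX that)
  have refl: "mod_iso A (X i) (X i)" if "i < n" for i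
    using retract_refl lin_id[of A "X i"] mod_iso_iff[OF lX[OF that] lX[OF that]]
    by (auto simp: iso_pair_def intro!: exI[of _ "\<lambda>x. x"])
  have rep: "\<exists>j<card J. mod_iso A (X i) (X (e j))" if "i < n" for i
  proof -
    \<comment> \<open>The least index whose summand is isomorphic to \<open>X i\<close> has no
      isomorphic predecessor, so it belongs to \<open>J\<close>.\<close>
    define k where "k = (LEAST k. mod_iso A (X i) (X k) \<and> k < n)"
    have k: "mod_iso A (X i) (X k)" "k < n"
      using LeastI[of "\<lambda>k. mod_iso A (X i) (X k) \<and> k < n" i] refl that unfolding k_def by blast+
    have "\<not> mod_iso A (X k) (X l)" if "l < k" for l
    proof
      assume "mod_iso A (X k) (X l)"
      have l: "l < n" using that k(2) by simp
      obtain u v where "iso_pair A (X i) (X k) u v" using k mod_iso_iff[OF lX lX] \<open>i < n\<close> by blast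
      moreover obtain u' v' where "iso_pair A (X k) (X l) u' v'"
        using \<open>mod_iso A (X k) (X l)\<close> mod_iso_iff[OF lX lX] k(2) l by blast
      ultimately have "mod_iso A (X i) (X l)"
        using iso_pair_trans mod_iso_iff[OF lX lX] \<open>i < n\<close> l by blast
      then show False using not_less_Least[OF that[unfolded k_def]] l by blast
    qed
    then have "k \<in> J" using k(2) by (simp add: J_def)
    then have "k \<in> e ` {..<card J}" using e by (simp add: bij_betw_def)
    then obtain j where "j < card J" "e j = k" by blast
    then show ?thesis using k(1) by blast
  qed
  let ?D = "dsum {..<card J} (\<lambda>j. X (e j))"
  have fgD: "fg_module A ?D" by (rule fg_dsum[OF R]) (use X(1) eJ in auto)
  obtain T :: "'a umod" and u v where T: "fg_module A T" "iso_pair A ?D T u v"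
    using fg_umod[OF fgD] by metis
  note lT = fg_left[OF T(1)] and lD = fg_left[OF fgD]
  have noniso: "\<not> mod_iso A (X (e i)) (X (e j))" if "i < card J" "j < card J" "i \<noteq> j" for i j
  proof -
    have "e i \<noteq> e j" using e that by (auto simp: bij_betw_def inj_on_eq_iff)
    then consider "e i < e j" | "e j < e i" by linarith
    then show ?thesis
    proof cases
      case 1
      then have "\<not> mod_iso A (X (e j)) (X (e i))" using eJ(1)[OF that(2)] by (simp add: J_def)
      then show ?thesis using sym eJ(2) that by blast
    next
      case 2
      then show ?thesis using eJ(1)[OF that(1)] by (simp add: J_def)
    qed
  qed
  have "mod_iso A T ?D" using mod_iso_iff[OF lT lD] iso_pair_sym[OF T(2)] by blast
  then have basic: "basic_module A T"
    unfolding basic_module_def using X eJ(2) noniso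
    by (intro exI[of _ "card J"] exI[of _ "\<lambda>j. X (e j)"]) (auto simp: fg_mods_def)
  have TM: "retract A T M"
  proof (rule retract_trans[OF iso_pair_retract[OF iso_pair_sym[OF T(2)]]])
    have "retract A ?D (dsum {..<n} X)"
      by (rule retract_dsum_reindex) (use e J(2) lX R in \<open>auto simp: bij_betw_def\<close>)
    then show "retract A ?D M" by (rule retract_trans[OF _ iso_pair_retract[OF iso_pair_sym[OF iso]]])
  qed
  have "retract A (X i) T" if i: "i < n" for i
  proof -
    obtain j where j: "j < card J" "mod_iso A (X i) (X (e j))" using rep[OF i] by blast
    have r1: "retract A (X i) (X (e j))"
      using j(2) mod_iso_iff[OF lX[OF i] lX[OF eJ(2)[OF j(1)]]] iso_pair_retract by blast
    have r2: "retract A (X (e j)) ?D"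
      using retract_dsum_component[of "{..<card J}" A "\<lambda>j. X (e j)" j] lX eJ j(1) by simp
    show ?thesis by (rule retract_trans[OF retract_trans[OF r1 r2] iso_pair_retract[OF T(2)]])
  qed
  then have "retract A (dsum {..<n} X) (dpower T n)"
    unfolding dpower_def by (intro retract_dsum R) (use lX lT in auto)
  then have "retract A M (dpower T n)" by (rule retract_trans[OF iso_pair_retract[OF iso]])
  then show ?thesis using that T(1) basic TM by blast
qed

section \<open>The classes add, Gen and Cogen\<close>

lemma fg_dpower: "fg_module A T \<Longrightarrow> fg_module A (dpower T n)"
  unfolding dpower_def by (rule fg_dsum) (auto dest: fg_left simp: left_module_def)

text \<open>The complement demanded by \<open>add_cl\<close> is the kernel of the retraction, moved
  to the fixed carrier type.\<close>

lemma add_cl_retract: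
  fixes A :: "('a, 'm) ring_scheme"
  assumes M: "fg_module A M" and T: "fg_module A T" and r: "retract A M (dpower T n)"
  shows "M \<in> add_cl A T"
proof -
  note lM = fg_left[OF M] and fgP = fg_dpower[OF T, of n]
  obtain i p where ip: "lin A M (dpower T n) i" "lin A (dpower T n) M p"
    "\<And>x. x \<in> carrier M \<Longrightarrow> p (i x) = x"
    using r unfolding retract_def by blast
  let ?K = "submod (dpower T n) {y \<in> carrier (dpower T n). p y = \<zero>\<^bsub>M\<^esub>}"
  have lK: "left_module A ?K"
    by (rule left_module_submod[OF fg_left[OF fgP] submodule_kernel[OF fg_left[OF fgP] lM ip(2)]])
  obtain f g where iso: "iso_pair A (dsum2 M ?K) (dpower T n) f g"
    using retract_complement_iso[where i = i and r = p, OF lM fg_left[OF fgP] ip] by blast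
  have fg2: "fg_module A (dsum2 M ?K)"
    by (rule fg_iso[OF iso_pair_sym[OF iso] fgP left_module_dsum2[OF lM lK]])
  interpret M: left_module A M by fact
  have "fg_module A ?K"
  proof (rule fg_surj[OF fg2 lK lin_snd])
    fix y assume "y \<in> carrier ?K"
    then show "\<exists>x\<in>carrier (dsum2 M ?K). snd x = y" by (intro bexI[of _ "(\<zero>\<^bsub>M\<^esub>, y)"]) auto
  qed
  then obtain N :: "'a umod" and u v where N: "fg_module A N" "iso_pair A ?K N u v" by (rule fg_umod)
  have "iso_pair A M M (\<lambda>x. x) (\<lambda>x. x)" by (simp add: iso_pair_def lin_id)
  note iso_pair_trans[OF iso_pair_sym[OF iso_pair_dsum2[OF this N(2)]] iso]
  then have "mod_iso A (dsum2 M N) (dpower T n)"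
    using mod_iso_iff[OF left_module_dsum2[OF lM fg_left[OF N(1)]] fg_left[OF fgP]] by blast
  then show ?thesis unfolding add_cl_def fg_mods_def using M N(1) by blast
qed

text \<open>The choice made in \<open>iso_reps\<close> always has a candidate, since every member is
  isomorphic to itself.\<close>

lemma iso_reps_spec:
  assumes "X \<in> \<X>" and "\<And>X. X \<in> \<X> \<Longrightarrow> left_module A X"
  shows "(SOME Y. Y \<in> \<X> \<and> mod_iso A X Y) \<in> \<X> \<and> mod_iso A X (SOME Y. Y \<in> \<X> \<and> mod_iso A X Y)"
proof (rule someI_ex)
  have "iso_pair A X X (\<lambda>x. x) (\<lambda>x. x)" by (simp add: iso_pair_def lin_id)
  then show "\<exists>Y. Y \<in> \<X> \<and> mod_iso A X Y" using assms mod_iso_iff by blast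
qed

lemma iso_reps_subset:
  assumes "\<And>X. X \<in> \<X> \<Longrightarrow> left_module A X"
  shows "iso_reps A \<X> \<subseteq> \<X>"
proof
  fix Y assume "Y \<in> iso_reps A \<X>"
  then obtain X where "X \<in> \<X>" "Y = (SOME Y. Y \<in> \<X> \<and> mod_iso A X Y)" unfolding iso_reps_def by blast
  then show "Y \<in> \<X>" using iso_reps_spec[of X \<X> A] assms by simp
qed

lemma left_module_Q_tilde:
  assumes "ring A"
  shows "left_module A (Q_tilde A)"
  unfolding Q_tilde_def
proof (rule left_module_dsum[OF assms])
  let ?X = "{X \<in> proj_inj_mods A. indecomposable A X}"
  have l: "left_module A X" if "X \<in> ?X" for X using that by (simp add: indecomposable_def)
  fix Y assume "Y \<in> iso_reps A ?X"
  then show "left_module A Y" using iso_reps_subset[of ?X A] l by blast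
qed

text \<open>An indecomposable summand of \<open>P\<close> is a retract of \<open>P\<close>, hence
  projective-injective, hence isomorphic to one of the representatives summed in
  \<open>Q_tilde\<close>. One copy of \<open>Q_tilde\<close> is spent on each summand.\<close>

lemma retract_Q_tilde:
  fixes A :: "('a, 'm) ring_scheme" and P :: "('a, 'b) module"
  assumes P: "projective_module A P" "injective_module A P" and dec: "decomposable A P"
  obtains m where "retract A P (dpower (Q_tilde A) m)"
proof -
  interpret P: left_module A P by (rule fg_left[OF projective_fg[OF P(1)]])
  note R = P.R.ring_axioms
  let ?X = "{X \<in> proj_inj_mods A. indecomposable A X}"
  have l: "left_module A X" if "X \<in> ?X" for X using that by (simp add: indecomposable_def)
  obtain n and X :: "nat \<Rightarrow> 'a umod" and f g where
    X: "\<And>i. i < n \<Longrightarrow> fg_module A (X i)" "\<And>i. i < n \<Longrightarrow> indecomposable A (X i)"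
    and iso: "iso_pair A P (dsum {..<n} X) f g"
    using dec unfolding decomposable_def by blast
  note lX = fg_left[OF X(1)]
  have "retract A (X i) (Q_tilde A)" if i: "i < n" for i
  proof -
    have r: "retract A (X i) P"
      using retract_dsum_component[of "{..<n}" A X i] lX i
      by (intro retract_trans[OF _ iso_pair_retract[OF iso_pair_sym[OF iso]]]) simp
    have Xi: "X i \<in> ?X"
      using projective_retract[OF P(1) lX[OF i] r] injective_retract[OF P(2) lX[OF i] r] X(2)[OF i]
      by (simp add: proj_inj_mods_def)
    \<comment> \<open>\<open>Y\<close> is literally the representative that \<open>iso_reps\<close>
      selects for \<open>X i\<close>, so its membership holds by definition.\<close>
    define Y where "Y = (SOME Y. Y \<in> ?X \<and> mod_iso A (X i) Y)"
    have Y: "Y \<in> ?X" "mod_iso A (X i) Y" using iso_reps_spec[OF Xi l] unfolding Y_def by auto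
    have "Y \<in> iso_reps A ?X" unfolding iso_reps_def Y_def using Xi by blast
    then have r2: "retract A Y (Q_tilde A)"
      unfolding Q_tilde_def using iso_reps_subset[of ?X A] l
      by (intro retract_dsum_component[of "iso_reps A ?X" A "\<lambda>X. X"]) blast+
    have "retract A (X i) Y" using mod_iso_iff[OF l[OF Xi] l[OF Y(1)]] Y(2) iso_pair_retract by blast
    then show ?thesis by (rule retract_trans[OF _ r2])
  qed
  then have "retract A (dsum {..<n} X) (dpower (Q_tilde A) n)"
    unfolding dpower_def by (intro retract_dsum R) (use lX left_module_Q_tilde[OF R] in auto)
  then show ?thesis by (rule that[OF retract_trans[OF iso_pair_retract[OF iso]]])
qed

text \<open>The retraction from the power of \<open>Q\<close> to \<open>P\<close> is onto and can be
  followed by the surjection from \<open>P\<close> to \<open>T\<close>.\<close>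

lemma Gen_retract:
  assumes T: "fg_module A T" and P: "left_module A P" and Q: "left_module A Q" and r: "retract A P (dpower Q m)"
    and f: "lin A P T f" "\<And>y. y \<in> carrier T \<Longrightarrow> \<exists>x\<in>carrier P. f x = y"
  shows "T \<in> Gen A Q"
proof -
  interpret Q: left_module A Q by fact
  have lQ: "left_module A (dpower Q m)"
    unfolding dpower_def by (rule left_module_dsum[OF Q.R.ring_axioms Q])
  obtain i p where ip: "lin A P (dpower Q m) i" "lin A (dpower Q m) P p"
    "\<And>x. x \<in> carrier P \<Longrightarrow> p (i x) = x"
    using r unfolding retract_def by blast
  note l = lin_comp[OF ip(2) f(1)]
  have "epi_hom A (dpower Q m) T (restrict (\<lambda>x. f (p x)) (carrier (dpower Q m)))"
    unfolding epi_hom_def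
  proof (intro conjI lin_mod_hom[OF lQ l] equalityI subsetI)
    fix y assume "y \<in> carrier T"
    then obtain x where "x \<in> carrier P" "f x = y" using f(2) by blast
    then show "y \<in> restrict (\<lambda>x. f (p x)) (carrier (dpower Q m)) ` carrier (dpower Q m)"
      using ip(3) linD(1)[OF ip(1)] by (intro image_eqI[of _ _ "i x"]) auto
  qed (use linD(1)[OF l] in auto)
  then show ?thesis using T unfolding Gen_def fg_mods_def by blast
qed

text \<open>A split inclusion is injective, so the embedding of \<open>T\<close> into
  \<open>P\<close> can be continued into the power of \<open>Q\<close>.\<close>

lemma Cogen_retract:
  assumes T: "fg_module A T" and r: "retract A P (dpower Q m)"
    and f: "lin A T P f" "inj_on f (carrier T)"
  shows "T \<in> Cogen A Q"
proof -
  obtain i p where ip: "lin A P (dpower Q m) i" "lin A (dpower Q m) P p"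
    "\<And>x. x \<in> carrier P \<Longrightarrow> p (i x) = x"
    using r unfolding retract_def by blast
  have "inj_on i (carrier P)" by (rule inj_on_inverseI[of _ p]) (rule ip(3))
  then have "inj_on (\<lambda>x. i (f x)) (carrier T)"
    using f(2) linD(1)[OF f(1)] by (auto simp: inj_on_def)
  then have "mono_hom A T (dpower Q m) (restrict (\<lambda>x. i (f x)) (carrier T))"
    unfolding mono_hom_def using lin_mod_hom[OF fg_left[OF T] lin_comp[OF f(1) ip(1)]] by simp
  then show ?thesis using T unfolding Cogen_def fg_mods_def by blast
qed

section \<open>Tilting modules from projective-injective presentations\<close>

text \<open>\<open>K\<close> plays the quotient of \<open>X\<close> by the kernel of
  \<open>d\<close>, given through a surjection so that no coset module is formed. Values are read
  off chosen preimages, and the kernel condition makes them independent of the choice.\<close>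

lemma lin_factor:
  assumes X: "left_module A X" and Y: "left_module A Y" and K: "left_module A K"
    and f: "lin A X Y f" and d: "lin A X K d" and surj: "\<And>k. k \<in> carrier K \<Longrightarrow> \<exists>x\<in>carrier X. d x = k"
    and ker: "\<And>x. \<lbrakk>x \<in> carrier X; d x = \<zero>\<^bsub>K\<^esub>\<rbrakk> \<Longrightarrow> f x = \<zero>\<^bsub>Y\<^esub>"
  obtains g where "lin A K Y g" "\<And>x. x \<in> carrier X \<Longrightarrow> g (d x) = f x"
proof -
  interpret X: left_module A X by fact
  interpret Y: left_module A Y by fact
  interpret K: left_module A K by fact
  note f' = linD[OF f] and d' = linD[OF d]
  have eq: "f x = f y" if "x \<in> carrier X" "y \<in> carrier X" "d x = d y" for x y
  proof -
    have "d (x \<oplus>\<^bsub>X\<^esub> \<ominus>\<^bsub>X\<^esub> y) = \<zero>\<^bsub>K\<^esub>"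
      using that d' lin_uminus[OF X K d] by (simp add: K.M.r_neg)
    then have "f x \<oplus>\<^bsub>Y\<^esub> \<ominus>\<^bsub>Y\<^esub> f y = \<zero>\<^bsub>Y\<^esub>"
      using ker[of "x \<oplus>\<^bsub>X\<^esub> \<ominus>\<^bsub>X\<^esub> y"] that f' lin_uminus[OF X Y f] by simp
    then show ?thesis using that f'(1) by (metis Y.M.minus_equality Y.M.minus_minus Y.M.a_inv_closed)
  qed
  define c where "c k = (SOME x. x \<in> carrier X \<and> d x = k)" for k
  have c: "c k \<in> carrier X" "d (c k) = k" if "k \<in> carrier K" for k
    using someI_ex[of "\<lambda>x. x \<in> carrier X \<and> d x = k"] surj[OF that] unfolding c_def by blast+
  show ?thesis
  proof (rule that[of "\<lambda>k. f (c k)"])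
    show "lin A K Y (\<lambda>k. f (c k))"
    proof (rule linI)
      fix x y assume xy: "x \<in> carrier K" "y \<in> carrier K"
      have "f (c (x \<oplus>\<^bsub>K\<^esub> y)) = f (c x \<oplus>\<^bsub>X\<^esub> c y)" by (rule eq) (use xy c d'(2) in simp_all)
      then show "f (c (x \<oplus>\<^bsub>K\<^esub> y)) = f (c x) \<oplus>\<^bsub>Y\<^esub> f (c y)" using c xy f'(2) by simp
    next
      fix a x assume ax: "a \<in> carrier A" "x \<in> carrier K"
      have "f (c (a \<odot>\<^bsub>K\<^esub> x)) = f (a \<odot>\<^bsub>X\<^esub> c x)" by (rule eq) (use ax c d'(3) in simp_all)
      then show "f (c (a \<odot>\<^bsub>K\<^esub> x)) = a \<odot>\<^bsub>Y\<^esub> f (c x)" using c ax f'(3) by simp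
    qed (use c f'(1) in simp)
    fix x assume "x \<in> carrier X"
    then show "f (c (d x)) = f x" by (intro eq) (use c d'(1) in simp_all)
  qed
qed

lemma proj_resolutionD:
  assumes "proj_resolution A T P d \<epsilon>"
  shows "projective_module A (P i)" "lin A (P (Suc i)) (P i) (d i)"
    "lin A (P 0) T \<epsilon>" "\<epsilon> ` carrier (P 0) = carrier T"
    "d 0 ` carrier (P 1) = mod_ker (P 0) T \<epsilon>"
    "d (Suc i) ` carrier (P (Suc (Suc i))) = mod_ker (P (Suc i)) (P i) (d i)"
proof -
  note res = assms[unfolded proj_resolution_def epi_hom_def]
  show "projective_module A (P i)" by (rule res[THEN conjunct1, rule_format, THEN conjunct1])
  show "lin A (P (Suc i)) (P i) (d i)"
    by (rule mod_hom_lin[OF res[THEN conjunct1, rule_format, THEN conjunct2]])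
  show "lin A (P 0) T \<epsilon>"
    by (rule mod_hom_lin[OF res[THEN conjunct2, THEN conjunct1, THEN conjunct1]])
  show "\<epsilon> ` carrier (P 0) = carrier T" by (rule res[THEN conjunct2, THEN conjunct1, THEN conjunct2])
  show "d 0 ` carrier (P 1) = mod_ker (P 0) T \<epsilon>"
    by (rule res[THEN conjunct2, THEN conjunct2, THEN conjunct1])
  show "d (Suc i) ` carrier (P (Suc (Suc i))) = mod_ker (P (Suc i)) (P i) (d i)"
    by (rule res[THEN conjunct2, THEN conjunct2, THEN conjunct2, rule_format])
qed

text \<open>\<open>Ext\<close> is computed from a resolution picked by \<open>SOME\<close>, about
  which only the resolution property is known. Hence existence is assumed and vanishing is required
  for every resolution. Once cocycles equal coboundaries, the group is the quotient of an abelian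
  group by itself.\<close>

lemma trivial_Ext1:
  fixes A :: "('a, 'm) ring_scheme" and T :: "('a, 'b) module" and N :: "('a, 'c) module"
  assumes ex: "\<exists>P d \<epsilon>. proj_resolution A T P d \<epsilon>" and N: "left_module A N"
    and van: "\<And>P d \<epsilon>. proj_resolution A T P d \<epsilon> \<Longrightarrow> cocycles A P d N 1 \<subseteq> coboundaries A P d N 1"
  shows "trivial_group (Ext A 1 T N)"
proof -
  interpret N: left_module A N by fact
  define Pd where "Pd = (SOME (P, d). \<exists>\<epsilon>. proj_resolution A T P d \<epsilon>)"
  obtain P d where Pd': "Pd = (P, d)" by force
  have "\<exists>Pd. (case Pd of (P, d) \<Rightarrow> \<exists>\<epsilon>. proj_resolution A T P d \<epsilon>)" using ex by auto
  then have "case Pd of (P, d) \<Rightarrow> \<exists>\<epsilon>. proj_resolution A T P d \<epsilon>" unfolding Pd_def by (rule someI_ex)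
  then obtain \<epsilon> where res: "proj_resolution A T P d \<epsilon>" unfolding Pd' by auto
  note lP = fg_left[OF projective_fg[OF proj_resolutionD(1)[OF res]]]
    and d = proj_resolutionD(2)[OF res]
  have dd: "d 0 (d 1 x) = \<zero>\<^bsub>P 0\<^esub>" if "x \<in> carrier (P 2)" for x
  proof -
    have "d 1 x \<in> mod_ker (P 1) (P 0) (d 0)"
      using that unfolding One_nat_def proj_resolutionD(6)[OF res, symmetric] numeral_2_eq_2 by blast
    then show ?thesis by (simp add: mod_ker_def)
  qed
  define Z where "Z = cocycles A P d N 1"
  let ?G = "(hom_group A (P 1) N)\<lparr>carrier := Z\<rparr>"
  interpret P1: left_module A "P 1" by (rule lP)
  interpret P2: left_module A "P 2" by (rule lP)
  have l12: "lin A (P 2) (P 1) (d 1)" using d[of 1] by (simp add: numeral_2_eq_2)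
  have Z_iff: "f \<in> Z \<longleftrightarrow> f \<in> extensional (carrier (P 1)) \<and> lin A (P 1) N f \<and>
      (\<forall>x\<in>carrier (P 2). f (d 1 x) = \<zero>\<^bsub>N\<^esub>)" for f
  proof -
    have "f \<in> mod_hom A (P 1) N \<longleftrightarrow> f \<in> extensional (carrier (P 1)) \<and> lin A (P 1) N f"
      by (auto simp: mod_hom_def lin_def PiE_iff)
    then show ?thesis
      unfolding Z_def cocycles_def by (auto simp: compose_def zero_hom_def fun_eq_iff numeral_2_eq_2)
  qed
  have Z1: "restrict f (carrier (P 1)) \<in> Z"
    if "lin A (P 1) N f" "\<And>x. x \<in> carrier (P 2) \<Longrightarrow> f (d 1 x) = \<zero>\<^bsub>N\<^esub>" for f
    unfolding Z_iff using that lin_cong[OF lP that(1)] linD(1)[OF l12] by simp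
  \<comment> \<open>The factor group is formed inside this group; commutativity supplies normality
    of the subgroup that is divided out.\<close>
  have "comm_group ?G"
  proof (rule comm_groupI)
    fix f g assume fg: "f \<in> carrier ?G" "g \<in> carrier ?G"
    then have z: "f \<in> Z" "g \<in> Z" by simp_all
    have "(\<lambda>x\<in>carrier (P 1). f x \<oplus>\<^bsub>N\<^esub> g x) \<in> Z"
      by (rule Z1[OF lin_add[OF N]]) (use z in \<open>auto simp: Z_iff\<close>)
    then show "f \<otimes>\<^bsub>?G\<^esub> g \<in> carrier ?G" by (simp add: hom_group_def)
    show "f \<otimes>\<^bsub>?G\<^esub> g = g \<otimes>\<^bsub>?G\<^esub> f"
      using z linD(1)[of A "P 1" N f] linD(1)[of A "P 1" N g]
      by (auto simp: hom_group_def Z_iff N.M.a_comm intro!: restrict_ext)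
  next
    fix f g h assume "f \<in> carrier ?G" "g \<in> carrier ?G" "h \<in> carrier ?G"
    then have "lin A (P 1) N f" "lin A (P 1) N g" "lin A (P 1) N h" by (simp_all add: Z_iff)
    from this[THEN linD(1)] show "f \<otimes>\<^bsub>?G\<^esub> g \<otimes>\<^bsub>?G\<^esub> h = f \<otimes>\<^bsub>?G\<^esub> (g \<otimes>\<^bsub>?G\<^esub> h)"
      by (auto simp: hom_group_def N.M.a_assoc intro!: restrict_ext)
  next
    show "\<one>\<^bsub>?G\<^esub> \<in> carrier ?G"
      using Z1[OF lin_const_zero[OF N]] by (simp add: hom_group_def zero_hom_def)
  next
    fix f assume "f \<in> carrier ?G"
    then have f: "f \<in> extensional (carrier (P 1))" "lin A (P 1) N f"
      "\<And>x. x \<in> carrier (P 2) \<Longrightarrow> f (d 1 x) = \<zero>\<^bsub>N\<^esub>" by (simp_all add: Z_iff)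
    show "\<one>\<^bsub>?G\<^esub> \<otimes>\<^bsub>?G\<^esub> f = f"
      using f(1) linD(1)[OF f(2)] by (auto simp: hom_group_def zero_hom_def extensional_def fun_eq_iff)
    have "(\<lambda>x\<in>carrier (P 1). \<ominus>\<^bsub>N\<^esub> f x) \<in> Z" by (rule Z1[OF lin_neg[OF N f(2)]]) (simp add: f(3) del: One_nat_def)
    moreover have "(\<lambda>x\<in>carrier (P 1). \<ominus>\<^bsub>N\<^esub> f x) \<otimes>\<^bsub>?G\<^esub> f = \<one>\<^bsub>?G\<^esub>"
      using linD(1)[OF f(2)] by (auto simp: hom_group_def zero_hom_def N.M.l_neg intro!: restrict_ext)
    ultimately show "\<exists>y\<in>carrier ?G. y \<otimes>\<^bsub>?G\<^esub> f = \<one>\<^bsub>?G\<^esub>" by (intro bexI) auto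
  qed
  then interpret G: comm_group ?G .
  have "coboundaries A P d N 1 \<subseteq> Z"
  proof
    fix f assume "f \<in> coboundaries A P d N 1"
    then obtain g where g: "g \<in> mod_hom A (P 0) N" "f = compose (carrier (P 1)) g (d 0)" by auto
    have "lin A (P 1) N (\<lambda>x. g (d 0 x))" using lin_comp[OF d[of 0] mod_hom_lin[OF g(1)]] by simp
    moreover have "g (d 0 (d 1 x)) = \<zero>\<^bsub>N\<^esub>" if "x \<in> carrier (P 2)" for x
      using dd[OF that] lin_zero[OF lP N mod_hom_lin[OF g(1)]] by simp
    ultimately show "f \<in> Z" unfolding g(2) compose_def by (rule Z1)
  qed
  then have BZ: "coboundaries A P d N 1 = Z" using van[OF res] unfolding Z_def by blast
  have "Ext A 1 T N = ?G Mod Z"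
    using BZ unfolding Ext_def Let_def Pd_def[symmetric] Pd' Z_def by simp
  moreover have "trivial_group (?G Mod Z)"
    unfolding trivial_group_def
  proof
    have nG: "carrier ?G \<lhd> ?G" by (rule G.subgroup_imp_normal[OF G.subgroup_self])
    then show "group (?G Mod Z)" using normal.factorgroup_is_group by fastforce
    have "carrier ?G #>\<^bsub>?G\<^esub> x = carrier ?G" if "x \<in> carrier ?G" for x
      using G.coset_join2[OF that G.subgroup_self that] .
    moreover have "\<one>\<^bsub>?G\<^esub> \<in> carrier ?G" by (rule G.one_closed)
    ultimately show "carrier (?G Mod Z) = {\<one>\<^bsub>?G Mod Z\<^esub>}"
      unfolding carrier_FactGroup one_FactGroup by (simp del: G.one_closed) blast
  qed
  ultimately show ?thesis by simp
qed

text \<open>An exact sequence \<open>0 -> L -> N -> M -> 0\<close> together with a retract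
  \<open>T\<close> of \<open>M\<close>. In the application \<open>L\<close> is the regular module
  and \<open>T\<close> the basic part of \<open>M\<close>. The kernel of the induced map from
  \<open>N\<close> to \<open>T\<close> need no longer be \<open>L\<close>, so facts about
  \<open>T\<close> have to be derived from the sequence for \<open>M\<close>.\<close>

locale retract_presentation =
  fixes A :: "('a, 'm) ring_scheme" and L :: "('a, 'l) module" and N :: "('a, 'n) module"
    and M :: "('a, 'c) module" and T :: "('a, 'b) module" and \<iota> \<pi> i r
  assumes L: "projective_module A L" and N: "projective_module A N" "injective_module A N"
    and M: "fg_module A M" and T: "fg_module A T"
    and \<iota>: "lin A L N \<iota>" "inj_on \<iota> (carrier L)"
    and \<pi>: "lin A N M \<pi>" "\<And>y. y \<in> carrier M \<Longrightarrow> \<exists>x\<in>carrier N. \<pi> x = y"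
    and exact: "{x \<in> carrier N. \<pi> x = \<zero>\<^bsub>M\<^esub>} = \<iota> ` carrier L"
    and i: "lin A T M i" and r: "lin A M T r" and ri: "\<And>x. x \<in> carrier T \<Longrightarrow> r (i x) = x"
begin

lemmas lT = fg_left[OF T] and lM = fg_left[OF M] and fgN = projective_fg[OF N(1)]
  and fgL = projective_fg[OF L] and lN = fg_left[OF projective_fg[OF N(1)]]
  and lL = fg_left[OF projective_fg[OF L]]

sublocale N: left_module A N by (rule lN)

sublocale T: left_module A T by (rule lT)

lemma r\<pi>: "lin A N T (\<lambda>x. r (\<pi> x))"
  by (rule lin_comp[OF \<pi>(1) r])

text \<open>Schanuel-type argument: two projective presentations of \<open>T\<close> are compared by lifts \<open>s\<close> and
  \<open>t\<close>, and \<open>1 - ts\<close> maps into the kernel of the given one.\<close>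

lemma cocycles_subset_coboundaries:
  assumes res: "proj_resolution A T P d \<epsilon>"
  shows "cocycles A P d T 1 \<subseteq> coboundaries A P d T 1"
proof
  fix f assume f: "f \<in> cocycles A P d T 1"
  note pP = proj_resolutionD(1)[OF res]
  note fgP = projective_fg[OF pP] and lP = fg_left[OF projective_fg[OF pP]]
  interpret P0: left_module A "P 0" by (rule lP)
  have d0: "lin A (P 1) (P 0) (d 0)" and \<epsilon>: "lin A (P 0) T \<epsilon>" "\<And>y. y \<in> carrier T \<Longrightarrow> \<exists>x\<in>carrier (P 0). \<epsilon> x = y"
    and ker0: "d 0 ` carrier (P 1) = {x \<in> carrier (P 0). \<epsilon> x = \<zero>\<^bsub>T\<^esub>}"
    and ker1: "d 1 ` carrier (P 2) = {x \<in> carrier (P 1). d 0 x = \<zero>\<^bsub>P 0\<^esub>}"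
  proof -
    show "lin A (P 1) (P 0) (d 0)" using proj_resolutionD(2)[OF res, of 0] by simp
    show "lin A (P 0) T \<epsilon>" by (rule proj_resolutionD(3)[OF res])
    show "\<exists>x\<in>carrier (P 0). \<epsilon> x = y" if "y \<in> carrier T" for y
      using that unfolding proj_resolutionD(4)[OF res, symmetric] by blast
    show "d 0 ` carrier (P 1) = {x \<in> carrier (P 0). \<epsilon> x = \<zero>\<^bsub>T\<^esub>}"
      using proj_resolutionD(5)[OF res] unfolding mod_ker_def .
    show "d 1 ` carrier (P 2) = {x \<in> carrier (P 1). d 0 x = \<zero>\<^bsub>P 0\<^esub>}"
      using proj_resolutionD(6)[OF res, of 0] unfolding mod_ker_def numeral_2_eq_2 One_nat_def .
  qed
  have fl: "lin A (P 1) T f" and fext: "f \<in> extensional (carrier (P 1))"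
    using f mod_hom_lin mod_homD(1) unfolding cocycles_def by blast+
  have f0: "f (d 1 x) = \<zero>\<^bsub>T\<^esub>" if "x \<in> carrier (P 2)" for x
  proof -
    have "compose (carrier (P 2)) f (d 1) x = zero_hom (P 2) T x"
      using f by (simp add: cocycles_def numeral_2_eq_2)
    then show ?thesis using that by (simp add: compose_def zero_hom_def)
  qed
  let ?K = "{x \<in> carrier (P 0). \<epsilon> x = \<zero>\<^bsub>T\<^esub>}"
  have K: "submodule ?K A (P 0)" by (rule submodule_kernel[OF lP lT \<epsilon>(1)])
  note lK = left_module_submod[OF lP K]
  have dK: "lin A (P 1) (submod (P 0) ?K) (d 0)"
    by (rule lin_submod_cod[OF d0]) (use ker0 in blast)
  \<comment> \<open>A cocycle kills the image of \<open>d 1\<close>, which is the kernel of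
    \<open>d 0\<close>, so it factors through the first syzygy \<open>?K\<close>. It remains to
    extend \<open>fb\<close> from \<open>?K\<close> to \<open>P 0\<close>.\<close>
  obtain fb where fb: "lin A (submod (P 0) ?K) T fb" "\<And>x. x \<in> carrier (P 1) \<Longrightarrow> fb (d 0 x) = f x"
  proof (rule lin_factor[OF lP lT lK fl dK])
    show "\<exists>x\<in>carrier (P 1). d 0 x = k" if "k \<in> carrier (submod (P 0) ?K)" for k
      using that ker0 unfolding submod_simps by (metis (lifting) imageE)
    show "f x = \<zero>\<^bsub>T\<^esub>" if "x \<in> carrier (P 1)" "d 0 x = \<zero>\<^bsub>submod (P 0) ?K\<^esub>" for x
    proof -
      have "x \<in> d 1 ` carrier (P 2)" unfolding ker1 using that by simp
      then show ?thesis using f0 by blast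
    qed
  qed blast
  obtain s where s: "lin A (P 0) N s" "\<And>p. p \<in> carrier (P 0) \<Longrightarrow> \<pi> (s p) = i (\<epsilon> p)"
    using projective_lift[OF pP fgN M \<pi> lin_comp[OF \<epsilon>(1) i]] by blast
  obtain t where t: "lin A N (P 0) t" "\<And>p. p \<in> carrier N \<Longrightarrow> \<epsilon> (t p) = r (\<pi> p)"
    using projective_lift[OF N(1) fgP T \<epsilon> lin_comp[OF \<pi>(1) r]] by blast
  have r\<pi>s: "\<exists>x\<in>carrier N. r (\<pi> x) = y" if "y \<in> carrier T" for y
    using \<pi>(2)[OF linD(1)[OF i that]] ri[OF that] by metis
  have t\<iota>: "lin A L (submod (P 0) ?K) (\<lambda>l. t (\<iota> l))"
  proof (rule lin_submod_cod[OF lin_comp[OF \<iota>(1) t(1)]])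
    fix l assume l: "l \<in> carrier L"
    have "\<pi> (\<iota> l) = \<zero>\<^bsub>M\<^esub>" using exact l by blast
    then show "t (\<iota> l) \<in> ?K"
      using t(2)[OF linD(1)[OF \<iota>(1) l]] linD(1)[OF t(1) linD(1)[OF \<iota>(1) l]] lin_zero[OF lM lT r] by simp
  qed
  \<comment> \<open>Maps from \<open>L\<close> to \<open>T\<close> extend along
    \<open>\<iota>\<close>: they lift to \<open>N\<close> because \<open>L\<close> is projective,
    and the lift extends because \<open>N\<close> is injective.\<close>
  obtain w where w: "lin A L N w" "\<And>p. p \<in> carrier L \<Longrightarrow> r (\<pi> (w p)) = fb (t (\<iota> p))"
    using projective_lift[OF L fgN T r\<pi> r\<pi>s lin_comp[OF t\<iota> fb(1)]] by blast
  obtain W where W: "lin A N N W" "\<And>p. p \<in> carrier L \<Longrightarrow> W (\<iota> p) = w p"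
    using injective_extend[OF N(2) fgL fgN \<iota> w(1)] by blast
  have u: "lin A N T (\<lambda>n. r (\<pi> (W n)))" by (rule lin_comp[OF W(1) r\<pi>])
  have k: "lin A (P 0) (submod (P 0) ?K) (\<lambda>p. p \<ominus>\<^bsub>P 0\<^esub> t (s p))"
  proof (rule lin_submod_cod[OF lin_diff[OF lP lin_id lin_comp[OF s(1) t(1)]]])
    fix p assume p: "p \<in> carrier (P 0)"
    have c: "s p \<in> carrier N" "t (s p) \<in> carrier (P 0)" "\<epsilon> p \<in> carrier T"
      using p linD(1)[OF s(1)] linD(1)[OF t(1)] linD(1)[OF \<epsilon>(1)] by blast+
    then have "\<epsilon> (t (s p)) = \<epsilon> p" using t(2) s(2)[OF p] ri by simp
    then have "\<epsilon> (p \<ominus>\<^bsub>P 0\<^esub> t (s p)) = \<zero>\<^bsub>T\<^esub>"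
      using p c linD(2)[OF \<epsilon>(1)] lin_uminus[OF lP lT \<epsilon>(1)] by (simp add: a_minus_def T.M.r_neg)
    then show "p \<ominus>\<^bsub>P 0\<^esub> t (s p) \<in> ?K" using p c by simp
  qed
  \<comment> \<open>The two terms follow the splitting \<open>p = t (s p) + (p - t (s p))\<close>.
    For \<open>p\<close> in \<open>?K\<close> the element \<open>s p\<close> comes from
    \<open>L\<close>, where the extension agrees with \<open>fb\<close> after \<open>t\<close>, so
    the terms add up to \<open>fb p\<close>.\<close>
  define g where "g p = r (\<pi> (W (s p))) \<oplus>\<^bsub>T\<^esub> fb (p \<ominus>\<^bsub>P 0\<^esub> t (s p))" for p
  have g: "lin A (P 0) T g"
    unfolding g_def by (rule lin_add[OF lT lin_comp[OF s(1) u] lin_comp[OF k fb(1)]])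
  have gd: "g (d 0 x) = f x" if x: "x \<in> carrier (P 1)" for x
  proof -
    let ?q = "d 0 x"
    have q: "?q \<in> ?K" using ker0 x by blast
    then have q0: "?q \<in> carrier (P 0)" "\<epsilon> ?q = \<zero>\<^bsub>T\<^esub>" by simp_all
    then have "\<pi> (s ?q) = \<zero>\<^bsub>M\<^esub>" using s(2) lin_zero[OF lT lM i] by simp
    then have "s ?q \<in> \<iota> ` carrier L" using exact linD(1)[OF s(1) q0(1)] by blast
    then obtain l where l: "l \<in> carrier L" "s ?q = \<iota> l" by blast
    then have e1: "r (\<pi> (W (s ?q))) = fb (t (s ?q))" using W(2) w(2) by simp
    have tk: "t (s ?q) \<in> ?K" using linD(1)[OF t\<iota> l(1)] l(2) by simp
    have mk: "?q \<ominus>\<^bsub>P 0\<^esub> t (s ?q) \<in> ?K" using linD(1)[OF k q0(1)] by simp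
    have "g ?q = fb (t (s ?q) \<oplus>\<^bsub>P 0\<^esub> (?q \<ominus>\<^bsub>P 0\<^esub> t (s ?q)))"
      unfolding g_def e1 using linD(2)[OF fb(1), of "t (s ?q)" "?q \<ominus>\<^bsub>P 0\<^esub> t (s ?q)"] tk mk by simp
    also have "t (s ?q) \<oplus>\<^bsub>P 0\<^esub> (?q \<ominus>\<^bsub>P 0\<^esub> t (s ?q)) = ?q"
      using q0(1) tk by (simp add: a_minus_def P0.M.a_lcomm[of "t (s ?q)"] P0.M.r_neg)
    finally show ?thesis using fb(2)[OF x] by simp
  qed
  have "f = compose (carrier (P 1)) (restrict g (carrier (P 0))) (d 0)"
  proof (rule extensionalityI[OF fext])
    fix x assume "x \<in> carrier (P 1)"
    then show "f x = compose (carrier (P 1)) (restrict g (carrier (P 0))) (d 0) x"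
      using gd linD(1)[OF d0] by (simp add: compose_def)
  qed (simp add: compose_extensional)
  then show "f \<in> coboundaries A P d T 1"
    using lin_mod_hom[OF lP g] by (simp add: image_iff) blast
qed

text \<open>Lift the idempotent \<open>i r\<close> of \<open>M\<close> to an endomorphism
  \<open>s\<close> of \<open>N\<close>. It sends the kernel of \<open>N -> T\<close> into the image
  of \<open>\<iota>\<close>, and \<open>n - s n\<close> always lies in that kernel. So
  \<open>k\<close> mapped to \<open>(s k, k)\<close> and \<open>(l, n)\<close> mapped to
  \<open>\<iota> l + (n - s n)\<close> make the kernel a retract of the projective module
  \<open>L \<oplus> N\<close>.\<close>

lemma kernel_projective:
  "projective_module A (submod N {x \<in> carrier N. r (\<pi> x) = \<zero>\<^bsub>T\<^esub>})"
proof -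
  let ?K = "{x \<in> carrier N. r (\<pi> x) = \<zero>\<^bsub>T\<^esub>}"
  let ?I = "{x \<in> carrier N. \<pi> x = \<zero>\<^bsub>M\<^esub>}"
  have K: "submodule ?K A N" by (rule submodule_kernel[OF lN lT r\<pi>])
  have I: "submodule ?I A N" by (rule submodule_kernel[OF lN lM \<pi>(1)])
  note lK = left_module_submod[OF lN K] and lI = left_module_submod[OF lN I]
  have \<iota>I: "lin A L (submod N ?I) \<iota>" by (rule lin_submod_cod[OF \<iota>(1)]) (simp add: exact)
  obtain \<kappa> where \<kappa>: "iso_pair A L (submod N ?I) \<iota> \<kappa>"
    by (rule lin_bij_iso_pair[OF lL lI \<iota>I \<iota>(2)]) (auto simp: exact)
  obtain s where s: "lin A N N s" "\<And>p. p \<in> carrier N \<Longrightarrow> \<pi> (s p) = i (r (\<pi> p))"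
    using projective_lift[OF N(1) fgN M \<pi> lin_comp[OF r\<pi> i]] by blast
  have sK: "lin A (submod N ?K) (submod N ?I) s"
    by (rule lin_submod_cod[OF lin_submod_dom[OF K s(1)]])
      (use s linD(1)[OF s(1)] lin_zero[OF lT lM i] in auto)
  have a: "lin A (submod N ?K) (dsum2 L N) (\<lambda>k. (\<kappa> (s k), k))"
    by (intro lin_pair lin_comp[OF sK iso_pairD(2)[OF \<kappa>]] lin_incl[OF K])
  have IK: "?I \<subseteq> ?K" using lin_zero[OF lM lT r] by auto
  have b1: "lin A L (submod N ?K) \<iota>" by (rule lin_submod_cod[OF \<iota>(1)]) (use IK exact in blast)
  have b2: "lin A N (submod N ?K) (\<lambda>n. n \<ominus>\<^bsub>N\<^esub> s n)"
  proof (rule lin_submod_cod[OF lin_diff[OF lN lin_id s(1)]])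
    fix n assume n: "n \<in> carrier N"
    have c: "s n \<in> carrier N" "r (\<pi> n) \<in> carrier T" using n linD(1)[OF s(1)] linD(1)[OF r\<pi>] by blast+
    have "r (\<pi> (s n)) = r (\<pi> n)" using s(2)[OF n] ri[OF c(2)] by simp
    then have "r (\<pi> (n \<ominus>\<^bsub>N\<^esub> s n)) = \<zero>\<^bsub>T\<^esub>"
      using n c linD(2)[OF r\<pi>] lin_uminus[OF lN lT r\<pi>] by (simp add: a_minus_def T.M.r_neg)
    then show "n \<ominus>\<^bsub>N\<^esub> s n \<in> ?K" using n c by simp
  qed
  have b: "lin A (dsum2 L N) (submod N ?K) (\<lambda>p. \<iota> (fst p) \<oplus>\<^bsub>N\<^esub> (snd p \<ominus>\<^bsub>N\<^esub> s (snd p)))"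
    using lin_copair[OF lK b1 b2] by simp
  have ba: "\<iota> (\<kappa> (s k)) \<oplus>\<^bsub>N\<^esub> (k \<ominus>\<^bsub>N\<^esub> s k) = k" if "k \<in> ?K" for k
  proof -
    have c: "k \<in> carrier N" "s k \<in> ?I" using that linD(1)[OF sK, of k] by auto
    then have "\<iota> (\<kappa> (s k)) = s k" using iso_pairD(4)[OF \<kappa>] by simp
    then show ?thesis using c by (simp add: a_minus_def N.M.a_lcomm[of "s k"] N.M.r_neg)
  qed
  have "retract A (submod N ?K) (dsum2 L N)"
    unfolding retract_def using a b ba
    by (intro exI[of _ "\<lambda>k. (\<kappa> (s k), k)"] exI[of _ "\<lambda>p. \<iota> (fst p) \<oplus>\<^bsub>N\<^esub> (snd p \<ominus>\<^bsub>N\<^esub> s (snd p))"]) simp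
  then show ?thesis by (rule projective_retract[OF projective_dsum2[OF L N(1)] lK])
qed

end

text \<open>Padding for resolutions, which are indexed by all naturals. The zero module is
  projective as a retract of the regular module.\<close>

lemma projective_zero_umod:
  assumes R: "ring A"
  obtains Z :: "'a umod" where "projective_module (A :: ('a, 'm) ring_scheme) Z" "zero_module Z"
proof -
  let ?D = "dsum ({} :: nat set) (\<lambda>_. undefined :: 'a umod)"
  have c: "carrier ?D = {\<zero>\<^bsub>?D\<^esub>}"
    by (auto simp: dsum_simps restrict_def)
  obtain Z :: "'a umod" and f g where
    Z: "fg_module A Z" "iso_pair A ?D Z f g"
    by (rule fg_umod[OF fg_dsum_empty[OF R]])
  interpret Z: left_module A Z by (rule fg_left[OF Z(1)])
  have x: "x = f \<zero>\<^bsub>?D\<^esub>" if "x \<in> carrier Z" for x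
    using iso_pairD(4,6)[OF Z(2) that] c by simp
  have zc: "carrier Z = {\<zero>\<^bsub>Z\<^esub>}"
    using x x[OF Z.M.zero_closed] Z.M.zero_closed by auto
  have "retract A Z (regular_module A)"
    unfolding retract_def
    by (rule exI[of _ "\<lambda>_. \<zero>\<^bsub>regular_module A\<^esub>"], rule exI[of _ "\<lambda>_. \<zero>\<^bsub>Z\<^esub>"])
      (use zc lin_const_zero[OF left_module_regular[OF R]] lin_const_zero[OF Z.left_module_axioms] in auto)
  then have "projective_module A Z"
    by (rule projective_retract[OF projective_regular[OF R] Z.left_module_axioms])
  then show ?thesis using that zc by (simp add: zero_module_def)
qed

text \<open>A resolution is an infinite sequence over the fixed carrier type, so \<open>K\<close>
  and \<open>N\<close> are replaced by isomorphic copies and the sequence is continued by zero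
  modules.\<close>

lemma proj_resolution_length_one:
  fixes A :: "('a, 'm) ring_scheme" and T :: "('a, 'b) module" and K :: "('a, 'c) module" and N :: "('a, 'd) module"
  assumes K: "projective_module A K" and N: "projective_module A N" and T: "left_module A T"
    and j: "lin A K N j" "inj_on j (carrier K)"
    and p: "lin A N T p" "\<And>y. y \<in> carrier T \<Longrightarrow> \<exists>x\<in>carrier N. p x = y"
    and exact: "{x \<in> carrier N. p x = \<zero>\<^bsub>T\<^esub>} = j ` carrier K"
  shows "\<exists>P d \<epsilon>. proj_resolution A T P d \<epsilon> \<and> (\<forall>i>1. zero_module (P i))"
proof -
  note fgK = projective_fg[OF K] and fgN = projective_fg[OF N]
  note lK = fg_left[OF fgK] and lN = fg_left[OF fgN]
  interpret N: left_module A N by fact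
  interpret K: left_module A K by fact
  obtain K' :: "'a umod" and u u' where K': "fg_module A K'" "iso_pair A K K' u u'" by (rule fg_umod[OF fgK])
  obtain N' :: "'a umod" and v v' where N': "fg_module A N'" "iso_pair A N N' v v'" by (rule fg_umod[OF fgN])
  obtain Z :: "'a umod" where Z: "projective_module A Z" "zero_module Z"
    by (rule projective_zero_umod[OF N.R.ring_axioms])
  note lK' = fg_left[OF K'(1)] and lN' = fg_left[OF N'(1)] and lZ = fg_left[OF projective_fg[OF Z(1)]]
  note u = iso_pairD[OF K'(2)] and v = iso_pairD[OF N'(2)]
  interpret K': left_module A K' by fact
  interpret N': left_module A N' by fact
  interpret Z: left_module A Z by fact
  have pK': "projective_module A K'"
    by (rule projective_retract[OF K lK' iso_pair_retract[OF iso_pair_sym[OF K'(2)]]])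
  have pN': "projective_module A N'"
    by (rule projective_retract[OF N lN' iso_pair_retract[OF iso_pair_sym[OF N'(2)]]])
  define P where "P i = (if i = 0 then N' else if i = 1 then K' else Z)" for i :: nat
  define d where "d i = (if i = 0 then restrict (\<lambda>x. v (j (u' x))) (carrier K') else zero_hom Z (P i))" for i :: nat
  have P: "P 0 = N'" "P (Suc 0) = K'" "P (Suc (Suc i)) = Z" for i by (auto simp: P_def)
  have lP: "left_module A (P i)" for i using lK' lN' lZ by (simp add: P_def)
  have z0: "zero_hom Z (P i) \<in> mod_hom A Z (P i)" for i
    using lin_mod_hom[OF lZ lin_const_zero[OF lP]] by (simp add: zero_hom_def)
  have l0: "lin A K' N' (\<lambda>x. v (j (u' x)))" by (rule lin_comp[OF u(2) lin_comp[OF j(1) v(1)]])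
  have dh: "d i \<in> mod_hom A (P (Suc i)) (P i)" for i
  proof (cases i)
    case 0
    then show ?thesis using lin_mod_hom[OF lK' l0] by (simp add: d_def P)
  next
    case (Suc i')
    then show ?thesis using z0[of i] by (simp add: d_def P)
  qed
  have pv: "lin A N' T (\<lambda>x. p (v' x))" by (rule lin_comp[OF v(2) p(1)])
  let ?\<epsilon> = "restrict (\<lambda>x. p (v' x)) (carrier N')"
  have epi: "epi_hom A N' T ?\<epsilon>"
    unfolding epi_hom_def
  proof (intro conjI lin_mod_hom[OF lN' pv] equalityI subsetI)
    fix y assume "y \<in> carrier T"
    then obtain x where "x \<in> carrier N" "p x = y" using p(2) by blast
    then show "y \<in> ?\<epsilon> ` carrier N'" using v(3,5) by (intro image_eqI[of _ _ "v x"]) auto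
  qed (use linD(1)[OF pv] in auto)
  have ex0: "d 0 ` carrier K' = mod_ker N' T ?\<epsilon>"
  proof (intro equalityI subsetI)
    fix y assume "y \<in> d 0 ` carrier K'"
    then obtain x where x: "x \<in> carrier K'" "y = v (j (u' x))" by (auto simp: d_def)
    have "j (u' x) \<in> {x \<in> carrier N. p x = \<zero>\<^bsub>T\<^esub>}" unfolding exact using u(6)[OF x(1)] by blast
    then show "y \<in> mod_ker N' T ?\<epsilon>" using x(2) v(3,5) by (simp add: mod_ker_def)
  next
    fix y assume "y \<in> mod_ker N' T ?\<epsilon>"
    then have y: "y \<in> carrier N'" "p (v' y) = \<zero>\<^bsub>T\<^esub>" by (auto simp: mod_ker_def)
    then have "v' y \<in> j ` carrier K" unfolding exact[symmetric] using v(6) by simp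
    then obtain k where k: "k \<in> carrier K" "v' y = j k" by blast
    then have "y = v (j (u' (u k)))" using v(4)[OF y(1)] u(3) by simp
    then show "y \<in> d 0 ` carrier K'" using u(5)[OF k(1)] by (auto simp: d_def)
  qed
  \<comment> \<open>Exactness in degree one amounts to injectivity of \<open>j\<close>, because the
    incoming map starts at a zero module.\<close>
  have ker0: "mod_ker K' N' (d 0) = {\<zero>\<^bsub>K'\<^esub>}"
  proof -
    have "x = \<zero>\<^bsub>K'\<^esub>" if x: "x \<in> carrier K'" "v (j (u' x)) = \<zero>\<^bsub>N'\<^esub>" for x
    proof -
      have c: "u' x \<in> carrier K" "j (u' x) \<in> carrier N" using x(1) u(6) linD(1)[OF j(1)] by blast+
      have "j (u' x) = \<zero>\<^bsub>N\<^esub>" using v(3)[OF c(2)] x(2) lin_zero[OF lN' lN v(2)] by simp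
      then have "u' x = \<zero>\<^bsub>K\<^esub>"
        using j(2) c(1) lin_zero[OF lK lN j(1)] by (metis inj_on_eq_iff K.M.zero_closed)
      then show ?thesis using u(4)[OF x(1)] lin_zero[OF lK lK' u(1)] by simp
    qed
    then show ?thesis using lin_zero[OF lK' lN' l0] by (auto simp: mod_ker_def d_def)
  qed
  have Zc: "carrier Z = {\<zero>\<^bsub>Z\<^esub>}" using Z(2) by (simp add: zero_module_def)
  have exS: "d (Suc i) ` carrier (P (Suc (Suc i))) = mod_ker (P (Suc i)) (P i) (d i)" for i
  proof (cases i)
    case 0
    then show ?thesis using ker0 Zc by (simp add: P d_def zero_hom_def)
  next
    case (Suc i')
    then show ?thesis using Zc by (auto simp: P d_def zero_hom_def mod_ker_def)
  qed
  have "proj_resolution A T P d ?\<epsilon>"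
    unfolding proj_resolution_def
    using dh epi ex0 exS pK' pN' Z(1) by (simp add: P P_def)
  moreover have "\<forall>i>1. zero_module (P i)" using Z(2) by (simp add: P_def)
  ultimately show ?thesis by blast
qed

lemma decomposable_of_artinian_umods:
  fixes A :: "('a, 'm) ring_scheme" and M :: "('a, 'b) module"
  assumes M: "fg_module A M" and art: "\<And>M :: 'a umod. fg_module A M \<Longrightarrow> artinian_module A M"
  shows "decomposable A M"
proof -
  obtain M' :: "'a umod" and u v where M': "fg_module A M'" "iso_pair A M M' u v" by (rule fg_umod[OF M])
  show ?thesis by (rule decomposable_iso[OF M'(2) decomposable_artinian[OF M'(1) art[OF M'(1)]]])
qed

text \<open>Put \<open>M = G \<oplus> C\<close>. The projective-injective module
  \<open>G \<oplus> G\<close> maps onto \<open>M\<close> with the regular module, placed in the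
  second coordinate, as kernel; this yields projective dimension, vanishing of Ext, and Gen. The
  embedding of \<open>M\<close> into \<open>G \<oplus> I\<close> yields Cogen. The given sequence is
  the third tilting condition, as \<open>G\<close> and \<open>C\<close> lie in \<open>add T\<close>
  up to isomorphism.\<close>

lemma tilting_module_of_presentation:
  fixes A :: "('a, 'm) ring_scheme"
  assumes R: "ring A" and art: "\<And>M :: 'a umod. fg_module A M \<Longrightarrow> artinian_module A M"
    and G: "projective_module A G" "injective_module A G"
    and I: "projective_module A I" "injective_module A I" and C: "fg_module A C"
    and f: "lin A (regular_module A) G f" "inj_on f (carrier A)"
    and g: "lin A G C g" "\<And>y. y \<in> carrier C \<Longrightarrow> \<exists>x\<in>carrier G. g x = y"
    and exact: "{x \<in> carrier G. g x = \<zero>\<^bsub>C\<^esub>} = f ` carrier A"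
    and h: "lin A C I h" "inj_on h (carrier C)"
  shows "\<exists>T. tilting_module A T \<and> T \<in> C_cat A"
proof -
  note dec = decomposable_of_artinian_umods[OF _ art]
  note fgG = projective_fg[OF G(1)]
  note lG = fg_left[OF fgG] and lC = fg_left[OF C]
  interpret G: left_module A G by fact
  let ?L = "regular_module A" and ?N = "dsum2 G G" and ?M = "dsum2 G C"
  let ?P = "{x \<in> carrier ?N. (fst x, g (snd x)) = \<zero>\<^bsub>?M\<^esub>}"
  let ?K' = "{x \<in> carrier G. g x = \<zero>\<^bsub>C\<^esub>}"
  note L = projective_regular[OF R]
  note lL = fg_left[OF fg_regular[OF R]]
  note N = projective_dsum2[OF G(1) G(1)] injective_dsum2[OF G(2) G(2)]
  note lN = fg_left[OF projective_fg[OF N(1)]]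
  note fgM = fg_dsum2[OF fgG C]
  have \<iota>: "lin A ?L ?N (\<lambda>x. (\<zero>\<^bsub>G\<^esub>, f x))" by (rule lin_pair[OF lin_const_zero[OF lG] f(1)])
  have \<iota>i: "inj_on (\<lambda>x. (\<zero>\<^bsub>G\<^esub>, f x)) (carrier ?L)" using f(2) by (simp add: inj_on_def)
  have \<pi>: "lin A ?N ?M (\<lambda>p. (fst p, g (snd p)))"
    by (rule lin_pair[OF lin_fst lin_comp[OF lin_snd g(1)]])
  have \<pi>s: "\<exists>x\<in>carrier ?N. (fst x, g (snd x)) = y" if "y \<in> carrier ?M" for y
    using that g(2) by (cases y) fastforce
  have ex: "?P = (\<lambda>x. (\<zero>\<^bsub>G\<^esub>, f x)) ` carrier ?L"
  proof -
    have "?P = Pair \<zero>\<^bsub>G\<^esub> ` ?K'"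
    proof (intro equalityI subsetI)
      fix x assume "x \<in> ?P"
      then have "x = (\<zero>\<^bsub>G\<^esub>, snd x)" "snd x \<in> ?K'"
        by (simp_all add: prod_eq_iff mem_Times_iff)
      then show "x \<in> Pair \<zero>\<^bsub>G\<^esub> ` ?K'" by (rule image_eqI)
    next
      fix x assume "x \<in> Pair \<zero>\<^bsub>G\<^esub> ` ?K'"
      then obtain y where "x = (\<zero>\<^bsub>G\<^esub>, y)" "y \<in> carrier G" "g y = \<zero>\<^bsub>C\<^esub>" by blast
      then show "x \<in> ?P" by simp
    qed
    then show ?thesis unfolding exact by (simp add: image_image)
  qed
  obtain T :: "'a umod" and n where T: "fg_module A T" "basic_module A T" "retract A T ?M"
    "retract A ?M (dpower T n)"
    by (rule basic_reduction[OF fgM dec[OF fgM]])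
  note lT = fg_left[OF T(1)]
  obtain i r where i: "lin A T ?M i" and r: "lin A ?M T r" and ri: "\<And>x. x \<in> carrier T \<Longrightarrow> r (i x) = x"
    using T(3) unfolding retract_def by blast
  let ?p = "\<lambda>x. r (fst x, g (snd x))"
  have p: "lin A ?N T ?p" by (rule lin_comp[OF \<pi> r])
  have ps: "\<exists>x\<in>carrier ?N. ?p x = y" if "y \<in> carrier T" for y
    using \<pi>s[OF linD(1)[OF i that]] ri[OF that] by metis
  note pres = retract_presentation.intro[OF L N fgM T(1) \<iota> \<iota>i \<pi> \<pi>s ex i r ri]
  note K = retract_presentation.kernel_projective[OF pres]
  let ?K = "{x \<in> carrier ?N. ?p x = \<zero>\<^bsub>T\<^esub>}"
  have "\<exists>P d \<epsilon>. proj_resolution A T P d \<epsilon> \<and> (\<forall>i>1. zero_module (P i))"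
    by (rule proj_resolution_length_one[OF K N(1) lT lin_incl[OF submodule_kernel[OF lN lT p]] _ p ps])
      auto
  then obtain P d \<epsilon> where res: "proj_resolution A T P d \<epsilon>" "\<forall>i>1. zero_module (P i)" by blast
  have pd: "projdim A T \<le> 1"
    unfolding projdim_def
  proof (rule Inf_lower)
    show "1 \<in> {enat n |n. \<exists>P d \<epsilon>. proj_resolution A T P d \<epsilon> \<and> (\<forall>i>n. zero_module (P i))}"
      using res unfolding one_enat_def by blast
  qed
  have ext: "trivial_group (Ext A 1 T T)"
  proof (rule trivial_Ext1[OF _ lT])
    show "\<exists>P d \<epsilon>. proj_resolution A T P d \<epsilon>" using res(1) by blast
    show "cocycles A P d T 1 \<subseteq> coboundaries A P d T 1" if "proj_resolution A T P d \<epsilon>" for P d \<epsilon>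
      by (rule retract_presentation.cocycles_subset_coboundaries[OF pres that])
  qed
  interpret C: left_module A C by fact
  \<comment> \<open>\<open>add_cl\<close> contains only modules on the fixed carrier type, so the
    exact sequence is transported to copies \<open>G'\<close> and \<open>C'\<close>.\<close>
  obtain G' :: "'a umod" and u u' where G': "fg_module A G'" "iso_pair A G G' u u'"
    by (rule fg_umod[OF projective_fg[OF G(1)]])
  obtain C' :: "'a umod" and w w' where C': "fg_module A C'" "iso_pair A C C' w w'"
    by (rule fg_umod[OF C])
  note u = iso_pairD[OF G'(2)] and w = iso_pairD[OF C'(2)]
  have f': "lin A (regular_module A) G' (\<lambda>x. u (f x))" by (rule lin_comp[OF f(1) u(1)])
  have g': "lin A G' C' (\<lambda>x. w (g (u' x)))" by (rule lin_comp[OF u(2) lin_comp[OF g(1) w(1)]])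
  have fc: "f x \<in> carrier G" if "x \<in> carrier A" for x using linD(1)[OF f(1)] that by simp
  note gc = linD(1)[OF g(1)]
  have fi: "inj_on (\<lambda>x. u (f x)) (carrier A)"
    by (rule inj_on_inverseI[of _ "\<lambda>y. the_inv_into (carrier A) f (u' y)"])
      (simp add: u(3) fc the_inv_into_f_f[OF f(2)])
  have gs: "\<exists>x\<in>carrier G'. w (g (u' x)) = y" if y: "y \<in> carrier C'" for y
  proof -
    obtain x where x: "x \<in> carrier G" "g x = w' y" using g(2)[OF w(6)[OF y]] by blast
    then show ?thesis using u(3,5) w(4)[OF y] by (intro bexI[of _ "u x"]) simp_all
  qed
  have ex': "{x \<in> carrier G'. w (g (u' x)) = \<zero>\<^bsub>C'\<^esub>} = (\<lambda>x. u (f x)) ` carrier A"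
  proof (intro equalityI subsetI)
    fix x assume "x \<in> {x \<in> carrier G'. w (g (u' x)) = \<zero>\<^bsub>C'\<^esub>}"
    then have x: "x \<in> carrier G'" "w (g (u' x)) = \<zero>\<^bsub>C'\<^esub>" by auto
    have "g (u' x) = \<zero>\<^bsub>C\<^esub>"
      using w(3)[OF gc[OF u(6)[OF x(1)]]] x(2) lin_zero[OF fg_left[OF C'(1)] fg_left[OF C] w(2)] by simp
    then have "u' x \<in> f ` carrier A" using exact u(6)[OF x(1)] by blast
    then obtain a where "a \<in> carrier A" "u' x = f a" by blast
    then show "x \<in> (\<lambda>x. u (f x)) ` carrier A" using u(4)[OF x(1)] by (intro image_eqI[of _ _ a]) simp_all
  next
    fix x assume "x \<in> (\<lambda>x. u (f x)) ` carrier A"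
    then obtain a where a: "a \<in> carrier A" "x = u (f a)" by blast
    have "g (f a) = \<zero>\<^bsub>C\<^esub>" using exact a(1) by blast
    then show "x \<in> {x \<in> carrier G'. w (g (u' x)) = \<zero>\<^bsub>C'\<^esub>}"
      using a fc[OF a(1)] u(3,5) lin_zero[OF fg_left[OF C] fg_left[OF C'(1)] w(1)] by simp
  qed
  \<comment> \<open>\<open>G\<close> and \<open>C\<close> are retracts of \<open>M\<close>, and
    \<open>M\<close> is a retract of a power of \<open>T\<close>: here it matters that no
    isomorphism class of summands was lost in passing to the basic part.\<close>
  have rG: "retract A G ?M"
    unfolding retract_def
    using lin_pair[OF lin_id lin_const_zero[OF lC]] lin_fst
    by (intro exI[of _ "\<lambda>x. (x, \<zero>\<^bsub>C\<^esub>)"] exI[of _ fst]) auto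
  have GT: "G' \<in> add_cl A T"
    by (rule add_cl_retract[OF G'(1) T(1) retract_trans[OF iso_pair_retract[OF iso_pair_sym[OF G'(2)]]
          retract_trans[OF rG T(4)]]])
  have rC: "retract A C ?M"
    unfolding retract_def
    using lin_pair[OF lin_const_zero[OF lG] lin_id] lin_snd
    by (intro exI[of _ "\<lambda>x. (\<zero>\<^bsub>G\<^esub>, x)"] exI[of _ snd]) auto
  have CT: "C' \<in> add_cl A T"
    by (rule add_cl_retract[OF C'(1) T(1) retract_trans[OF iso_pair_retract[OF iso_pair_sym[OF C'(2)]]
          retract_trans[OF rC T(4)]]])
  have se: "short_exact A ?L (restrict (\<lambda>x. u (f x)) (carrier ?L)) G'
      (restrict (\<lambda>x. w (g (u' x))) (carrier G')) C'"
    unfolding short_exact_def mono_hom_def epi_hom_def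
  proof (intro conjI lin_mod_hom[OF lL f'] lin_mod_hom[OF fg_left[OF G'(1)] g'])
    show "inj_on (restrict (\<lambda>x. u (f x)) (carrier ?L)) (carrier ?L)" using fi by (simp add: inj_on_def)
    show "restrict (\<lambda>x. u (f x)) (carrier ?L) ` carrier ?L
        = mod_ker G' C' (restrict (\<lambda>x. w (g (u' x))) (carrier G'))"
      using ex' by (auto simp: mod_ker_def)
    show "restrict (\<lambda>x. w (g (u' x))) (carrier G') ` carrier G' = carrier C'"
      using gs linD(1)[OF g'] by (auto simp: image_iff)
  qed
  have tilt: "tilting_module A T"
    unfolding tilting_module_def using T(1,2) pd ext GT CT se by blast
  note lQ = left_module_Q_tilde[OF R]
  obtain m where m: "retract A ?N (dpower (Q_tilde A) m)"
    by (rule retract_Q_tilde[OF N dec[OF projective_fg[OF N(1)]]])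
  have Gen: "T \<in> Gen A (Q_tilde A)" by (rule Gen_retract[OF T(1) lN lQ m p ps])
  note GI = projective_dsum2[OF G(1) I(1)] injective_dsum2[OF G(2) I(2)]
  obtain m' where m': "retract A (dsum2 G I) (dpower (Q_tilde A) m')"
    by (rule retract_Q_tilde[OF GI dec[OF projective_fg[OF GI(1)]]])
  \<comment> \<open>\<open>T\<close> sits in \<open>G \<oplus> C\<close> through \<open>i\<close>,
    and \<open>C\<close> sits in \<open>I\<close> through \<open>h\<close>.\<close>
  have "lin A T (dsum2 G I) (\<lambda>x. (fst (i x), h (snd (i x))))"
    by (rule lin_comp[OF i lin_pair[OF lin_fst lin_comp[OF lin_snd h(1)]]])
  moreover have "inj_on (\<lambda>x. (fst (i x), h (snd (i x)))) (carrier T)"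
  proof (rule inj_onI)
    fix x y assume xy: "x \<in> carrier T" "y \<in> carrier T" "(fst (i x), h (snd (i x))) = (fst (i y), h (snd (i y)))"
    have "snd (i x) \<in> carrier C" "snd (i y) \<in> carrier C"
      using linD(1)[OF i xy(1)] linD(1)[OF i xy(2)] by (auto simp: mem_Times_iff)
    then have "i x = i y" using xy(3) h(2) by (simp add: inj_on_eq_iff prod_eq_iff)
    then show "x = y" using ri xy(1,2) by metis
  qed
  ultimately have "T \<in> Cogen A (Q_tilde A)" by (rule Cogen_retract[OF T(1) m'])
  then show ?thesis using tilt Gen unfolding C_cat_def by blast
qed

section \<open>Artinian modules and restriction of scalars\<close>

lemma artinian_moduleD:
  assumes "artinian_module A M" "\<And>n. submodule (H n) A M" "\<And>n. H (Suc n) \<subseteq> H n"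
  shows "\<exists>N. \<forall>n\<ge>N. H n = H N"
  using assms unfolding artinian_module_def by blast

text \<open>Chains are pushed forward, and an injective map reflects equality of images.\<close>

lemma artinian_module_inj:
  assumes M: "left_module A M" and N: "left_module A N" and f: "lin A M N f" "inj_on f (carrier M)"
    and art: "artinian_module A N"
  shows "artinian_module A M"
  unfolding artinian_module_def
proof (intro allI impI)
  fix H assume H: "\<forall>n. submodule (H n) A M \<and> H (Suc n) \<subseteq> H n"
  have sH: "submodule (H n) A M" for n using H by blast
  obtain m where m: "\<forall>n\<ge>m. f ` H n = f ` H m"
    using artinian_moduleD[OF art, of "\<lambda>n. f ` H n"] submodule_image[OF M N f(1) sH] H by blast
  have "H n \<subseteq> carrier M" for n using submoduleD(1)[OF sH] by blast
  then have "H n = H m" if "f ` H n = f ` H m" for n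
    using that f(2) inj_on_image_eq_iff by metis
  then show "\<exists>m. \<forall>n\<ge>m. H n = H m" using m by blast
qed

text \<open>Chains are pulled back, and surjectivity recovers each member from its preimage.\<close>

lemma artinian_module_surj:
  assumes M: "left_module A M" and N: "left_module A N" and f: "lin A M N f"
    "\<And>y. y \<in> carrier N \<Longrightarrow> \<exists>x\<in>carrier M. f x = y"
    and art: "artinian_module A M"
  shows "artinian_module A N"
  unfolding artinian_module_def
proof (intro allI impI)
  fix H assume H: "\<forall>n. submodule (H n) A N \<and> H (Suc n) \<subseteq> H n"
  have sH: "submodule (H n) A N" for n using H by blast
  let ?V = "\<lambda>n. {x \<in> carrier M. f x \<in> H n}"
  obtain m where m: "\<forall>n\<ge>m. ?V n = ?V m"
    using artinian_moduleD[OF art, of ?V] submodule_vimage[OF M N f(1) sH] H by blast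
  have V: "f ` ?V n = H n" for n
  proof (intro equalityI subsetI)
    fix y assume "y \<in> H n"
    then show "y \<in> f ` ?V n" using f(2)[OF submoduleD(1)[OF sH]] by blast
  qed blast
  show "\<exists>m. \<forall>n\<ge>m. H n = H m"
  proof (intro exI[of _ m] allI impI)
    fix n assume "m \<le> n"
    then have "?V n = ?V m" using m by blast
    then have "f ` ?V n = f ` ?V m" by (rule arg_cong)
    then show "H n = H m" unfolding V .
  qed
qed

text \<open>A chain is controlled by its intersections with the first factor and its projections to
  the second. Once both are stationary, an element of a larger member shares its second coordinate
  with one of a smaller member, and their difference lies in the common intersection with the first
  factor.\<close>

lemma artinian_module_dsum2:
  assumes M: "left_module A M" "artinian_module A M" and N: "left_module A N" "artinian_module A N"
  shows "artinian_module A (dsum2 M N)"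
  unfolding artinian_module_def
proof (intro allI impI)
  interpret M: left_module A M by fact
  interpret N: left_module A N by fact
  note lD = left_module_dsum2[OF M(1) N(1)]
  interpret D: left_module A "dsum2 M N" by fact
  fix H assume H: "\<forall>n. submodule (H n) A (dsum2 M N) \<and> H (Suc n) \<subseteq> H n"
  have sH: "submodule (H n) A (dsum2 M N)" for n using H by blast
  have anti: "H n \<subseteq> H m" if "m \<le> n" for m n
    by (rule lift_Suc_antimono_le[of H, OF _ that]) (rule H[rule_format, THEN conjunct2])
  let ?K = "\<lambda>n. {x \<in> carrier M. (x, \<zero>\<^bsub>N\<^esub>) \<in> H n}" and ?I = "\<lambda>n. snd ` H n"
  have "submodule (?K n) A M" for n
    by (rule submodule_vimage[OF M(1) lD lin_pair[OF lin_id lin_const_zero[OF N(1)]] sH])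
  moreover have "?K (Suc n) \<subseteq> ?K n" for n using H by blast
  ultimately obtain m where m: "\<And>n. m \<le> n \<Longrightarrow> ?K n = ?K m"
    using artinian_moduleD[OF M(2), of ?K] by blast
  have "submodule (?I n) A N" for n by (rule submodule_image[OF lD N(1) lin_snd sH])
  moreover have "?I (Suc n) \<subseteq> ?I n" for n using H by blast
  ultimately obtain m' where m': "\<And>n. m' \<le> n \<Longrightarrow> ?I n = ?I m'"
    using artinian_moduleD[OF N(2), of ?I] by blast
  let ?m = "max m m'"
  have "H n = H ?m" if n: "?m \<le> n" for n
  proof (intro equalityI anti[OF n] subsetI)
    fix z assume z: "z \<in> H ?m"
    have n': "m \<le> n" "m' \<le> n" "m \<le> ?m" "m' \<le> ?m" using n by auto
    have "?I n = ?I ?m" by (rule trans[OF m'[OF n'(2)] m'[OF n'(4), symmetric]])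
    then have "snd z \<in> ?I n" using z by blast
    then obtain w where w: "w \<in> H n" "snd w = snd z" by (metis imageE)
    have wm: "w \<in> H ?m" using w(1) anti[OF n] by blast
    obtain x y x' where xy: "z = (x, y)" "w = (x', y)" using w(2) by (metis prod.collapse)
    have c: "x \<in> carrier M" "x' \<in> carrier M" "y \<in> carrier N"
      using submoduleD(1)[OF sH z] submoduleD(1)[OF sH wm] xy by auto
    have neg: "\<ominus>\<^bsub>dsum2 M N\<^esub> w = (\<ominus>\<^bsub>M\<^esub> x', \<ominus>\<^bsub>N\<^esub> y)"
      by (rule D.M.minus_equality) (use c xy(2) in \<open>auto simp: M.M.l_neg N.M.l_neg\<close>)
    have "z \<oplus>\<^bsub>dsum2 M N\<^esub> \<ominus>\<^bsub>dsum2 M N\<^esub> w \<in> H ?m"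
      by (intro submoduleD(3)[OF sH] submoduleD(5)[OF sH] z wm)
    then have "(x \<oplus>\<^bsub>M\<^esub> \<ominus>\<^bsub>M\<^esub> x', \<zero>\<^bsub>N\<^esub>) \<in> H ?m" unfolding neg xy(1) using c by (simp add: N.M.r_neg)
    then have "x \<oplus>\<^bsub>M\<^esub> \<ominus>\<^bsub>M\<^esub> x' \<in> ?K ?m" using c by simp
    moreover have "?K n = ?K ?m" by (rule trans[OF m[OF n'(1)] m[OF n'(3), symmetric]])
    ultimately have "x \<oplus>\<^bsub>M\<^esub> \<ominus>\<^bsub>M\<^esub> x' \<in> ?K n" by simp
    then have "(x \<oplus>\<^bsub>M\<^esub> \<ominus>\<^bsub>M\<^esub> x', \<zero>\<^bsub>N\<^esub>) \<oplus>\<^bsub>dsum2 M N\<^esub> w \<in> H n" using submoduleD(3)[OF sH _ w(1)] by blast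
    then show "z \<in> H n" using xy c by (simp add: M.M.a_assoc M.M.l_neg)
  qed
  then show "\<exists>m. \<forall>n\<ge>m. H n = H m" by blast
qed

lemma artinian_module_subsingleton:
  assumes "carrier M = {\<zero>\<^bsub>M\<^esub>}"
  shows "artinian_module A M"
  unfolding artinian_module_def
proof (intro allI impI)
  fix H assume H: "\<forall>n. submodule (H n) A M \<and> H (Suc n) \<subseteq> H n"
  have "H n = {\<zero>\<^bsub>M\<^esub>}" for n
    using submoduleD(1,2)[of "H n" A M] H assms by blast
  then show "\<exists>m. \<forall>n\<ge>m. H n = H m" by blast
qed

lemma artinian_module_dsum:
  assumes R: "ring A" and I: "finite I"
    and X: "\<And>i. i \<in> I \<Longrightarrow> left_module A (X i)" "\<And>i. i \<in> I \<Longrightarrow> artinian_module A (X i)"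
  shows "artinian_module A (dsum I X)"
  using I X
proof (induction I rule: finite_induct)
  case empty
  show ?case by (rule artinian_module_subsingleton) (auto simp: dsum_simps restrict_def)
next
  case (insert j I)
  have l: "left_module A (dsum I X)" "left_module A (X j)"
    using insert.prems(1) by (auto intro: left_module_dsum[OF R])
  obtain f where f: "lin A (dsum2 (dsum I X) (X j)) (dsum (insert j I) X) f"
    "\<And>y. y \<in> carrier (dsum (insert j I) X) \<Longrightarrow> \<exists>x\<in>carrier (dsum2 (dsum I X) (X j)). f x = y"
    by (rule dsum_insert_cover[of A I j X]) (use R insert in blast)+
  show ?case
    by (rule artinian_module_surj[OF left_module_dsum2[OF l] left_module_dsum[OF R insert.prems(1)] f])
      (use artinian_module_dsum2[OF l(1) _ l(2)] insert in auto)
qed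

section \<open>Restriction of scalars\<close>

definition res_scalars :: "('k \<Rightarrow> 'a) \<Rightarrow> ('a, 'b) module \<Rightarrow> ('k, 'b) module" where
  "res_scalars \<psi> M = \<lparr>carrier = carrier M, monoid.mult = monoid.mult M, one = \<one>\<^bsub>M\<^esub>,
     zero = \<zero>\<^bsub>M\<^esub>, add = add M, smult = (\<lambda>c x. \<psi> c \<odot>\<^bsub>M\<^esub> x)\<rparr>"

lemma res_scalars_simps [simp]:
  "carrier (res_scalars \<psi> M) = carrier M" "\<zero>\<^bsub>res_scalars \<psi> M\<^esub> = \<zero>\<^bsub>M\<^esub>"
  "x \<oplus>\<^bsub>res_scalars \<psi> M\<^esub> y = x \<oplus>\<^bsub>M\<^esub> y" "c \<odot>\<^bsub>res_scalars \<psi> M\<^esub> x = \<psi> c \<odot>\<^bsub>M\<^esub> x"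
  by (simp_all add: res_scalars_def)

lemma res_scalars_id: "res_scalars (\<lambda>c. c) M = M"
  by (cases M) (simp add: res_scalars_def)

lemma scalar_module_res: "scalar_module \<phi> A = res_scalars \<phi> (regular_module A)"
  by (simp add: res_scalars_def regular_module_def scalar_module_def)

lemma left_module_res_scalars:
  assumes k: "ring k" and \<psi>: "\<psi> \<in> ring_hom k S" and M: "left_module S M"
  shows "left_module k (res_scalars \<psi> M)"
proof -
  let ?M = "res_scalars \<psi> M"
  interpret M: left_module S M by fact
  note c = ring_hom_closed[OF \<psi>]
  show ?thesis
  proof (rule left_moduleI[OF k])
    fix x assume "x \<in> carrier ?M"
    then show "\<exists>y\<in>carrier ?M. y \<oplus>\<^bsub>?M\<^esub> x = \<zero>\<^bsub>?M\<^esub>"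
      by (intro bexI[of _ "\<ominus>\<^bsub>M\<^esub> x"]) (auto simp: M.M.l_neg)
  qed (use c in \<open>auto simp: M.M.a_ac M.smult_l_distr M.smult_r_distr M.smult_assoc1
      ring_hom_add[OF \<psi>] ring_hom_mult[OF \<psi>] ring_hom_one[OF \<psi>]\<close>)
qed

lemma lin_res_scalars:
  assumes "\<psi> \<in> ring_hom k S" "lin S M N f"
  shows "lin k (res_scalars \<psi> M) (res_scalars \<psi> N) f"
  using linD[OF assms(2)] ring_hom_closed[OF assms(1)] by (auto intro!: linI)

text \<open>Every submodule over \<open>S\<close> is one over \<open>k\<close>, so chains over
  \<open>S\<close> are chains over \<open>k\<close>.\<close>

lemma artinian_res_scalars:
  assumes k: "ring k" and \<psi>: "\<psi> \<in> ring_hom k S" and M: "left_module S M"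
    and art: "artinian_module k (res_scalars \<psi> M)"
  shows "artinian_module S M"
  unfolding artinian_module_def
proof (intro allI impI)
  interpret K: left_module k "res_scalars \<psi> M" by (rule left_module_res_scalars[OF k \<psi> M])
  fix H assume H: "\<forall>n. submodule (H n) S M \<and> H (Suc n) \<subseteq> H n"
  then have sH: "submodule (H n) S M" for n by blast
  have "submodule (H n) k (res_scalars \<psi> M)" for n
    by (rule K.submoduleI') (use submoduleD[OF sH] ring_hom_closed[OF \<psi>] in auto)
  then show "\<exists>m. \<forall>n\<ge>m. H n = H m" using artinian_moduleD[OF art] H by blast
qed

text \<open>The module is built up one generator at a time, each adding an image of
  \<open>S\<close>. The homomorphism from \<open>k\<close> to \<open>S\<close> is arbitrary because
  the result serves three times: for \<open>A\<close> over \<open>k\<close>, for \<open>E\<close>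
  over \<open>A\<close>, and for modules over \<open>B\<close>.\<close>

lemma artinian_fg_module:
  assumes k: "ring k" and S: "ring S" and \<psi>: "\<psi> \<in> ring_hom k S"
    and art: "artinian_module k (res_scalars \<psi> (regular_module S))" and M: "fg_module S M"
  shows "artinian_module k (res_scalars \<psi> M)"
proof -
  note lM = fg_left[OF M] and lS = left_module_regular[OF S]
  interpret M: left_module S M by fact
  note res = left_module_res_scalars[OF k \<psi>]
  let ?S = "res_scalars \<psi> (regular_module S)"
  from M obtain X where X: "finite X" "X \<subseteq> carrier M"
    "\<And>H. \<lbrakk>submodule H S M; X \<subseteq> H\<rbrakk> \<Longrightarrow> H = carrier M"
    by (rule fg_generators) blast
  \<comment> \<open>Asking only for some artinian submodule around the generators avoids forming
    their span; the generating property turns it into \<open>M\<close> at the end.\<close>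
  have "\<exists>H. submodule H S M \<and> X \<subseteq> H \<and> artinian_module k (res_scalars \<psi> (submod M H))"
    using X(1,2)
  proof (induction X rule: finite_induct)
    case empty
    have "artinian_module k (res_scalars \<psi> (submod M {\<zero>\<^bsub>M\<^esub>}))"
      by (rule artinian_module_subsingleton) simp
    then show ?case using M.submodule_zero by blast
  next
    case (insert s X)
    then obtain H where H: "submodule H S M" "X \<subseteq> H" "artinian_module k (res_scalars \<psi> (submod M H))"
      by auto
    have s: "s \<in> carrier M" using insert by simp
    note lH = left_module_submod[OF lM H(1)]
    let ?D = "dsum2 (submod M H) (regular_module S)" and ?f = "\<lambda>p. fst p \<oplus>\<^bsub>M\<^esub> snd p \<odot>\<^bsub>M\<^esub> s"
    note lD = left_module_dsum2[OF lH lS]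
    have f: "lin S ?D M ?f" by (rule lin_copair[OF lM lin_incl[OF H(1)] lin_regular[OF lM s]])
    have I: "submodule (?f ` carrier ?D) S M"
      by (rule submodule_image[OF lD lM f left_module.submodule_carrier[OF lD]])
    have fI: "lin S ?D (submod M (?f ` carrier ?D)) ?f" by (rule lin_submod_cod[OF f]) blast
    have l: "lin k (dsum2 (res_scalars \<psi> (submod M H)) ?S)
        (res_scalars \<psi> (submod M (?f ` carrier ?D))) ?f"
      by (rule lin_comp[OF _ lin_res_scalars[OF \<psi> fI]]) (auto intro!: linI)
    have "artinian_module k (res_scalars \<psi> (submod M (?f ` carrier ?D)))"
    proof (rule artinian_module_surj[OF left_module_dsum2[OF res[OF lH] res[OF lS]]
          res[OF left_module_submod[OF lM I]] l _ artinian_module_dsum2[OF res[OF lH] H(3) res[OF lS] art]])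
      fix y assume "y \<in> carrier (res_scalars \<psi> (submod M (?f ` carrier ?D)))"
      then show "\<exists>x\<in>carrier (dsum2 (res_scalars \<psi> (submod M H)) ?S). ?f x = y"
        unfolding res_scalars_simps submod_simps dsum2_simps by blast
    qed
    moreover have "X \<subseteq> ?f ` carrier ?D"
    proof
      fix x assume "x \<in> X"
      then have x: "x \<in> H" "x \<in> carrier M" using H(2) submoduleD(1)[OF H(1)] by blast+
      then show "x \<in> ?f ` carrier ?D"
        using s by (intro image_eqI[of _ _ "(x, \<zero>\<^bsub>S\<^esub>)"]) auto
    qed
    moreover have "s \<in> ?f ` carrier ?D"
      using s submoduleD(2)[OF H(1)] by (intro image_eqI[of _ _ "(\<zero>\<^bsub>M\<^esub>, \<one>\<^bsub>S\<^esub>)"]) auto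
    ultimately show ?case using I by blast
  qed
  then obtain H where H: "submodule H S M" "X \<subseteq> H" "artinian_module k (res_scalars \<psi> (submod M H))"
    by blast
  have "H = carrier M" by (rule X(3)[OF H(1,2)])
  then have "submod M H = M" by (simp add: submod_def)
  then show ?thesis using H(3) by simp
qed

text \<open>Over a commutative ring the submodules of the regular module are two-sided ideals, so
  the chain condition on ideals applies.\<close>

lemma artinian_cring_regular:
  assumes "artinian_cring k"
  shows "artinian_module k (regular_module k)"
  unfolding artinian_module_def
proof (intro allI impI)
  interpret cring k using assms by (simp add: artinian_cring_def)
  interpret M: left_module k "regular_module k" by (rule left_module_regular[OF ring_axioms])
  fix H assume H: "\<forall>n. submodule (H n) k (regular_module k) \<and> H (Suc n) \<subseteq> H n"
  then have sH: "submodule (H n) k (regular_module k)" for n by blast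
  have "ideal (H n) k" for n
  proof (rule idealI[OF ring_axioms])
    have "\<ominus>\<^bsub>k\<^esub> x \<in> H n" if "x \<in> H n" for x
    proof -
      have x: "x \<in> carrier k" using submoduleD(1)[OF sH that] by simp
      have "\<ominus>\<^bsub>regular_module k\<^esub> x = \<ominus>\<^bsub>k\<^esub> x" by (rule M.M.minus_equality) (use x in \<open>auto simp: l_neg\<close>)
      then show ?thesis using submoduleD(5)[OF sH that] by simp
    qed
    then show "subgroup (H n) (add_monoid k)"
      using submoduleD[OF sH] by (intro subgroup.intro) (auto simp: a_inv_def)
    fix a x assume "a \<in> H n" "x \<in> carrier k"
    then show "x \<otimes>\<^bsub>k\<^esub> a \<in> H n" "a \<otimes>\<^bsub>k\<^esub> x \<in> H n"
      using submoduleD(4)[OF sH, of x a] submoduleD(1)[OF sH, of a] by (auto simp: m_comm)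
  qed
  then show "\<exists>m. \<forall>n\<ge>m. H n = H m" using H assms unfolding artinian_cring_def by blast
qed

section \<open>Modules over the triangular matrix algebra\<close>

text \<open>In the first entry of the product, \<open>r\<close> is applied before \<open>r'\<close>:
  this is composition in the opposite ring, matching the right action on \<open>E\<close>.\<close>

lemma ext_simps:
  "carrier (ext_algebra A E) = mod_hom A E E \<times> carrier E \<times> carrier A"
  "\<zero>\<^bsub>ext_algebra A E\<^esub> = (zero_hom E E, \<zero>\<^bsub>E\<^esub>, \<zero>\<^bsub>A\<^esub>)"
  "\<one>\<^bsub>ext_algebra A E\<^esub> = (\<lambda>x\<in>carrier E. x, \<zero>\<^bsub>E\<^esub>, \<one>\<^bsub>A\<^esub>)"
  "(r, e, a) \<oplus>\<^bsub>ext_algebra A E\<^esub> (r', e', a') =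
     (\<lambda>x\<in>carrier E. r x \<oplus>\<^bsub>E\<^esub> r' x, e \<oplus>\<^bsub>E\<^esub> e', a \<oplus>\<^bsub>A\<^esub> a')"
  "(r, e, a) \<otimes>\<^bsub>ext_algebra A E\<^esub> (r', e', a') =
     (compose (carrier E) r' r, r' e \<oplus>\<^bsub>E\<^esub> a \<odot>\<^bsub>E\<^esub> e', a \<otimes>\<^bsub>A\<^esub> a')"
  by (simp_all add: ext_algebra_def tri_matrix_ring_def op_ring_def End_ring_def)

text \<open>A non-unital embedding of \<open>A\<close> into the matrix algebra: the unit goes to the
  idempotent \<open>e2\<close>.\<close>

definition corner_mat :: "('a, 'e) module \<Rightarrow> 'a \<Rightarrow> ('e \<Rightarrow> 'e) \<times> 'e \<times> 'a" where
  "corner_mat E a = (zero_hom E E, \<zero>\<^bsub>E\<^esub>, a)"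

text \<open>Together with \<open>corner_mat\<close> this spans the second row \<open>e2 B\<close>,
  which carries all the information that passes between a module and its corner.\<close>

definition lower_mat :: "('a, 'm) ring_scheme \<Rightarrow> ('a, 'e) module \<Rightarrow> 'e \<Rightarrow> ('e \<Rightarrow> 'e) \<times> 'e \<times> 'a" where
  "lower_mat A E e = (zero_hom E E, e, \<zero>\<^bsub>A\<^esub>)"

text \<open>This is \<open>e2 X\<close> as a module over \<open>e2 B e2 = A\<close>, described by
  the fixed points of the idempotent so that membership is an equation.\<close>

definition corner_module ::
    "('a, 'm) ring_scheme \<Rightarrow> ('a, 'e) module \<Rightarrow> (('e \<Rightarrow> 'e) \<times> 'e \<times> 'a, 'b) module \<Rightarrow> ('a, 'b) module" where
  "corner_module A E X = \<lparr>carrier = {x \<in> carrier X. corner_mat E \<one>\<^bsub>A\<^esub> \<odot>\<^bsub>X\<^esub> x = x},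
     monoid.mult = undefined, one = undefined, zero = \<zero>\<^bsub>X\<^esub>, add = add X,
     smult = (\<lambda>a x. corner_mat E a \<odot>\<^bsub>X\<^esub> x)\<rparr>"

lemma corner_simps [simp]:
  "carrier (corner_module A E X) = {x \<in> carrier X. corner_mat E \<one>\<^bsub>A\<^esub> \<odot>\<^bsub>X\<^esub> x = x}"
  "\<zero>\<^bsub>corner_module A E X\<^esub> = \<zero>\<^bsub>X\<^esub>" "x \<oplus>\<^bsub>corner_module A E X\<^esub> y = x \<oplus>\<^bsub>X\<^esub> y"
  "a \<odot>\<^bsub>corner_module A E X\<^esub> x = corner_mat E a \<odot>\<^bsub>X\<^esub> x"
  by (simp_all add: corner_module_def)

abbreviation lower_right :: "'r \<times> 'e \<times> 'a \<Rightarrow> 'a" where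
  "lower_right b \<equiv> snd (snd b)"

definition inflation :: "('a, 'b) module \<Rightarrow> ('r \<times> 'e \<times> 'a, 'b) module" where
  "inflation M = res_scalars lower_right M"

lemma inflation_simps [simp]:
  "carrier (inflation M) = carrier M" "\<zero>\<^bsub>inflation M\<^esub> = \<zero>\<^bsub>M\<^esub>"
  "x \<oplus>\<^bsub>inflation M\<^esub> y = x \<oplus>\<^bsub>M\<^esub> y" "b \<odot>\<^bsub>inflation M\<^esub> x = lower_right b \<odot>\<^bsub>M\<^esub> x"
  by (simp_all add: inflation_def)

section \<open>Matrix calculus, corners and inflation\<close>

locale ext_setup =
  fixes A :: "('a, 'm) ring_scheme" and E :: "('a, 'e) module"
  assumes fgE: "fg_module A E"
begin

sublocale E: left_module A E by (rule fg_left[OF fgE])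

abbreviation B where "B \<equiv> ext_algebra A E"
abbreviation em where "em \<equiv> corner_mat E"
abbreviation lw where "lw \<equiv> lower_mat A E"
abbreviation e2 where "e2 \<equiv> em \<one>\<^bsub>A\<^esub>"
abbreviation Cor where "Cor \<equiv> corner_module A E"

lemma ring_B: "ring B" by (rule ring_ext_algebra[OF E.left_module_axioms])

lemma zero_hom_in: "zero_hom E E \<in> mod_hom A E E"
  using lin_mod_hom[OF E.left_module_axioms lin_const_zero[OF E.left_module_axioms]] by (simp add: zero_hom_def)

lemma end_zero: "r \<in> mod_hom A E E \<Longrightarrow> r \<zero>\<^bsub>E\<^esub> = \<zero>\<^bsub>E\<^esub>"
  using lin_zero[OF E.left_module_axioms E.left_module_axioms mod_hom_lin] .

lemma end_closed: "\<lbrakk>r \<in> mod_hom A E E; x \<in> carrier E\<rbrakk> \<Longrightarrow> r x \<in> carrier E"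
  by (rule mod_homD(2))

lemma compose_zero:
  "r \<in> mod_hom A E E \<Longrightarrow> compose (carrier E) (zero_hom E E) r = zero_hom E E"
  "r \<in> mod_hom A E E \<Longrightarrow> compose (carrier E) r (zero_hom E E) = zero_hom E E"
  using end_closed end_zero by (auto simp: compose_def zero_hom_def fun_eq_iff)

lemma zero_hom_apply: "x \<in> carrier E \<Longrightarrow> zero_hom E E x = \<zero>\<^bsub>E\<^esub>"
  by (simp add: zero_hom_def)

lemma mat_closed:
  "a \<in> carrier A \<Longrightarrow> em a \<in> carrier B" "e \<in> carrier E \<Longrightarrow> lw e \<in> carrier B"
  by (simp_all add: corner_mat_def lower_mat_def ext_simps zero_hom_in)

text \<open>The first identity makes \<open>B e2\<close> the inflation of the regular
  \<open>A\<close>-module. The third shows how the upper left entry acts on \<open>E\<close> from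
  the right.\<close>

lemma mat_mult:
  "\<lbrakk>r \<in> mod_hom A E E; e \<in> carrier E; a \<in> carrier A; c \<in> carrier A\<rbrakk> \<Longrightarrow> (r, e, a) \<otimes>\<^bsub>B\<^esub> em c = em (a \<otimes>\<^bsub>A\<^esub> c)"
  "\<lbrakk>r \<in> mod_hom A E E; e \<in> carrier E; a \<in> carrier A; c \<in> carrier A\<rbrakk> \<Longrightarrow>
    em c \<otimes>\<^bsub>B\<^esub> (r, e, a) = (zero_hom E E, c \<odot>\<^bsub>E\<^esub> e, c \<otimes>\<^bsub>A\<^esub> a)"
  "\<lbrakk>r \<in> mod_hom A E E; e \<in> carrier E; a \<in> carrier A; x \<in> carrier E\<rbrakk> \<Longrightarrow> lw x \<otimes>\<^bsub>B\<^esub> (r, e, a) = lw (r x)"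
  "\<lbrakk>a \<in> carrier A; c \<in> carrier A\<rbrakk> \<Longrightarrow> em a \<otimes>\<^bsub>B\<^esub> em c = em (a \<otimes>\<^bsub>A\<^esub> c)"
  "\<lbrakk>a \<in> carrier A; e \<in> carrier E\<rbrakk> \<Longrightarrow> em a \<otimes>\<^bsub>B\<^esub> lw e = lw (a \<odot>\<^bsub>E\<^esub> e)"
  by (simp_all add: corner_mat_def lower_mat_def ext_simps zero_hom_in compose_zero end_zero end_closed zero_hom_apply)

lemma mat_add:
  "\<lbrakk>a \<in> carrier A; c \<in> carrier A\<rbrakk> \<Longrightarrow> em a \<oplus>\<^bsub>B\<^esub> em c = em (a \<oplus>\<^bsub>A\<^esub> c)"
  "\<lbrakk>e \<in> carrier E; e' \<in> carrier E\<rbrakk> \<Longrightarrow> lw e \<oplus>\<^bsub>B\<^esub> lw e' = lw (e \<oplus>\<^bsub>E\<^esub> e')"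
  "\<lbrakk>e \<in> carrier E; a \<in> carrier A\<rbrakk> \<Longrightarrow> lw e \<oplus>\<^bsub>B\<^esub> em a = (zero_hom E E, e, a)"
  by (simp_all add: corner_mat_def lower_mat_def ext_simps zero_hom_def cong: restrict_cong)

lemma lower_right_hom: "lower_right \<in> ring_hom B A"
  by (rule ring_hom_memI) (auto simp: ext_simps)

lemma left_module_inflation: "left_module A M \<Longrightarrow> left_module B (inflation M)"
  unfolding inflation_def by (rule left_module_res_scalars[OF ring_B lower_right_hom])

lemma lin_inflation: "lin A M N f \<Longrightarrow> lin B (inflation M) (inflation N) f"
  unfolding inflation_def by (rule lin_res_scalars[OF lower_right_hom])

text \<open>Multiplication by \<open>a\<close> is multiplication by \<open>em a\<close>, so a
  \<open>B\<close>-submodule of the inflation is an \<open>A\<close>-submodule and the same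
  generators work.\<close>

lemma fg_inflation:
  assumes "fg_module A M"
  shows "fg_module B (inflation M)"
proof -
  interpret M: left_module A M by (rule fg_left[OF assms])
  interpret I: left_module B "inflation M" by (rule left_module_inflation[OF M.left_module_axioms])
  from assms obtain S where S: "finite S" "S \<subseteq> carrier M"
    "\<And>H. \<lbrakk>submodule H A M; S \<subseteq> H\<rbrakk> \<Longrightarrow> H = carrier M"
    by (rule fg_generators) blast
  show ?thesis unfolding fg_module_def
  proof (intro conjI I.left_module_axioms exI[of _ S] allI impI)
    fix H assume "submodule H B (inflation M) \<and> S \<subseteq> H"
    then have H: "submodule H B (inflation M)" and SH: "S \<subseteq> H" by auto
    have "submodule H A M"
    proof (rule M.submoduleI')
      fix a x assume "a \<in> carrier A" "x \<in> H"
      then show "a \<odot>\<^bsub>M\<^esub> x \<in> H"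
        using submoduleD(4)[OF H mat_closed(1)] by (simp add: corner_mat_def)
    qed (use submoduleD(1,2,3)[OF H] in auto)
    from S(3)[OF this SH] show "H = carrier (inflation M)" by simp
  qed (use S in auto)
qed

lemma corner_smult_closed:
  assumes X: "left_module B X" and "b \<in> carrier B" "x \<in> carrier X" "e2 \<otimes>\<^bsub>B\<^esub> b = b"
  shows "b \<odot>\<^bsub>X\<^esub> x \<in> carrier (Cor X)"
proof -
  interpret X: left_module B X by fact
  show ?thesis using assms(2-4) mat_closed(1)[OF E.R.one_closed] by (simp flip: X.smult_assoc1)
qed

lemma em_closed:
  assumes "left_module B X" "a \<in> carrier A" "x \<in> carrier X"
  shows "em a \<odot>\<^bsub>X\<^esub> x \<in> carrier (Cor X)"
  by (rule corner_smult_closed[OF assms(1) mat_closed(1)[OF assms(2)] assms(3)])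
    (use mat_mult(4) assms(2) in simp)

lemma lw_closed:
  assumes "left_module B X" "e \<in> carrier E" "x \<in> carrier X"
  shows "lw e \<odot>\<^bsub>X\<^esub> x \<in> carrier (Cor X)"
  by (rule corner_smult_closed[OF assms(1) mat_closed(2)[OF assms(2)] assms(3)])
    (use mat_mult(5) assms(2) in simp)

lemma left_module_corner:
  assumes X: "left_module B X"
  shows "left_module A (Cor X)"
proof -
  let ?C = "Cor X"
  interpret X: left_module B X by fact
  note m = mat_closed(1)
  show ?thesis
  proof (rule left_moduleI[OF E.R.ring_axioms])
    fix x y assume "x \<in> carrier ?C" "y \<in> carrier ?C"
    then show "x \<oplus>\<^bsub>?C\<^esub> y \<in> carrier ?C"
      by (simp add: X.smult_r_distr m)
  next
    fix x assume x: "x \<in> carrier ?C"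
    then show "\<exists>y\<in>carrier ?C. y \<oplus>\<^bsub>?C\<^esub> x = \<zero>\<^bsub>?C\<^esub>"
      by (intro bexI[of _ "\<ominus>\<^bsub>X\<^esub> x"]) (auto simp: X.M.l_neg X.smult_neg m)
    show "\<one>\<^bsub>A\<^esub> \<odot>\<^bsub>?C\<^esub> x = x" using x by simp
  next
    fix a x assume "a \<in> carrier A" "x \<in> carrier ?C"
    then show "a \<odot>\<^bsub>?C\<^esub> x \<in> carrier ?C"
      using em_closed[OF X] by simp
  next
    fix a b x assume abx: "a \<in> carrier A" "b \<in> carrier A" "x \<in> carrier ?C"
    then have x: "x \<in> carrier X" by simp
    show "(a \<oplus>\<^bsub>A\<^esub> b) \<odot>\<^bsub>?C\<^esub> x
        = a \<odot>\<^bsub>?C\<^esub> x \<oplus>\<^bsub>?C\<^esub> b \<odot>\<^bsub>?C\<^esub> x"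
      using X.smult_l_distr[OF m[OF abx(1)] m[OF abx(2)] x] mat_add(1)[OF abx(1,2)] by simp
    show "(a \<otimes>\<^bsub>A\<^esub> b) \<odot>\<^bsub>?C\<^esub> x
        = a \<odot>\<^bsub>?C\<^esub> (b \<odot>\<^bsub>?C\<^esub> x)"
      using X.smult_assoc1[OF m[OF abx(1)] m[OF abx(2)] x] mat_mult(4)[OF abx(1,2)] by simp
  qed (auto simp: X.M.a_ac X.smult_r_distr m)
qed

lemma lin_corner:
  assumes "lin B X Y f"
  shows "lin A (Cor X) (Cor Y) f"
proof (rule linI)
  note f = linD[OF assms]
  fix x assume "x \<in> carrier (Cor X)"
  then show "f x \<in> carrier (Cor Y)"
    using f(1) f(3)[OF mat_closed(1)[OF E.R.one_closed], of x] by simp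
next
  note f = linD[OF assms]
  fix x y assume "x \<in> carrier (Cor X)" "y \<in> carrier (Cor X)"
  then show "f (x \<oplus>\<^bsub>Cor X\<^esub> y) = f x \<oplus>\<^bsub>Cor Y\<^esub> f y" using f(2) by simp
next
  note f = linD[OF assms]
  fix a x assume "a \<in> carrier A" "x \<in> carrier (Cor X)"
  then show "f (a \<odot>\<^bsub>Cor X\<^esub> x) = a \<odot>\<^bsub>Cor Y\<^esub> f x"
    using f(3) mat_closed(1) by simp
qed

text \<open>Maps of this shape are what the condition \<open>Hom (E, Q) = 0\<close> kills, and what
  recovers the endomorphism entry in the first column.\<close>

lemma lin_lw:
  assumes X: "left_module B X" and x: "x \<in> carrier X"
  shows "lin A E (Cor X) (\<lambda>e. lw e \<odot>\<^bsub>X\<^esub> x)"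
proof -
  interpret X: left_module B X by fact
  show ?thesis
  proof (rule linI)
    fix e e' assume e: "e \<in> carrier E" "e' \<in> carrier E"
    show "lw (e \<oplus>\<^bsub>E\<^esub> e') \<odot>\<^bsub>X\<^esub> x = lw e \<odot>\<^bsub>X\<^esub> x \<oplus>\<^bsub>Cor X\<^esub> lw e' \<odot>\<^bsub>X\<^esub> x"
      using X.smult_l_distr[OF mat_closed(2)[OF e(1)] mat_closed(2)[OF e(2)] x] mat_add(2)[OF e] by simp
  next
    fix a e assume e: "a \<in> carrier A" "e \<in> carrier E"
    show "lw (a \<odot>\<^bsub>E\<^esub> e) \<odot>\<^bsub>X\<^esub> x = a \<odot>\<^bsub>Cor X\<^esub> (lw e \<odot>\<^bsub>X\<^esub> x)"
      using X.smult_assoc1[OF mat_closed(1)[OF e(1)] mat_closed(2)[OF e(2)] x] mat_mult(5)[OF e] by simp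
  qed (rule lw_closed[OF X _ x])
qed

text \<open>The second row of \<open>(r, e, a)\<close> is \<open>lw e \<oplus> em a\<close>, so the
  corner component of a product involves only \<open>e\<close> and \<open>a\<close>; the entry
  \<open>r\<close> is felt only through its action on \<open>E\<close>.\<close>

lemma corner_smult:
  assumes X: "left_module B X" and b: "r \<in> mod_hom A E E" "e \<in> carrier E" "a \<in> carrier A" and x: "x \<in> carrier X"
  shows "e2 \<odot>\<^bsub>X\<^esub> ((r, e, a) \<odot>\<^bsub>X\<^esub> x) = lw e \<odot>\<^bsub>X\<^esub> x \<oplus>\<^bsub>X\<^esub> em a \<odot>\<^bsub>X\<^esub> (e2 \<odot>\<^bsub>X\<^esub> x)"
    and "y \<in> carrier E \<Longrightarrow> lw y \<odot>\<^bsub>X\<^esub> ((r, e, a) \<odot>\<^bsub>X\<^esub> x) = lw (r y) \<odot>\<^bsub>X\<^esub> x"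
proof -
  interpret X: left_module B X by fact
  have bB: "(r, e, a) \<in> carrier B" using b by (simp add: ext_simps)
  note o = mat_closed(1)[OF E.R.one_closed] and m = mat_closed(1)[OF b(3)] mat_closed(2)[OF b(2)]
  have "e2 \<odot>\<^bsub>X\<^esub> ((r, e, a) \<odot>\<^bsub>X\<^esub> x) = (lw e \<oplus>\<^bsub>B\<^esub> em a) \<odot>\<^bsub>X\<^esub> x"
    using X.smult_assoc1[OF o bB x] mat_mult(2)[OF b E.R.one_closed] mat_add(3)[OF b(2,3)] b by simp
  also have "\<dots> = lw e \<odot>\<^bsub>X\<^esub> x \<oplus>\<^bsub>X\<^esub> em a \<odot>\<^bsub>X\<^esub> x" by (rule X.smult_l_distr[OF m(2,1) x])
  also have "em a \<odot>\<^bsub>X\<^esub> x = em a \<odot>\<^bsub>X\<^esub> (e2 \<odot>\<^bsub>X\<^esub> x)"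
    using X.smult_assoc1[OF m(1) o x] mat_mult(4)[OF b(3) E.R.one_closed] b(3) by simp
  finally show "e2 \<odot>\<^bsub>X\<^esub> ((r, e, a) \<odot>\<^bsub>X\<^esub> x)
    = lw e \<odot>\<^bsub>X\<^esub> x \<oplus>\<^bsub>X\<^esub> em a \<odot>\<^bsub>X\<^esub> (e2 \<odot>\<^bsub>X\<^esub> x)" .
  show "lw y \<odot>\<^bsub>X\<^esub> ((r, e, a) \<odot>\<^bsub>X\<^esub> x) = lw (r y) \<odot>\<^bsub>X\<^esub> x" if y: "y \<in> carrier E"
    using X.smult_assoc1[OF mat_closed(2)[OF y] bB x] mat_mult(3)[OF b y] by simp
qed

text \<open>Since \<open>e2 B\<close> is \<open>lw E + em A\<close>, the corner is generated over
  \<open>A\<close> by the multiples of \<open>S\<close> by \<open>e2\<close> and by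
  \<open>lw E\<close>. Finite generation of \<open>E\<close> cuts the latter down to multiples by
  \<open>lw J\<close>.\<close>

lemma fg_corner:
  assumes "fg_module B X"
  shows "fg_module A (Cor X)"
proof -
  note lX = fg_left[OF assms]
  let ?C = "Cor X"
  interpret X: left_module B X by fact
  note lC = left_module_corner[OF lX]
  interpret C: left_module A ?C by fact
  from assms obtain S where S: "finite S" "S \<subseteq> carrier X"
    "\<And>H. \<lbrakk>submodule H B X; S \<subseteq> H\<rbrakk> \<Longrightarrow> H = carrier X"
    by (rule fg_generators) blast
  from fgE obtain J where J: "finite J" "J \<subseteq> carrier E"
    "\<And>H. \<lbrakk>submodule H A E; J \<subseteq> H\<rbrakk> \<Longrightarrow> H = carrier E"
    by (rule fg_generators) blast
  let ?T = "(\<lambda>x. e2 \<odot>\<^bsub>X\<^esub> x) ` S \<union> (\<lambda>(e, x). lw e \<odot>\<^bsub>X\<^esub> x) ` (J \<times> S)"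
  show ?thesis unfolding fg_module_def
  proof (intro conjI lC exI[of _ ?T] allI impI)
    show "finite ?T" using S(1) J(1) by simp
    show "?T \<subseteq> carrier ?C"
    proof (intro Un_least image_subsetI)
      fix x assume "x \<in> S"
      then show "e2 \<odot>\<^bsub>X\<^esub> x \<in> carrier ?C" using S(2) by (intro em_closed[OF lX E.R.one_closed]) blast
    next
      fix p assume "p \<in> J \<times> S"
      then obtain e x where "p = (e, x)" "e \<in> carrier E" "x \<in> carrier X" using S(2) J(2) by blast
      then show "(case p of (e, x) \<Rightarrow> lw e \<odot>\<^bsub>X\<^esub> x) \<in> carrier ?C" using lw_closed[OF lX] by simp
    qed
    fix H assume "submodule H A ?C \<and> ?T \<subseteq> H"
    then have H: "submodule H A ?C" and TH: "?T \<subseteq> H" by auto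
    \<comment> \<open>\<open>?K\<close> collects the elements whose multiples by the second row fall
      into \<open>H\<close>. It is a \<open>B\<close>-submodule containing \<open>S\<close>, hence
      everything, and on the corner \<open>e2\<close> is the identity.\<close>
    let ?K = "{x \<in> carrier X. e2 \<odot>\<^bsub>X\<^esub> x \<in> H \<and> (\<forall>e\<in>carrier E. lw e \<odot>\<^bsub>X\<^esub> x \<in> H)}"
    have "submodule ?K B X"
    proof (rule X.submoduleI')
      show "\<zero>\<^bsub>X\<^esub> \<in> ?K" using submoduleD(2)[OF H] mat_closed by simp
      fix x y assume "x \<in> ?K" "y \<in> ?K"
      then show "x \<oplus>\<^bsub>X\<^esub> y \<in> ?K"
        using submoduleD(3)[OF H] mat_closed by (simp add: X.smult_r_distr)
    next
      fix b x assume bx: "b \<in> carrier B" "x \<in> ?K"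
      then obtain r e a where b: "b = (r, e, a)" "r \<in> mod_hom A E E" "e \<in> carrier E" "a \<in> carrier A"
        by (auto simp: ext_simps)
      have x: "x \<in> carrier X" "e2 \<odot>\<^bsub>X\<^esub> x \<in> H" "\<And>e. e \<in> carrier E \<Longrightarrow> lw e \<odot>\<^bsub>X\<^esub> x \<in> H"
        using bx(2) by auto
      have "e2 \<odot>\<^bsub>X\<^esub> (b \<odot>\<^bsub>X\<^esub> x) \<in> H"
        unfolding b(1) corner_smult(1)[OF lX b(2-4) x(1)]
        using submoduleD(3)[OF H x(3)[OF b(3)]] submoduleD(4)[OF H b(4) x(2)] by simp
      moreover have "lw y \<odot>\<^bsub>X\<^esub> (b \<odot>\<^bsub>X\<^esub> x) \<in> H" if "y \<in> carrier E" for y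
        unfolding b(1) corner_smult(2)[OF lX b(2-4) x(1) that] by (rule x(3)[OF end_closed[OF b(2) that]])
      ultimately show "b \<odot>\<^bsub>X\<^esub> x \<in> ?K" using bx(1) x(1) by simp
    qed blast
    moreover have "S \<subseteq> ?K"
    proof
      fix x assume x: "x \<in> S"
      then have xX: "x \<in> carrier X" using S(2) by blast
      have "{e \<in> carrier E. lw e \<odot>\<^bsub>X\<^esub> x \<in> H} = carrier E"
        by (rule J(3)[OF submodule_vimage[OF E.left_module_axioms lC lin_lw[OF lX xX] H]])
          (use J(2) TH x in blast)
      then show "x \<in> ?K" using TH x xX by blast
    qed
    ultimately have K: "?K = carrier X" by (rule S(3))
    have "x \<in> H" if "x \<in> carrier ?C" for x
    proof -
      have "x \<in> ?K" "e2 \<odot>\<^bsub>X\<^esub> x = x" using that unfolding K by auto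
      then show ?thesis by simp
    qed
    then show "H = carrier ?C" using submoduleD(1)[OF H] by blast
  qed
qed

text \<open>\<open>e2\<close> acts as the identity on an inflation, so the image lies in the corner.
  With \<open>lin_inflation_of_corner\<close> this is the adjunction between inflation and
  corner.\<close>

lemma lin_corner_of_inflation:
  assumes P: "left_module A P" and g: "lin B (inflation P) Y g"
  shows "lin A P (Cor Y) g"
proof -
  interpret P: left_module A P by fact
  note g' = linD[OF g]
  have e: "em a \<odot>\<^bsub>Y\<^esub> g x = g (a \<odot>\<^bsub>P\<^esub> x)" if "a \<in> carrier A" "x \<in> carrier P" for a x
    using g'(3)[OF mat_closed(1)[OF that(1)], of x] that(2) by (simp add: corner_mat_def)
  show ?thesis by (rule linI) (use g'(1,2) e in auto)
qed

text \<open>Because \<open>b e2 = em a\<close>, a matrix acts on corner elements through its lower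
  right entry alone.\<close>

lemma lin_inflation_of_corner:
  assumes X: "left_module B X" and h: "lin A P (Cor X) h"
  shows "lin B (inflation P) X h"
proof -
  interpret X: left_module B X by fact
  note h' = linD[OF h]
  show ?thesis
  proof (rule linI)
    fix b x assume bx: "b \<in> carrier B" "x \<in> carrier (inflation P)"
    then obtain r e a where b: "b = (r, e, a)" "r \<in> mod_hom A E E" "e \<in> carrier E" "a \<in> carrier A"
      by (auto simp: ext_simps)
    have x: "h x \<in> carrier X" "e2 \<odot>\<^bsub>X\<^esub> h x = h x" using h'(1) bx(2) by auto
    have "b \<odot>\<^bsub>X\<^esub> (e2 \<odot>\<^bsub>X\<^esub> h x) = em a \<odot>\<^bsub>X\<^esub> h x"
      using X.smult_assoc1[OF bx(1) mat_closed(1)[OF E.R.one_closed] x(1)]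
        mat_mult(1)[OF b(2-4) E.R.one_closed] b(1,4) by simp
    then have "b \<odot>\<^bsub>X\<^esub> h x = em a \<odot>\<^bsub>X\<^esub> h x" unfolding x(2) .
    then show "h (b \<odot>\<^bsub>inflation P\<^esub> x) = b \<odot>\<^bsub>X\<^esub> h x" using h'(3)[OF b(4), of x] bx(2) b(1) by simp
  qed (use h'(1,2) in auto)
qed

text \<open>By adjunction the lifting problem moves to the corners. Surjectivity survives there: a
  preimage \<open>x\<close> of a corner element may be replaced by its \<open>e2\<close>
  multiple.\<close>

lemma projective_inflation:
  assumes "projective_module A P"
  shows "projective_module B (inflation P)"
proof (rule projectiveI[OF fg_inflation[OF projective_fg[OF assms]]])
  fix X Y :: "(('e \<Rightarrow> 'e) \<times> 'e \<times> 'a) umod" and f g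
  assume a: "fg_module B X" "fg_module B Y" "lin B X Y f"
    "\<And>y. y \<in> carrier Y \<Longrightarrow> \<exists>x\<in>carrier X. f x = y" "lin B (inflation P) Y g"
  note lX = fg_left[OF a(1)] and lP = fg_left[OF projective_fg[OF assms]]
  have s: "\<exists>x\<in>carrier (Cor X). f x = y" if "y \<in> carrier (Cor Y)" for y
  proof -
    have y: "y \<in> carrier Y" "e2 \<odot>\<^bsub>Y\<^esub> y = y" using that by auto
    obtain x where x: "x \<in> carrier X" "f x = y" using a(4)[OF y(1)] by blast
    have "f (e2 \<odot>\<^bsub>X\<^esub> x) = y"
      using linD(3)[OF a(3) mat_closed(1)[OF E.R.one_closed] x(1)] x(2) y(2) by simp
    then show ?thesis using em_closed[OF lX E.R.one_closed x(1)] by blast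
  qed
  obtain h where h: "lin A P (Cor X) h" "\<And>p. p \<in> carrier P \<Longrightarrow> f (h p) = g p"
    using projective_lift[OF assms fg_corner[OF a(1)] fg_corner[OF a(2)] lin_corner[OF a(3)] s
        lin_corner_of_inflation[OF lP a(5)]] by blast
  then show "\<exists>h. lin B (inflation P) X h \<and> (\<forall>p\<in>carrier (inflation P). f (h p) = g p)"
    using lin_inflation_of_corner[OF lX h(1)] h(2) by (intro exI[of _ h]) simp
qed

text \<open>A map into an inflation sees only the corner, so extend it there by injectivity of
  \<open>Q\<close> and precompose with \<open>e2\<close>. The one term obstructing
  \<open>B\<close>-linearity, \<open>e\<close> mapped to \<open>h (lw e y)\<close>, is a linear map
  from \<open>E\<close> to \<open>Q\<close> and therefore zero.\<close>

lemma injective_inflation: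
  assumes Q: "injective_module A Q" and hom: "mod_hom A E Q = {zero_hom E Q}"
  shows "injective_module B (inflation Q)"
proof (rule injectiveI[OF fg_inflation[OF injective_fg[OF Q]]])
  note lQ = fg_left[OF injective_fg[OF Q]]
  interpret Q: left_module A Q by fact
  have zero: "f e = \<zero>\<^bsub>Q\<^esub>" if f: "lin A E Q f" and e: "e \<in> carrier E" for f e
  proof -
    have "restrict f (carrier E) = zero_hom E Q" using lin_mod_hom[OF E.left_module_axioms f] hom by blast
    from fun_cong[OF this, of e] show ?thesis using e by (simp add: zero_hom_def)
  qed
  fix X Y :: "(('e \<Rightarrow> 'e) \<times> 'e \<times> 'a) umod" and f g
  assume a: "fg_module B X" "fg_module B Y" "lin B X Y f" "inj_on f (carrier X)" "lin B X (inflation Q) g"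
  note lX = fg_left[OF a(1)] and lY = fg_left[OF a(2)]
  interpret Y: left_module B Y by fact
  have fi: "inj_on f (carrier (Cor X))" using a(4) by (rule inj_on_subset) auto
  have g': "lin A (Cor X) Q g"
  proof (rule linI)
    fix c x assume "c \<in> carrier A" "x \<in> carrier (Cor X)"
    then show "g (c \<odot>\<^bsub>Cor X\<^esub> x) = c \<odot>\<^bsub>Q\<^esub> g x"
      using linD(3)[OF a(5) mat_closed(1)] by (simp add: corner_mat_def)
  qed (use linD(1,2)[OF a(5)] in auto)
  obtain h where h: "lin A (Cor Y) Q h"
    "\<And>x. x \<in> carrier (Cor X) \<Longrightarrow> h (f x) = g x"
    using injective_extend[OF Q fg_corner[OF a(1)] fg_corner[OF a(2)] lin_corner[OF a(3)] fi g'] by blast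
  note o = E.R.one_closed mat_closed(1)[OF E.R.one_closed]
  have H: "lin B Y (inflation Q) (\<lambda>y. h (e2 \<odot>\<^bsub>Y\<^esub> y))"
  proof (rule linI)
    fix y assume "y \<in> carrier Y"
    then show "h (e2 \<odot>\<^bsub>Y\<^esub> y) \<in> carrier (inflation Q)"
      using linD(1)[OF h(1) em_closed[OF lY o(1)]] by simp
  next
    fix x y assume xy: "x \<in> carrier Y" "y \<in> carrier Y"
    then show "h (e2 \<odot>\<^bsub>Y\<^esub> (x \<oplus>\<^bsub>Y\<^esub> y))
        = h (e2 \<odot>\<^bsub>Y\<^esub> x) \<oplus>\<^bsub>inflation Q\<^esub> h (e2 \<odot>\<^bsub>Y\<^esub> y)"
      using linD(2)[OF h(1) em_closed[OF lY o(1) xy(1)] em_closed[OF lY o(1) xy(2)]]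
      by (simp add: Y.smult_r_distr o(2))
  next
    fix b y assume by': "b \<in> carrier B" "y \<in> carrier Y"
    then obtain r e c where b: "b = (r, e, c)" "r \<in> mod_hom A E E" "e \<in> carrier E" "c \<in> carrier A"
      by (auto simp: ext_simps)
    let ?y = "e2 \<odot>\<^bsub>Y\<^esub> y"
    have y: "?y \<in> carrier (Cor Y)" by (rule em_closed[OF lY o(1) by'(2)])
    then have cy: "em c \<odot>\<^bsub>Y\<^esub> ?y \<in> carrier (Cor Y)"
      using em_closed[OF lY b(4), of ?y] by simp
    have "h (e2 \<odot>\<^bsub>Y\<^esub> (b \<odot>\<^bsub>Y\<^esub> y)) = h (lw e \<odot>\<^bsub>Y\<^esub> y) \<oplus>\<^bsub>Q\<^esub> h (em c \<odot>\<^bsub>Y\<^esub> ?y)"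
      unfolding b(1) corner_smult(1)[OF lY b(2-4) by'(2)]
      using linD(2)[OF h(1) lw_closed[OF lY b(3) by'(2)] cy] by simp
    also have "h (lw e \<odot>\<^bsub>Y\<^esub> y) = \<zero>\<^bsub>Q\<^esub>"
      by (rule zero[OF lin_comp[OF lin_lw[OF lY by'(2)] h(1)] b(3)])
    also have "h (em c \<odot>\<^bsub>Y\<^esub> ?y) = c \<odot>\<^bsub>Q\<^esub> h ?y" using linD(3)[OF h(1) b(4) y] by simp
    finally show "h (e2 \<odot>\<^bsub>Y\<^esub> (b \<odot>\<^bsub>Y\<^esub> y)) = b \<odot>\<^bsub>inflation Q\<^esub> h ?y"
      using linD(1)[OF h(1) y] b(1,4) by simp
  qed
  have "h (e2 \<odot>\<^bsub>Y\<^esub> f x) = g x" if x: "x \<in> carrier X" for x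
  proof -
    have "h (e2 \<odot>\<^bsub>Y\<^esub> f x) = g (e2 \<odot>\<^bsub>X\<^esub> x)"
      using linD(3)[OF a(3) o(2) x] h(2)[OF em_closed[OF lX o(1) x]] by simp
    also have "\<dots> = g x"
      using linD(3)[OF a(5) o(2) x] linD(1)[OF a(5) x] by (simp add: corner_mat_def)
    finally show ?thesis .
  qed
  then show "\<exists>h. lin B Y (inflation Q) h \<and> (\<forall>x\<in>carrier X. h (f x) = g x)" using H by blast
qed

text \<open>The upper right entry of every matrix is zero, so matrices with zero lower right entry
  form exactly the first column; as a kernel it is visibly a submodule.\<close>

definition column :: "(('e \<Rightarrow> 'e) \<times> 'e \<times> 'a, ('e \<Rightarrow> 'e) \<times> 'e \<times> 'a) module" where
  "column = submod (regular_module B) {b \<in> carrier B. lower_right b = \<zero>\<^bsub>A\<^esub>}"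

lemma lin_lower_right: "lin B (regular_module B) (inflation (regular_module A)) lower_right"
  by (rule linI) (auto simp: ext_simps)

lemma submodule_column:
  "submodule {b \<in> carrier B. lower_right b = \<zero>\<^bsub>A\<^esub>} B (regular_module B)"
  using submodule_kernel[OF left_module_regular[OF ring_B]
        left_module_inflation[OF left_module_regular[OF E.R.ring_axioms]] lin_lower_right] by simp

lemma left_module_column: "left_module B column"
  unfolding column_def by (rule left_module_submod[OF left_module_regular[OF ring_B] submodule_column])

lemma column_iff: "b \<in> carrier column \<longleftrightarrow> (\<exists>r\<in>mod_hom A E E. \<exists>e\<in>carrier E. b = (r, e, \<zero>\<^bsub>A\<^esub>))"
  by (auto simp: column_def ext_simps)

lemma column_ops:
  "x \<oplus>\<^bsub>column\<^esub> y = x \<oplus>\<^bsub>B\<^esub> y" "b \<odot>\<^bsub>column\<^esub> x = b \<otimes>\<^bsub>B\<^esub> x"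
  by (simp_all add: column_def)

lemma lin_column_proj: "lin B (regular_module B) column (\<lambda>(r, e, a). (r, e, \<zero>\<^bsub>A\<^esub>))"
proof (rule linI)
  fix x assume "x \<in> carrier (regular_module B)"
  then show "(case x of (r, e, a) \<Rightarrow> (r, e, \<zero>\<^bsub>A\<^esub>)) \<in> carrier column"
    by (auto simp: column_iff ext_simps)
qed (auto simp: column_ops ext_simps)

lemma projective_column: "projective_module B column"
proof (rule projective_retract[OF projective_regular[OF ring_B] left_module_column])
  have "lin B column (regular_module B) (\<lambda>x. x)"
    unfolding column_def by (rule lin_incl[OF submodule_column])
  moreover have "(case x of (r, e, a) \<Rightarrow> (r, e, \<zero>\<^bsub>A\<^esub>)) = x" if "x \<in> carrier column" for x
    using that by (auto simp: column_iff)
  ultimately show "retract B column (regular_module B)"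
    unfolding retract_def using lin_column_proj by blast
qed

text \<open>The column is \<open>Hom_A (e2 B, E)\<close>: the pair \<open>(r, e)\<close> is the map
  given by \<open>r\<close> on the summand \<open>E\<close> and sending the unit of the summand
  \<open>A\<close> to \<open>e\<close>. Maps from \<open>X\<close> into the column thus correspond
  to \<open>A\<close>-linear maps from the corner of \<open>X\<close> to \<open>E\<close>, and these
  extend.\<close>

lemma injective_column:
  assumes "injective_module A E"
  shows "injective_module B column"
proof (rule injectiveI[OF projective_fg[OF projective_column]])
  fix X Y :: "(('e \<Rightarrow> 'e) \<times> 'e \<times> 'a) umod" and f g
  assume a: "fg_module B X" "fg_module B Y" "lin B X Y f" "inj_on f (carrier X)" "lin B X column g"
  note lX = fg_left[OF a(1)] and lY = fg_left[OF a(2)]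
  interpret X: left_module B X by fact
  interpret Y: left_module B Y by fact
  note o = E.R.one_closed mat_closed(1)[OF E.R.one_closed]
  have fi: "inj_on f (carrier (Cor X))" using a(4) by (rule inj_on_subset) auto
  let ?g = "\<lambda>x. fst (snd (g x))"
  have gc: "\<exists>r\<in>mod_hom A E E. \<exists>e\<in>carrier E. g x = (r, e, \<zero>\<^bsub>A\<^esub>)" if "x \<in> carrier X" for x
    using linD(1)[OF a(5) that] unfolding column_iff .
  have gem: "?g (em c \<odot>\<^bsub>X\<^esub> x) = c \<odot>\<^bsub>E\<^esub> ?g x" if "c \<in> carrier A" "x \<in> carrier X" for c x
    using linD(3)[OF a(5) mat_closed(1)[OF that(1)] that(2)] gc[OF that(2)] that(1)
    by (auto simp: column_ops mat_mult(2))
  \<comment> \<open>The endomorphism entry of \<open>g x\<close> can be read off from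
    \<open>?g\<close> on the elements \<open>lw e x\<close>, so \<open>?g\<close> determines all of
    \<open>g\<close>.\<close>
  have glw: "?g (lw e \<odot>\<^bsub>X\<^esub> x) = fst (g x) e" if e: "e \<in> carrier E" and x: "x \<in> carrier X" for e x
  proof -
    obtain r e' where re: "r \<in> mod_hom A E E" "e' \<in> carrier E" "g x = (r, e', \<zero>\<^bsub>A\<^esub>)"
      using gc[OF x] by blast
    have "g (lw e \<odot>\<^bsub>X\<^esub> x) = lw (r e)"
      using linD(3)[OF a(5) mat_closed(2)[OF e] x] mat_mult(3)[OF re(1,2) _ e] re(3)
      by (simp add: column_ops)
    then show ?thesis using re(3) by (simp add: lower_mat_def)
  qed
  have g': "lin A (Cor X) E ?g"
  proof (rule linI)
    fix x y assume "x \<in> carrier (Cor X)" "y \<in> carrier (Cor X)"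
    then have xy: "x \<in> carrier X" "y \<in> carrier X" by auto
    show "?g (x \<oplus>\<^bsub>Cor X\<^esub> y) = ?g x \<oplus>\<^bsub>E\<^esub> ?g y"
      using linD(2)[OF a(5) xy] gc[OF xy(1)] gc[OF xy(2)] by (auto simp: column_ops ext_simps)
  next
    fix x assume "x \<in> carrier (Cor X)"
    then show "?g x \<in> carrier E" using gc[of x] by auto
  next
    fix c x assume "c \<in> carrier A" "x \<in> carrier (Cor X)"
    then show "?g (c \<odot>\<^bsub>Cor X\<^esub> x) = c \<odot>\<^bsub>E\<^esub> ?g x" using gem by simp
  qed
  obtain h where h: "lin A (Cor Y) E h"
    "\<And>x. x \<in> carrier (Cor X) \<Longrightarrow> h (f x) = ?g x"
    using injective_extend[OF assms fg_corner[OF a(1)] fg_corner[OF a(2)] lin_corner[OF a(3)] fi g'] by blast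
  \<comment> \<open>The endomorphism entry of the extension is rebuilt from \<open>h\<close> by the
    same formula that recovers the one of \<open>g\<close> from \<open>?g\<close>.\<close>
  define \<rho> where "\<rho> y = (\<lambda>e\<in>carrier E. h (lw e \<odot>\<^bsub>Y\<^esub> y))" for y
  have \<rho>: "\<rho> y \<in> mod_hom A E E" if "y \<in> carrier Y" for y
    unfolding \<rho>_def by (rule lin_mod_hom[OF E.left_module_axioms lin_comp[OF lin_lw[OF lY that] h(1)]])
  let ?e = "\<lambda>y. e2 \<odot>\<^bsub>Y\<^esub> y"
  have ye: "?e y \<in> carrier (Cor Y)" if "y \<in> carrier Y" for y
    by (rule em_closed[OF lY o(1) that])
  have H: "lin B Y column (\<lambda>y. (\<rho> y, h (?e y), \<zero>\<^bsub>A\<^esub>))"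
  proof (rule linI)
    fix y assume "y \<in> carrier Y"
    then show "(\<rho> y, h (?e y), \<zero>\<^bsub>A\<^esub>) \<in> carrier column"
      using linD(1)[OF h(1) ye] \<rho> by (simp add: column_iff)
  next
    fix x y assume xy: "x \<in> carrier Y" "y \<in> carrier Y"
    have "\<rho> (x \<oplus>\<^bsub>Y\<^esub> y) = (\<lambda>e\<in>carrier E. \<rho> x e \<oplus>\<^bsub>E\<^esub> \<rho> y e)"
      unfolding \<rho>_def
    proof (rule restrict_ext)
      fix e assume e: "e \<in> carrier E"
      show "h (lw e \<odot>\<^bsub>Y\<^esub> (x \<oplus>\<^bsub>Y\<^esub> y)) = (\<lambda>e\<in>carrier E. h (lw e \<odot>\<^bsub>Y\<^esub> x)) e \<oplus>\<^bsub>E\<^esub> (\<lambda>e\<in>carrier E. h (lw e \<odot>\<^bsub>Y\<^esub> y)) e"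
        using linD(2)[OF h(1) lw_closed[OF lY e xy(1)] lw_closed[OF lY e xy(2)]] e xy
        by (simp add: Y.smult_r_distr mat_closed(2))
    qed
    moreover have "h (?e (x \<oplus>\<^bsub>Y\<^esub> y)) = h (?e x) \<oplus>\<^bsub>E\<^esub> h (?e y)"
      using linD(2)[OF h(1) ye[OF xy(1)] ye[OF xy(2)]] xy by (simp add: Y.smult_r_distr o(2))
    ultimately show "(\<rho> (x \<oplus>\<^bsub>Y\<^esub> y), h (?e (x \<oplus>\<^bsub>Y\<^esub> y)), \<zero>\<^bsub>A\<^esub>)
        = (\<rho> x, h (?e x), \<zero>\<^bsub>A\<^esub>) \<oplus>\<^bsub>column\<^esub> (\<rho> y, h (?e y), \<zero>\<^bsub>A\<^esub>)"
      by (simp add: column_ops ext_simps)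
  next
    fix b y assume by': "b \<in> carrier B" "y \<in> carrier Y"
    then obtain r e c where b: "b = (r, e, c)" "r \<in> mod_hom A E E" "e \<in> carrier E" "c \<in> carrier A"
      by (auto simp: ext_simps)
    have cy: "em c \<odot>\<^bsub>Y\<^esub> ?e y \<in> carrier (Cor Y)"
      using em_closed[OF lY b(4), of "?e y"] ye[OF by'(2)] by simp
    have "h (?e (b \<odot>\<^bsub>Y\<^esub> y)) = h (lw e \<odot>\<^bsub>Y\<^esub> y) \<oplus>\<^bsub>E\<^esub> h (em c \<odot>\<^bsub>Y\<^esub> ?e y)"
      unfolding b(1) corner_smult(1)[OF lY b(2-4) by'(2)]
      using linD(2)[OF h(1) lw_closed[OF lY b(3) by'(2)] cy] by simp
    also have "h (em c \<odot>\<^bsub>Y\<^esub> ?e y) = c \<odot>\<^bsub>E\<^esub> h (?e y)" using linD(3)[OF h(1) b(4) ye[OF by'(2)]] by simp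
    finally have 1: "h (?e (b \<odot>\<^bsub>Y\<^esub> y)) = \<rho> y e \<oplus>\<^bsub>E\<^esub> c \<odot>\<^bsub>E\<^esub> h (?e y)" using b(3) by (simp add: \<rho>_def)
    have 2: "\<rho> (b \<odot>\<^bsub>Y\<^esub> y) = compose (carrier E) (\<rho> y) r"
      unfolding compose_def
      by (subst \<rho>_def, rule restrict_ext)
        (use corner_smult(2)[OF lY b(2-4) by'(2)] end_closed[OF b(2)] b(1) in \<open>simp add: \<rho>_def\<close>)
    show "(\<rho> (b \<odot>\<^bsub>Y\<^esub> y), h (?e (b \<odot>\<^bsub>Y\<^esub> y)), \<zero>\<^bsub>A\<^esub>) = b \<odot>\<^bsub>column\<^esub> (\<rho> y, h (?e y), \<zero>\<^bsub>A\<^esub>)"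
      unfolding 1 2 unfolding b(1) using b(4) by (simp add: column_ops ext_simps)
  qed
  have "(\<rho> (f x), h (?e (f x)), \<zero>\<^bsub>A\<^esub>) = g x" if x: "x \<in> carrier X" for x
  proof -
    obtain r e where re: "r \<in> mod_hom A E E" "e \<in> carrier E" "g x = (r, e, \<zero>\<^bsub>A\<^esub>)" using gc[OF x] by blast
    have "\<rho> (f x) = r"
    proof (rule extensionalityI[of _ "carrier E"])
      show "\<rho> (f x) \<in> extensional (carrier E)" by (simp add: \<rho>_def)
      show "r \<in> extensional (carrier E)" by (rule mod_homD(1)[OF re(1)])
      fix y assume y: "y \<in> carrier E"
      have "h (lw y \<odot>\<^bsub>Y\<^esub> f x) = ?g (lw y \<odot>\<^bsub>X\<^esub> x)"
        using linD(3)[OF a(3) mat_closed(2)[OF y] x] h(2)[OF lw_closed[OF lX y x]] by simp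
      then show "\<rho> (f x) y = r y" using y glw[OF y x] re(3) by (simp add: \<rho>_def)
    qed
    moreover have "h (?e (f x)) = e"
    proof -
      have "h (?e (f x)) = ?g (e2 \<odot>\<^bsub>X\<^esub> x)"
        using linD(3)[OF a(3) o(2) x] h(2)[OF em_closed[OF lX o(1) x]] by simp
      then show ?thesis using gem[OF o(1) x] re(2,3) by simp
    qed
    ultimately show ?thesis using re(3) by simp
  qed
  then show "\<exists>h. lin B Y column h \<and> (\<forall>x\<in>carrier X. h (f x) = g x)" using H by blast
qed

end

section \<open>Data from the dominant dimension\<close>

lemma inj_resolutionD:
  assumes "inj_resolution A M I d \<eta>"
  shows "injective_module A (I i)" "lin A (I i) (I (Suc i)) (d i)"
    "lin A M (I 0) \<eta>" "inj_on \<eta> (carrier M)" "\<eta> ` carrier M = mod_ker (I 0) (I 1) (d 0)"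
proof -
  note res = assms[unfolded inj_resolution_def mono_hom_def]
  show "injective_module A (I i)" by (rule res[THEN conjunct1, rule_format, THEN conjunct1])
  show "lin A (I i) (I (Suc i)) (d i)"
    by (rule mod_hom_lin[OF res[THEN conjunct1, rule_format, THEN conjunct2]])
  show "lin A M (I 0) \<eta>"
    by (rule mod_hom_lin[OF res[THEN conjunct2, THEN conjunct1, THEN conjunct1]])
  show "inj_on \<eta> (carrier M)" by (rule res[THEN conjunct2, THEN conjunct1, THEN conjunct2])
  show "\<eta> ` carrier M = mod_ker (I 0) (I 1) (d 0)"
    by (rule res[THEN conjunct2, THEN conjunct2, THEN conjunct1])
qed

lemma domdim_ge_2D:
  assumes "2 \<le> domdim A"
  obtains I d \<eta> where "inj_resolution A (regular_module A) I d \<eta>"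
    "projective_module A (I 0)" "projective_module A (I 1)"
proof -
  \<comment> \<open>An infinite supremum need not be attained, but a supremum above 1 always yields
    a member \<open>k\<close> above 1, which covers the indices 0 and 1.\<close>
  have "(1 :: enat) < 2" by (simp add: numeral_eq_enat one_enat_def)
  then have "1 < domdim A" using assms by (rule less_le_trans)
  then obtain k I d \<eta> where k: "(1 :: enat) < enat k" "min_inj_resolution A (regular_module A) I d \<eta>"
    "\<And>i. i < k \<Longrightarrow> projective_module A (I i)"
    unfolding domdim_def less_Sup_iff by blast
  have "1 < k" using k(1) by (simp add: one_enat_def)
  then show ?thesis
    using that[of I d \<eta>] k(2,3) unfolding min_inj_resolution_def by simp
qed

context ext_setup
begin

text \<open>An endomorphism of \<open>E\<close> is determined by its values on the generators
  \<open>J\<close>. So \<open>B\<close> embeds over \<open>k\<close> into the sum of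
  \<open>E^J\<close>, \<open>E\<close> and \<open>A\<close>, all of which are artinian over
  \<open>k\<close>, and the chain condition passes to finitely generated
  \<open>B\<close>-modules.\<close>

lemma artinian_B_module:
  assumes alg: "artin_algebra k \<phi> A" and M: "fg_module B M"
  shows "artinian_module B M"
proof -
  have ac: "artinian_cring k" and \<phi>: "\<phi> \<in> ring_hom k A"
    and central: "\<And>c a. c \<in> carrier k \<Longrightarrow> a \<in> carrier A \<Longrightarrow> \<phi> c \<otimes>\<^bsub>A\<^esub> a = a \<otimes>\<^bsub>A\<^esub> \<phi> c"
    and fgA: "fg_module k (scalar_module \<phi> A)"
    using alg unfolding artin_algebra_def by blast+
  interpret k: cring k using ac by (simp add: artinian_cring_def)
  note kr = k.ring_axioms and RA = E.R.ring_axioms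
  note \<phi>c = ring_hom_closed[OF \<phi>]
  \<comment> \<open>Taking \<open>k\<close> as its own ring of scalars treats \<open>A\<close> as a
    finitely generated \<open>k\<close>-module; \<open>E\<close> then follows with \<open>A\<close>
    as the ring.\<close>
  have "(\<lambda>c. c) \<in> ring_hom k k" by (rule ring_hom_memI) auto
  from artinian_fg_module[OF kr kr this _ fgA]
  have artA: "artinian_module k (res_scalars \<phi> (regular_module A))"
    using artinian_cring_regular[OF ac] by (simp add: res_scalars_id scalar_module_res)
  have artE: "artinian_module k (res_scalars \<phi> E)"
    by (rule artinian_fg_module[OF kr RA \<phi> artA fgE])
  \<comment> \<open>The structure map of \<open>B\<close> as a \<open>k\<close>-algebra. Its upper
    left entry is \<open>A\<close>-linear because \<open>\<phi> c\<close> is central.\<close>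
  define \<psi> where "\<psi> c = (\<lambda>x\<in>carrier E. \<phi> c \<odot>\<^bsub>E\<^esub> x, \<zero>\<^bsub>E\<^esub>, \<phi> c)" for c
  have scal: "(\<lambda>x\<in>carrier E. \<phi> c \<odot>\<^bsub>E\<^esub> x) \<in> mod_hom A E E" if c: "c \<in> carrier k" for c
    by (rule lin_mod_hom[OF E.left_module_axioms])
      (auto intro!: linI simp: c \<phi>c E.smult_r_distr central simp flip: E.smult_assoc1)
  have \<psi>: "\<psi> \<in> ring_hom k B"
  proof (rule ring_hom_memI)
    fix c assume "c \<in> carrier k"
    then show "\<psi> c \<in> carrier B" using scal \<phi>c by (simp add: \<psi>_def ext_simps)
  next
    fix c c' assume c: "c \<in> carrier k" "c' \<in> carrier k"
    show "\<psi> (c \<otimes>\<^bsub>k\<^esub> c') = \<psi> c \<otimes>\<^bsub>B\<^esub> \<psi> c'"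
      using c \<phi>c central[OF c(1) \<phi>c[OF c(2)]]
      by (auto simp: \<psi>_def ext_simps ring_hom_mult[OF \<phi>] compose_def E.smult_assoc1 intro!: restrict_ext)
    show "\<psi> (c \<oplus>\<^bsub>k\<^esub> c') = \<psi> c \<oplus>\<^bsub>B\<^esub> \<psi> c'"
      using c \<phi>c by (auto simp: \<psi>_def ext_simps ring_hom_add[OF \<phi>] E.smult_l_distr intro!: restrict_ext)
  next
    show "\<psi> \<one>\<^bsub>k\<^esub> = \<one>\<^bsub>B\<^esub>"
      by (auto simp: \<psi>_def ext_simps ring_hom_one[OF \<phi>] intro!: restrict_ext)
  qed
  from fgE obtain J where J: "finite J" "J \<subseteq> carrier E"
    "\<And>H. \<lbrakk>submodule H A E; J \<subseteq> H\<rbrakk> \<Longrightarrow> H = carrier E"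
    by (rule fg_generators) blast
  let ?Bk = "res_scalars \<psi> (regular_module B)"
  let ?Ak = "res_scalars \<phi> (regular_module A)" and ?Ek = "res_scalars \<phi> E"
  let ?J = "dsum J (\<lambda>_. ?Ek)"
  let ?D = "dsum2 ?J (dsum2 ?Ek ?Ak)"
  note lBk = left_module_res_scalars[OF kr \<psi> left_module_regular[OF ring_B]]
    and lAk = left_module_res_scalars[OF kr \<phi> left_module_regular[OF RA]]
    and lEk = left_module_res_scalars[OF kr \<phi> E.left_module_axioms]
  have lJ: "left_module k ?J" by (rule left_module_dsum[OF kr lEk])
  have artD: "artinian_module k ?D"
    by (intro artinian_module_dsum2 artinian_module_dsum kr J(1) lJ lEk lAk left_module_dsum2 artA artE)
  have act: "c \<odot>\<^bsub>?Bk\<^esub> (r, e, a) = (compose (carrier E) r (\<lambda>x\<in>carrier E. \<phi> c \<odot>\<^bsub>E\<^esub> x), \<phi> c \<odot>\<^bsub>E\<^esub> e, \<phi> c \<otimes>\<^bsub>A\<^esub> a)"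
    if "c \<in> carrier k" "r \<in> mod_hom A E E" "e \<in> carrier E" for c r e a
    using that end_zero[OF that(2)] \<phi>c by (simp add: \<psi>_def ext_simps)
  have l1: "lin k ?Bk ?Ek (\<lambda>b. fst b j)" if j: "j \<in> J" for j
  proof -
    have jE: "j \<in> carrier E" using J(2) j by blast
    show ?thesis
    proof (rule linI)
      fix c b assume c: "c \<in> carrier k" and "b \<in> carrier ?Bk"
      then obtain r e a where b: "b = (r, e, a)" "r \<in> mod_hom A E E" "e \<in> carrier E" by (auto simp: ext_simps)
      show "fst (c \<odot>\<^bsub>?Bk\<^esub> b) j = c \<odot>\<^bsub>?Ek\<^esub> fst b j"
        unfolding b(1) act[OF c b(2,3)] using jE mod_homD(4)[OF b(2) \<phi>c[OF c] jE] by (simp add: compose_def)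
    qed (use jE end_closed in \<open>auto simp: ext_simps\<close>)
  qed
  have l2: "lin k ?Bk ?Ek (\<lambda>b. fst (snd b))"
  proof (rule linI)
    fix c b assume c: "c \<in> carrier k" and "b \<in> carrier ?Bk"
    then obtain r e a where b: "b = (r, e, a)" "r \<in> mod_hom A E E" "e \<in> carrier E" by (auto simp: ext_simps)
    show "fst (snd (c \<odot>\<^bsub>?Bk\<^esub> b)) = c \<odot>\<^bsub>?Ek\<^esub> fst (snd b)" unfolding b(1) act[OF c b(2,3)] by simp
  qed (auto simp: ext_simps)
  have l3: "lin k ?Bk ?Ak lower_right"
  proof (rule linI)
    fix c b assume c: "c \<in> carrier k" and "b \<in> carrier ?Bk"
    then obtain r e a where b: "b = (r, e, a)" "r \<in> mod_hom A E E" "e \<in> carrier E" by (auto simp: ext_simps)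
    show "lower_right (c \<odot>\<^bsub>?Bk\<^esub> b) = c \<odot>\<^bsub>?Ak\<^esub> lower_right b" unfolding b(1) act[OF c b(2,3)] by simp
  qed (auto simp: ext_simps)
  let ?f = "\<lambda>b. (\<lambda>j\<in>J. fst b j, fst (snd b), lower_right b)"
  have f: "lin k ?Bk ?D ?f"
    by (intro lin_pair lin_dsum[OF J(1) l1 lBk] l2 l3)
  have "inj_on ?f (carrier ?Bk)"
  proof (rule lin_inj[OF lBk left_module_dsum2[OF lJ left_module_dsum2[OF lEk lAk]] f])
    fix b assume b: "b \<in> carrier ?Bk" "?f b = \<zero>\<^bsub>?D\<^esub>"
    obtain r e a where rea: "b = (r, e, a)" "r \<in> mod_hom A E E" using b(1) by (auto simp: ext_simps)
    have 0: "(\<lambda>j\<in>J. r j) = (\<lambda>j\<in>J. \<zero>\<^bsub>E\<^esub>)" "e = \<zero>\<^bsub>E\<^esub>" "a = \<zero>\<^bsub>A\<^esub>"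
      using b(2) rea(1) by (simp_all add: dsum_simps)
    have "r j = \<zero>\<^bsub>E\<^esub>" if "j \<in> J" for j using fun_cong[OF 0(1), of j] that by simp
    then have "{x \<in> carrier E. r x = \<zero>\<^bsub>E\<^esub>} = carrier E"
      using J(2) by (intro J(3) submodule_kernel[OF E.left_module_axioms E.left_module_axioms mod_hom_lin[OF rea(2)]]) blast
    then have "r = zero_hom E E"
      using mod_homD(1)[OF rea(2)] by (intro extensionalityI[of _ "carrier E"]) (auto simp: zero_hom_def)
    then show "b = \<zero>\<^bsub>?Bk\<^esub>" using rea(1) 0 by (simp add: ext_simps)
  qed
  then have "artinian_module k ?Bk"
    by (rule artinian_module_inj[OF lBk left_module_dsum2[OF lJ left_module_dsum2[OF lEk lAk]] f _ artD])
  then have "artinian_module k (res_scalars \<psi> M)"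
    by (rule artinian_fg_module[OF kr ring_B \<psi> _ M])
  then show ?thesis by (rule artinian_res_scalars[OF kr \<psi> fg_left[OF M]])
qed

end

theorem theorem3:
  fixes k :: "('k, 'l) ring_scheme" and \<phi> :: "'k \<Rightarrow> 'a"
    and A :: "('a, 'm) ring_scheme" and E :: "('a, 'e) module"
  assumes "auslander_algebra k \<phi> A"
    and "injective_module A E"
    and "semisimple_ring (End_ring A E)"
    and "\<forall>Q \<in> proj_inj_mods A. mod_hom A E Q = {zero_hom E Q}"
  shows "\<exists>T. tilting_module (ext_algebra A E) T \<and> T \<in> C_cat (ext_algebra A E)"
proof -
  have alg: "artin_algebra k \<phi> A" and dom: "2 \<le> domdim A"
    using assms(1) unfolding auslander_algebra_def by blast+
  interpret ext_setup A E by (rule ext_setup.intro[OF injective_fg[OF assms(2)]])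
  obtain I d \<eta> where res: "inj_resolution A (regular_module A) I d \<eta>"
    and proj: "projective_module A (I 0)" "projective_module A (I 1)"
    by (rule domdim_ge_2D[OF dom])
  note inj = inj_resolutionD(1)[OF res]
  \<comment> \<open>The modules in the resolution are injective, so projectivity alone brings them
    under the hypothesis on \<open>E\<close>.\<close>
  have hom: "mod_hom A E (I i) = {zero_hom E (I i)}" if "projective_module A (I i)" for i
    using assms(4) that inj unfolding proj_inj_mods_def by blast
  note l0 = fg_left[OF projective_fg[OF proj(1)]] and l1 = fg_left[OF projective_fg[OF proj(2)]]
  note d0 = inj_resolutionD(2)[OF res, of 0, folded One_nat_def]
    and \<eta> = inj_resolutionD(3,4)[OF res]
  have ker: "\<eta> ` carrier A = {x \<in> carrier (I 0). d 0 x = \<zero>\<^bsub>I 1\<^esub>}"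
    using inj_resolutionD(5)[OF res] by (simp add: mod_ker_def)
  \<comment> \<open>The cokernel of \<open>\<eta>\<close> is taken as the image of
    \<open>d 0\<close>, which comes with its embedding into \<open>I 1\<close>.\<close>
  let ?C = "submod (I 1) (d 0 ` carrier (I 0))"
  have sC: "submodule (d 0 ` carrier (I 0)) A (I 1)"
    by (rule submodule_image[OF l0 l1 d0 left_module.submodule_carrier[OF l0]])
  note lC = left_module_submod[OF l1 sC]
  have dC: "lin A (I 0) ?C (d 0)" by (rule lin_submod_cod[OF d0]) blast
  have fgC: "fg_module A ?C" by (rule fg_surj[OF projective_fg[OF proj(1)] lC dC]) auto
  let ?G = "dsum2 column (inflation (I 0))"
  have P0: "projective_module B (inflation (I 0))" "injective_module B (inflation (I 0))"
    by (rule projective_inflation[OF proj(1)], rule injective_inflation[OF inj hom[OF proj(1)]])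
  have P1: "projective_module B (inflation (I 1))" "injective_module B (inflation (I 1))"
    by (rule projective_inflation[OF proj(2)], rule injective_inflation[OF inj hom[OF proj(2)]])
  note G = projective_dsum2[OF projective_column P0(1)] injective_dsum2[OF injective_column[OF assms(2)] P0(2)]
  \<comment> \<open>A matrix is its first column plus its lower right entry. The column is mapped
    identically, so the cokernel is that of \<open>\<eta>\<close>, inflated.\<close>
  let ?f = "\<lambda>b. ((\<lambda>(r, e, a). (r, e, \<zero>\<^bsub>A\<^esub>)) b, \<eta> (lower_right b))"
  have f: "lin B (regular_module B) ?G ?f"
    by (rule lin_pair[OF lin_column_proj lin_comp[OF lin_lower_right lin_inflation[OF \<eta>(1)]]])
  have fi: "inj_on ?f (carrier B)"
    using \<eta>(2) by (auto simp: inj_on_def ext_simps)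
  have g: "lin B ?G (inflation ?C) (\<lambda>p. d 0 (snd p))"
    by (rule lin_comp[OF lin_snd lin_inflation[OF dC]])
  have gs: "\<exists>x\<in>carrier ?G. d 0 (snd x) = y" if y: "y \<in> carrier (inflation ?C)" for y
  proof -
    obtain x where "x \<in> carrier (I 0)" "d 0 x = y" using y by auto
    moreover have "(zero_hom E E, \<zero>\<^bsub>E\<^esub>, \<zero>\<^bsub>A\<^esub>) \<in> carrier column" using zero_hom_in by (simp add: column_iff)
    ultimately show ?thesis by (intro bexI[of _ "((zero_hom E E, \<zero>\<^bsub>E\<^esub>, \<zero>\<^bsub>A\<^esub>), x)"]) simp_all
  qed
  have ex: "{x \<in> carrier ?G. d 0 (snd x) = \<zero>\<^bsub>inflation ?C\<^esub>} = ?f ` carrier B"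
  proof (intro equalityI subsetI)
    fix p assume "p \<in> {x \<in> carrier ?G. d 0 (snd x) = \<zero>\<^bsub>inflation ?C\<^esub>}"
    then obtain r e x where p: "p = ((r, e, \<zero>\<^bsub>A\<^esub>), x)" "r \<in> mod_hom A E E" "e \<in> carrier E"
      "x \<in> carrier (I 0)" "d 0 x = \<zero>\<^bsub>I 1\<^esub>"
      by (auto simp: column_iff)
    then have "x \<in> \<eta> ` carrier A" unfolding ker by simp
    then obtain a where "a \<in> carrier A" "x = \<eta> a" by blast
    then show "p \<in> ?f ` carrier B" using p by (intro image_eqI[of _ _ "(r, e, a)"]) (simp_all add: ext_simps)
  next
    fix p assume "p \<in> ?f ` carrier B"
    then obtain r e a where p: "p = ((r, e, \<zero>\<^bsub>A\<^esub>), \<eta> a)" "r \<in> mod_hom A E E" "e \<in> carrier E" "a \<in> carrier A"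
      by (auto simp: ext_simps)
    have "\<eta> a \<in> {x \<in> carrier (I 0). d 0 x = \<zero>\<^bsub>I 1\<^esub>}" unfolding ker[symmetric] using p(4) by blast
    then show "p \<in> {x \<in> carrier ?G. d 0 (snd x) = \<zero>\<^bsub>inflation ?C\<^esub>}"
      using p by (auto simp: column_iff)
  qed
  have h: "lin B (inflation ?C) (inflation (I 1)) (\<lambda>x. x)" by (rule lin_inflation[OF lin_incl[OF sC]])
  show ?thesis
    by (rule tilting_module_of_presentation[OF ring_B artinian_B_module[OF alg] G P1 fg_inflation[OF fgC]
          f fi g gs ex h]) simp_all
qed

end
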